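(* Let $0<\alpha<1$ and $T>0$, and let $v,w:[-1,1]\to\mathbb{R}$ be given functions, continuous on $[-1,1]$, with $v,w\in C^3(-1,1)$ and $v^{(4)},w^{(4)}\in L_2(-1,1)$. Consider the inverse source problem: find a pair of functions $\{U(t,x),h(x)\}$ satisfying the equation $${}_CD_{0t}^{\alpha}U(t,x)=\left[(1-x^2)U_x(t,x)\right]_x+h(x)$$ in the domain $\Omega=\{(t,x):\,-1<x<1,\ 0<t<T\}$, together with the initial condition $$U(0,x)=v(x),\quad -1\le x\le 1,$$ and the over-determining condition $$U(T,x)=w(x),\quad -1\le x\le 1,$$ such that $U$ and $U_x$ are bounded at $x=-1$ and $x=1$. Then a unique solution $\{U(t,x),h(x)\}$ to this inverse problem exists, and it can be written in the form $$U(t,x)=\frac{t^{\alpha}}{T^{\alpha}}(w_0-v_0)+v(x)+\sum_{n=1}^{\infty}\frac{1-E_\alpha(-\lambda_n t^\alpha)}{1-E_\alpha(-\lambda_n T^\alpha)}(w_n-v_n)P_n(x)$$ and $$h(x)=\frac{\Gamma(\alpha+1)}{T^{\alpha}}(w_0-v_0)-\frac{d}{dx}\left[(1-x^2)v'(x)\right]+\sum_{n=1}^{\infty}\lambda_n\frac{w_n-v_n}{1-E_\alpha(-\lambda_n T^\alpha)}P_n(x),$$ where $\lambda_n=n(n+1)$ and, for $n=0,1,2,\dots$, $$v_n=\frac{2n+1}{2}\int_{-1}^{1}v(x)P_n(x)\,dx,\qquad w_n=\frac{2n+1}{2}\int_{-1}^{1}w(x)P_n(x)\,dx.$$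
   Context: $\Gamma$ is Euler's gamma function. For $0<\alpha<1$, the Caputo fractional derivative of order $\alpha$ in $t$ is $${}_CD_{0t}^{\alpha}U(t,x)=\frac{1}{\Gamma(1-\alpha)}\int_0^t\frac{U_s(s,x)}{(t-s)^{\alpha}}\,ds,\quad t>0.$$ $E_\alpha(z)=E_{\alpha,1}(z)=\sum_{k=0}^{\infty}\frac{z^k}{\Gamma(\alpha k+1)}$ is the Mittag-Leffler function. $P_n(x)=\frac{1}{2^n n!}\frac{d^n}{dx^n}(x^2-1)^n$, $n=0,1,2,\dots$, are the Legendre polynomials. Subscripts $x$ and $s$ on $U$ denote partial derivatives. *)

theory Defs
  imports "HOL-Analysis.Analysis"
begin

definition mittag_leffler :: "real \<Rightarrow> real \<Rightarrow> real" where
  "mittag_leffler \<alpha> z = (\<Sum>k. z ^ k / Gamma (\<alpha> * real k + 1))"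

definition legendre_P :: "nat \<Rightarrow> real \<Rightarrow> real" where
  "legendre_P n x = (deriv ^^ n) (\<lambda>y. (y\<^sup>2 - 1) ^ n) x / (2 ^ n * fact n)"

definition legendre_coeff :: "(real \<Rightarrow> real) \<Rightarrow> nat \<Rightarrow> real" where
  "legendre_coeff f n = (2 * real n + 1) / 2 * (LBINT x:{-1..1}. f x * legendre_P n x)"

definition legendre_eigenvalue :: "nat \<Rightarrow> real" where
  "legendre_eigenvalue n = real n * (real n + 1)"

definition legendre_op :: "(real \<Rightarrow> real) \<Rightarrow> real \<Rightarrow> real" where
  "legendre_op f x = deriv (\<lambda>y. (1 - y\<^sup>2) * deriv f y) x"

text \<open>Both \<^const>\<open>deriv\<close> and the Lebesgue integral are total, so that the existence of the
  Caputo derivative has to be recorded separately.\<close>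

definition caputo_exists :: "real \<Rightarrow> (real \<Rightarrow> real) \<Rightarrow> real \<Rightarrow> bool" where
  "caputo_exists \<alpha> u t \<longleftrightarrow>
     (\<forall>s\<in>{0<..<t}. u differentiable (at s)) \<and>
     set_integrable lborel {0<..<t} (\<lambda>s. deriv u s / (t - s) powr \<alpha>)"

definition caputo :: "real \<Rightarrow> (real \<Rightarrow> real) \<Rightarrow> real \<Rightarrow> real" where
  "caputo \<alpha> u t = 1 / Gamma (1 - \<alpha>) * (LBINT s:{0<..<t}. deriv u s / (t - s) powr \<alpha>)"

definition C_k_on :: "nat \<Rightarrow> real set \<Rightarrow> (real \<Rightarrow> real) \<Rightarrow> bool" where
  "C_k_on k S f \<longleftrightarrow>
     (\<forall>j<k. \<forall>x\<in>S. (deriv ^^ j) f differentiable (at x)) \<and> continuous_on S ((deriv ^^ k) f)"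

text \<open>The derivative of \<open>f\<close> belongs to \<open>L\<^sub>2(a,b)\<close> in the usual (Sobolev) sense: \<open>f\<close> is locally
  absolutely continuous on \<open>(a,b)\<close>, i.e. an indefinite Lebesgue integral of its a.e. derivative
  \<open>g\<close>, and \<open>g\<close> is square integrable. Mere a.e. differentiability would admit Cantor-type
  functions.\<close>

definition deriv_in_L2 :: "real \<Rightarrow> real \<Rightarrow> (real \<Rightarrow> real) \<Rightarrow> bool" where
  "deriv_in_L2 a b f \<longleftrightarrow>
     (\<exists>g. set_borel_measurable lborel {a<..<b} g \<and>
          set_integrable lborel {a<..<b} (\<lambda>x. (g x)\<^sup>2) \<and>
          (\<forall>c d. a < c \<and> c \<le> d \<and> d < b \<longrightarrow> f d - f c = (LBINT x:{c..d}. g x)))"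

text \<open>Classical solutions: \<open>U\<close> is continuous on the closed rectangle, so that the conditions at
  \<open>t = 0\<close> and \<open>t = T\<close> are attained continuously; every derivative occurring in the equation exists
  at every point of the open rectangle; and the terms of the equation are continuous there
  (continuity of the Caputo derivative follows from that of the right-hand side).
  Boundedness at \<open>x = -1\<close> and \<open>x = 1\<close> means boundedness on a one-sided neighbourhood of each of
  these lines, uniformly in \<open>t\<close>. The value of \<open>h\<close> matters on \<open>(-1,1)\<close> only.\<close>

definition inverse_source_solution ::
  "real \<Rightarrow> real \<Rightarrow> (real \<Rightarrow> real) \<Rightarrow> (real \<Rightarrow> real) \<Rightarrow>
   (real \<Rightarrow> real \<Rightarrow> real) \<Rightarrow> (real \<Rightarrow> real) \<Rightarrow> bool" where
  "inverse_source_solution \<alpha> T v w U h \<longleftrightarrow>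
     continuous_on ({0..T} \<times> {-1..1}) (\<lambda>(t, x). U t x) \<and>
     continuous_on ({0<..<T} \<times> {-1<..<1}) (\<lambda>(t, x). legendre_op (U t) x) \<and>
     continuous_on {-1<..<1} h \<and>
     (\<forall>t\<in>{0<..<T}. \<forall>x\<in>{-1<..<1}.
        caputo_exists \<alpha> (\<lambda>s. U s x) t \<and>
        U t differentiable (at x) \<and>
        (\<lambda>y. (1 - y\<^sup>2) * deriv (U t) y) differentiable (at x) \<and>
        caputo \<alpha> (\<lambda>s. U s x) t = legendre_op (U t) x + h x) \<and>
     (\<forall>x\<in>{-1..1}. U 0 x = v x) \<and>
     (\<forall>x\<in>{-1..1}. U T x = w x) \<and>
     (\<exists>\<delta>>0. \<exists>M. \<forall>t\<in>{0<..<T}. \<forall>x\<in>{-1<..<1}. 1 - \<delta> < \<bar>x\<bar> \<longrightarrow>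
        \<bar>U t x\<bar> \<le> M \<and> \<bar>deriv (U t) x\<bar> \<le> M)"

end

theory Submission imports Defs begin

text \<open>Existence: expand in Legendre polynomials. Four integrations by parts, the last one against the
  \<open>L\<^sub>2\<close> derivative, show that \<open>\<lambda>\<^sub>n (w\<^sub>n - v\<^sub>n)\<close> is absolutely summable.
      Since \<open>\<bar>P\<^sub>n\<bar> \<le> 1\<close>,
  \<open>\<bar>P\<^sub>n'\<bar> \<le> \<lambda>\<^sub>n / 2\<close> and \<open>0 \<le> E\<^sub>\<alpha> (- x) \<le> 1\<close>
      with \<open>E\<^sub>\<alpha> (- x)\<close> decreasing, this sequence majorizes all series
  that occur, and they may be differentiated and convolved term by term.

  Uniqueness: let \<open>u\<close> solve the homogeneous problem. Integrate the equation over \<open>[t\<^sub>1, t\<^sub>2]\<close>, which turns the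
  Caputo derivative into differences of \<open>J\<^bsup>1-\<alpha>\<^esup> u\<close>, multiply by \<open>P\<^sub>n\<close>,
      integrate over \<open>[-b, b]\<close> and let
  \<open>b \<rightarrow> 1\<close>; no integrability of \<open>h\<close> is needed, because every other term has a limit.
  The coefficients \<open>y\<^sub>n\<close> of \<open>u\<close> then satisfy \<open>J\<^bsup>1-\<alpha>\<^esup> y\<^sub>n +
      \<lambda>\<^sub>n J\<^bsup>1\<^esup> y\<^sub>n = H t\<close>, so that
  \<open>y\<^sub>n (t) = H t\<^bsup>\<alpha>\<^esup> E\<^bsub>\<alpha>,\<alpha>+1\<^esub> (- \<lambda>\<^sub>n
      t\<^bsup>\<alpha>\<^esup>)\<close>. This is nonzero at \<open>T\<close> unless \<open>H = 0\<close>.\<close>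

section \<open>Legendre polynomials\<close>

text \<open>Behaviour of the data at x = -1, 1: only continuity is assumed, but an L2 fourth
  derivative is integrable on the bounded interval, so the first three derivatives extend
  continuously to [-1,1]. Hence all boundary terms die against the factor 1 - x^2, and U_x is
  bounded. Signs: E_{a,a}(-x) >= 0 is the one hard fact about Mittag-Leffler functions. Convolution
  with positive kernels, the recursion in the second parameter and the derivative formula then give
  the bounds and monotonicity, the strict inequality E_a(-x) < 1 for x > 0, and E_{a,a+1}(-x) > 0.
  In particular every denominator 1 - E_a(-lambda_n T^a) is at least the one for n = 1. Uniqueness:
  the terms of the equation are continuous on the open rectangle only, so time and space integrals
  can be exchanged only on [t1,t2] x [-b,b] with t1 > 0 and b < 1. This forces two limits: b -> 1
  comes first, and only for the resulting scalar equation t1 -> 0, where J^{1-a} y_n tends to 0. The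
  constant H exists and does not depend on the times because h is independent of t: the integrals of
  h P_n over [-b,b] enter only multiplied by t2 - t1.\<close>

lemmas pCons_mult = mult_pCons_left mult_pCons_right

section \<open>Legendre's differential equation from Rodrigues' formula\<close>

lemma poly_ext_real: "(\<And>x. poly p x = poly q x) \<Longrightarrow> p = (q :: real poly)"
  by (simp flip: poly_eq_poly_eq_iff add: fun_eq_iff)

text \<open>Leibniz' rule for a factor of degree one: only two of its terms survive.\<close>

lemma higher_pderiv_X:
  "(pderiv ^^ Suc m) ([:0, 1:] * q) = [:0, 1::real:] * (pderiv ^^ Suc m) q + smult (real (Suc m)) ((pderiv ^^ m) q)"
proof (induction m)
  case 0
  then show ?case by (simp add: pderiv_mult pderiv_pCons)
next
  case (Suc m)
  have "(pderiv ^^ Suc (Suc m)) ([:0, 1:] * q) = pderiv ((pderiv ^^ Suc m) ([:0, 1:] * q))" by simp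
  also have "\<dots> = pderiv ([:0, 1::real:] * (pderiv ^^ Suc m) q + smult (real (Suc m)) ((pderiv ^^ m) q))"
    by (subst Suc) simp
  also have "\<dots> = [:0, 1::real:] * (pderiv ^^ Suc (Suc m)) q + smult (real (Suc (Suc m))) ((pderiv ^^ Suc m) q)"
    by (intro poly_ext_real) (simp add: pderiv_mult pderiv_add pderiv_smult pderiv_pCons algebra_simps del: pCons_mult)
  finally show ?case .
qed

text \<open>Leibniz' rule again; a quadratic factor leaves three terms.\<close>

lemma higher_pderiv_X2:
  "(pderiv ^^ Suc (Suc m)) ([:- 1, 0, 1:] * q) = [:- 1, 0, 1::real:] * (pderiv ^^ Suc (Suc m)) q
    + smult (2 * real (Suc (Suc m))) ([:0, 1:] * (pderiv ^^ Suc m) q)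
    + smult (real (Suc (Suc m)) * real (Suc m)) ((pderiv ^^ m) q)"
proof (induction m)
  case 0
  then show ?case by (intro poly_ext_real) (simp add: pderiv_mult pderiv_add pderiv_smult pderiv_pCons algebra_simps del: pCons_mult)
next
  case (Suc m)
  have "(pderiv ^^ Suc (Suc (Suc m))) ([:- 1, 0, 1:] * q) = pderiv ((pderiv ^^ Suc (Suc m)) ([:- 1, 0, 1:] * q))" by simp
  also have "\<dots> = pderiv ([:- 1, 0, 1::real:] * (pderiv ^^ Suc (Suc m)) q
    + smult (2 * real (Suc (Suc m))) ([:0, 1:] * (pderiv ^^ Suc m) q)
    + smult (real (Suc (Suc m)) * real (Suc m)) ((pderiv ^^ m) q))"
    by (subst Suc) simp
  also have "\<dots> = [:- 1, 0, 1::real:] * (pderiv ^^ Suc (Suc (Suc m))) q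
    + smult (2 * real (Suc (Suc (Suc m)))) ([:0, 1:] * (pderiv ^^ Suc (Suc m)) q)
    + smult (real (Suc (Suc (Suc m))) * real (Suc (Suc m))) ((pderiv ^^ Suc m) q)"
    by (intro poly_ext_real) (simp add: pderiv_mult pderiv_add pderiv_smult pderiv_pCons algebra_simps del: pCons_mult)
  finally show ?case .
qed

text \<open>Rodrigues' formula carried out in \<open>real poly\<close>, where differentiation is the
  algebraic operation \<open>pderiv\<close> and needs no differentiability conditions.\<close>

definition legendre_poly :: "nat \<Rightarrow> real poly" where
  "legendre_poly n = smult (1 / (2 ^ n * fact n)) ((pderiv ^^ n) ([:- 1, 0, 1:] ^ n))"

lemma deriv_funpow_poly: "(deriv ^^ n) (poly p) = poly ((pderiv ^^ n) (p :: real poly))"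
proof (induction n)
  case (Suc n)
  then show ?case by (auto intro!: DERIV_imp_deriv)
qed simp

lemma legendre_P_poly: "legendre_P n = poly (legendre_poly n)"
proof
  fix x
  have "(\<lambda>y. (y\<^sup>2 - 1) ^ n) = poly ([:- 1, 0, 1::real:] ^ n)"
    by (auto simp: fun_eq_iff poly_power power2_eq_square)
  then show "legendre_P n x = poly (legendre_poly n) x"
    by (simp add: legendre_P_def legendre_poly_def deriv_funpow_poly)
qed

lemma degree_legendre_poly: "degree (legendre_poly n) = n"
  by (simp add: legendre_poly_def degree_higher_pderiv degree_power_eq)

definition legendre_L :: "real poly \<Rightarrow> real poly" where
  "legendre_L p = pderiv ([:1, 0, - 1:] * pderiv p)"

text \<open>The power u = (x^2 - 1)^n satisfies (x^2 - 1) u' = 2 n x u. Differentiating this n + 1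
  times by the two Leibniz rules gives Legendre's equation for the n-th derivative of u.\<close>

lemma legendre_ode:
  "legendre_L (legendre_poly n) = smult (- legendre_eigenvalue n) (legendre_poly n)"
proof (cases n)
  case 0
  then show ?thesis by (simp add: legendre_L_def legendre_poly_def legendre_eigenvalue_def)
next
  case (Suc m)
  define u where "u = [:- 1, 0, 1::real:] ^ n"
  have u': "[:- 1, 0, 1:] * pderiv u = smult (2 * real n) ([:0, 1:] * u)"
    unfolding u_def Suc pderiv_power_Suc
    by (intro poly_ext_real) (simp add: pderiv_pCons algebra_simps del: of_nat_Suc mult_pCons_left)
  have "(pderiv ^^ Suc (Suc m)) ([:- 1, 0, 1:] * pderiv u)
     = (pderiv ^^ Suc n) (smult (2 * real n) ([:0, 1:] * u))"
    unfolding u' Suc ..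
  then have eq: "[:- 1, 0, 1::real:] * (pderiv ^^ Suc (Suc n)) u
    + smult (2 * real (Suc n)) ([:0, 1:] * (pderiv ^^ Suc n) u)
    + smult (real (Suc n) * real n) ((pderiv ^^ n) u) =
     smult (2 * real n) ([:0, 1::real:] * (pderiv ^^ Suc n) u + smult (real (Suc n)) ((pderiv ^^ n) u))"
    unfolding higher_pderiv_X2 higher_pderiv_smult higher_pderiv_X Suc
    by (simp del: funpow.simps add: funpow_Suc_right)
  have "legendre_L ((pderiv ^^ n) u) = smult (- legendre_eigenvalue n) ((pderiv ^^ n) u)"
  proof (rule poly_ext_real)
    fix x
    from arg_cong[OF eq, of "\<lambda>p. poly p x"]
    show "poly (legendre_L ((pderiv ^^ n) u)) x = poly (smult (- legendre_eigenvalue n) ((pderiv ^^ n) u)) x"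
      by (simp add: legendre_L_def pderiv_mult pderiv_pCons legendre_eigenvalue_def algebra_simps del: pCons_mult)
  qed
  then show ?thesis
    by (simp add: legendre_poly_def legendre_L_def pderiv_smult mult.commute flip: u_def)
qed

section \<open>Values at the end points and uniform bounds\<close>

text \<open>Taylor's formula: differentiation commutes with the translation by \<open>a\<close>, so
  the derivative can be read off at 0.\<close>

lemma higher_pderiv_at: "poly ((pderiv ^^ n) p) a = fact n * coeff (pcompose p [:a, 1::real:]) n"
proof -
  have "(pderiv ^^ k) (pcompose p [:a, 1:]) = pcompose ((pderiv ^^ k) p) [:a, 1:]" for k
    by (induction k) (simp_all add: pderiv_pcompose pderiv_pCons one_pCons[symmetric])
  from arg_cong[OF this, of "\<lambda>q. coeff q 0" n] show ?thesis
    by (simp add: coeff_higher_pderiv flip: poly_0_coeff_0 pochhammer_fact)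
       (simp add: coeff_higher_pderiv poly_0_coeff_0 poly_pcompose pochhammer_fact)
qed

lemma coeff_X_power_mult: "coeff ([:0, 1::real:] ^ n * q) n = poly q 0"
  by (simp add: coeff_monom_mult monom_altdef[of "1::real", simplified, symmetric] poly_0_coeff_0)

lemma pcompose_power: "pcompose (p ^ n) q = pcompose p q ^ n"
  for p q :: "'a :: comm_semiring_1 poly"
  by (induction n) (simp_all add: pcompose_mult pcompose_1)

text \<open>In the variable z = x - 1 the power (x^2 - 1)^n is z^n (z + 2)^n. Its coefficient at z^n
  is 2^n, which the normalisation cancels.\<close>

lemma legendre_P_1: "legendre_P n 1 = 1"
proof -
  have "pcompose ([:- 1, 0, 1:] ^ n) [:1, 1::real:] = ([:0, 1:] * [:2, 1:]) ^ n"
    by (simp add: pcompose_power pcompose_pCons)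
  then show ?thesis
    by (simp add: legendre_P_poly legendre_poly_def higher_pderiv_at power_mult_distrib coeff_X_power_mult
        poly_power del: pCons_mult)
qed

lemma legendre_P_minus_1: "legendre_P n (- 1) = (- 1) ^ n"
proof -
  have "pcompose ([:- 1, 0, 1:] ^ n) [:- 1, 1::real:] = ([:0, 1:] * [:- 2, 1:]) ^ n"
    by (simp add: pcompose_power pcompose_pCons)
  then show ?thesis
    by (simp add: legendre_P_poly legendre_poly_def higher_pderiv_at power_mult_distrib coeff_X_power_mult
        poly_power power_minus[of "2::real"] del: pCons_mult)
qed

lemma continuous_on_legendre_P [continuous_intros]: "continuous_on A (legendre_P n)"
  unfolding legendre_P_poly by (intro continuous_intros)

lemma has_real_derivative_legendre_P:
  "(legendre_P n has_real_derivative poly (pderiv (legendre_poly n)) x) (at x within A)"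
  unfolding legendre_P_poly by (rule has_field_derivative_at_within) (rule poly_DERIV)

lemma legendre_ode_at:
  fixes n x
  defines "Q \<equiv> pderiv (legendre_poly n)"
  shows "(1 - x\<^sup>2) * poly (pderiv Q) x - 2 * x * poly Q x = - legendre_eigenvalue n * legendre_P n x"
  using arg_cong[OF legendre_ode, of "\<lambda>p. poly p x" n]
  by (simp add: legendre_L_def Q_def pderiv_mult pderiv_pCons legendre_P_poly algebra_simps power2_eq_square
      del: pCons_mult)

text \<open>The reason is that \<open>q\<^sup>2 + (1 - x\<^sup>2) q'\<^sup>2 / \<mu>\<close> is monotone in \<open>\<bar>x\<bar>\<close>.\<close>

lemma poly_le_ends:
  fixes q :: "real poly"
  assumes ode: "\<And>x. (1 - x\<^sup>2) * poly (pderiv (pderiv q)) x - 2 * c * x * poly (pderiv q) x = - \<mu> * poly q x"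
    and c: "1 / 2 \<le> c" and \<mu>: "0 < \<mu>"
    and ends: "(poly q 1)\<^sup>2 = M\<^sup>2" "(poly q (- 1))\<^sup>2 = M\<^sup>2" "0 \<le> M"
    and x: "x \<in> {-1..1}"
  shows "\<bar>poly q x\<bar> \<le> M"
proof -
  \<comment> \<open>The equation turns the derivative of \<open>F\<close> into (4c - 2) x q'^2 /
    \<mu>, so c >= 1/2 gives it the sign of x. At both end points \<open>F\<close> equals M^2. The
    instances used below are c = 1 for P_n and c = 2 for P_n'.\<close>
  define F where "F x = (poly q x)\<^sup>2 + (1 - x\<^sup>2) * (poly (pderiv q) x)\<^sup>2 / \<mu>" for x
  have F': "(F has_real_derivative (4 * c - 2) * x * (poly (pderiv q) x)\<^sup>2 / \<mu>) (at x)" for x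
  proof -
    have *: "\<mu> * poly q x = 2 * c * x * poly (pderiv q) x - (1 - x\<^sup>2) * poly (pderiv (pderiv q)) x"
      using ode[of x] by simp
    have "(F has_real_derivative 2 * poly q x * poly (pderiv q) x + 
        ((- 2 * x) * (poly (pderiv q) x)\<^sup>2 + (1 - x\<^sup>2) * (2 * poly (pderiv q) x * poly (pderiv (pderiv q)) x)) / \<mu>) (at x)"
      unfolding F_def using \<mu> by (auto intro!: derivative_eq_intros)
    also have "2 * poly q x * poly (pderiv q) x + 
        ((- 2 * x) * (poly (pderiv q) x)\<^sup>2 + (1 - x\<^sup>2) * (2 * poly (pderiv q) x * poly (pderiv (pderiv q)) x)) / \<mu>
      = (2 * (\<mu> * poly q x) * poly (pderiv q) x + 
        ((- 2 * x) * (poly (pderiv q) x)\<^sup>2 + (1 - x\<^sup>2) * (2 * poly (pderiv q) x * poly (pderiv (pderiv q)) x))) / \<mu>"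
      using \<mu> by (simp add: field_simps)
    also have "\<dots> = (4 * c - 2) * x * (poly (pderiv q) x)\<^sup>2 / \<mu>"
      unfolding * using \<mu> by (simp add: field_simps power2_eq_square)
    finally show ?thesis .
  qed
  have "F x \<le> M\<^sup>2"
  proof (cases "0 \<le> x")
    case True
    have "F x \<le> F 1"
    proof (rule DERIV_nonneg_imp_nondecreasing[of x 1 F])
      show "\<exists>z. (F has_real_derivative z) (at y) \<and> 0 \<le> z" if "x \<le> y" "y \<le> 1" for y
        using F'[of y] that True c \<mu> by (intro exI[of _ "(4 * c - 2) * y * (poly (pderiv q) y)\<^sup>2 / \<mu>"] conjI) auto
    qed (use x in auto)
    then show ?thesis using ends by (simp add: F_def)
  next
    case False
    have "F x \<le> F (- 1)"
    proof (rule DERIV_nonpos_imp_nonincreasing[of "- 1" x F])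
      show "\<exists>z. (F has_real_derivative z) (at y) \<and> z \<le> 0" if "- 1 \<le> y" "y \<le> x" for y
        using F'[of y] that False c \<mu> 
        by (intro exI[of _ "(4 * c - 2) * y * (poly (pderiv q) y)\<^sup>2 / \<mu>"] conjI divide_nonpos_pos mult_nonpos_nonneg[OF
            mult_nonneg_nonpos]) auto
    qed (use x in auto)
    then show ?thesis using ends by (simp add: F_def)
  qed
  moreover have "0 \<le> (1 - x\<^sup>2) * (poly (pderiv q) x)\<^sup>2 / \<mu>"
    using \<mu> x by (intro divide_nonneg_pos mult_nonneg_nonneg) (auto simp: abs_square_le_1)
  ultimately have "(poly q x)\<^sup>2 \<le> M\<^sup>2" unfolding F_def by linarith
  then show ?thesis using ends(3) by (metis abs_le_square_iff abs_of_nonneg)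
qed

lemma legendre_eigenvalue_pos: "0 < n \<Longrightarrow> 0 < legendre_eigenvalue n"
  by (simp add: legendre_eigenvalue_def)

lemma abs_legendre_P_le: "\<bar>legendre_P n x\<bar> \<le> 1" if "x \<in> {-1..1}"
proof (cases "n = 0")
  case True
  then show ?thesis by (simp add: legendre_P_def)
next
  case False
  have "(legendre_P n (-1))\<^sup>2 = 1" by (simp add: legendre_P_minus_1 flip: power_mult)
  with False that show ?thesis
    using poly_le_ends[of "legendre_poly n" 1 "legendre_eigenvalue n" 1 x] legendre_ode_at[of _ n] legendre_P_1[of n]
    by (simp add: legendre_P_poly legendre_eigenvalue_pos)
qed

text \<open>Differentiating Legendre's equation gives an equation of the same type for P_n', with c
  = 2 and \<mu> = lambda_n - 2. Legendre's equation at x = 1 and x = -1, where the second derivative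
  drops out, supplies the end values of modulus lambda_n / 2. Positivity of \<mu> requires n >= 2;
  the cases n = 0, 1 are checked directly.\<close>

lemma abs_legendre_P'_le:
  assumes "x \<in> {-1..1}"
  shows "\<bar>poly (pderiv (legendre_poly n)) x\<bar> \<le> legendre_eigenvalue n / 2"
proof -
  define Q where "Q = pderiv (legendre_poly n)"
  have ode: "(1 - x\<^sup>2) * poly (pderiv Q) x - 2 * x * poly Q x = - legendre_eigenvalue n * poly (legendre_poly n) x" for x
    using legendre_ode_at[of x n] by (simp add: Q_def legendre_P_poly)
  have Q1: "poly Q 1 = legendre_eigenvalue n / 2" "poly Q (-1) = - (legendre_eigenvalue n * (- 1) ^ n) / 2"
    using ode[of 1] ode[of "-1"] legendre_P_1[of n] legendre_P_minus_1[of n] by (auto simp: legendre_P_poly)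
  then have ends: "poly Q 1 = legendre_eigenvalue n / 2" "(poly Q (-1))\<^sup>2 = (legendre_eigenvalue n / 2)\<^sup>2"
    by (simp_all add: power_divide power_mult_distrib flip: power_mult)
  have "[:1, 0, -1:] * pderiv Q - [:0, 2:] * Q = smult (- legendre_eigenvalue n) (legendre_poly n)"
    by (intro poly_ext_real) (use ode in \<open>simp add: power2_eq_square algebra_simps\<close>)
  then have "pderiv ([:1, 0, -1:] * pderiv Q - [:0, 2:] * Q) = smult (- legendre_eigenvalue n) Q"
    by (simp only: pderiv_smult Q_def)
  from arg_cong[OF this, of "\<lambda>p. poly p x" for x]
  have ode': "(1 - x\<^sup>2) * poly (pderiv (pderiv Q)) x - 2 * 2 * x * poly (pderiv Q) x = - (legendre_eigenvalue n - 2) * poly Q x" for x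
    by (simp add: pderiv_mult pderiv_diff pderiv_pCons power2_eq_square algebra_simps del: pCons_mult)
  consider "n = 0" | "n = 1" | "n \<ge> 2" by linarith
  then show ?thesis
  proof cases
    case 1
    then show ?thesis using ends by (simp add: legendre_poly_def legendre_eigenvalue_def)
  next
    case 2
    then have "degree Q = 0" by (simp add: Q_def degree_pderiv degree_legendre_poly)
    then obtain a where "Q = [:a:]" by (rule degree_eq_zeroE)
    then show ?thesis using ends 2 unfolding Q_def[symmetric] by (simp add: legendre_eigenvalue_def)
  next
    case 3
    then have "2 * 3 \<le> real n * (real n + 1)" by (intro mult_mono) auto
    then have "0 < legendre_eigenvalue n - 2" by (simp add: legendre_eigenvalue_def)
    from poly_le_ends[OF ode' _ this _ ends(2) _ assms] ends(1) show ?thesis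
      using legendre_eigenvalue_pos[of n] 3 by (simp add: Q_def)
  qed
qed

section \<open>Orthogonality, norms and completeness\<close>

text \<open>Green's formula: the boundary function carries the factor 1 - x^2, which vanishes at
  both ends.\<close>

lemma integral_legendre_L_symmetric:
  "integral {-1..1} (\<lambda>x. poly (legendre_L p) x * poly q x) = integral {-1..1} (\<lambda>x. poly p x * poly (legendre_L q) x)"
proof -
  define F where "F x = (1 - x\<^sup>2) * (poly (pderiv p) x * poly q x - poly p x * poly (pderiv q) x)" for x
  have "((\<lambda>x. poly (legendre_L p) x * poly q x - poly p x * poly (legendre_L q) x) has_integral F 1 - F (- 1)) {-1..1}"
  proof (rule fundamental_theorem_of_calculus)
    fix x :: real
    have "(F has_real_derivative (- 2 * x) * (poly (pderiv p) x * poly q x - poly p x * poly (pderiv q) x)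
       + (1 - x\<^sup>2) * (poly (pderiv (pderiv p)) x * poly q x - poly p x * poly (pderiv (pderiv q)) x)) (at x)"
      unfolding F_def by (auto intro!: derivative_eq_intros simp: algebra_simps)
    also have "(- 2 * x) * (poly (pderiv p) x * poly q x - poly p x * poly (pderiv q) x)
       + (1 - x\<^sup>2) * (poly (pderiv (pderiv p)) x * poly q x - poly p x * poly (pderiv (pderiv q)) x)
      = poly (legendre_L p) x * poly q x - poly p x * poly (legendre_L q) x"
      by (simp add: legendre_L_def pderiv_mult pderiv_pCons power2_eq_square algebra_simps
          del: pCons_mult)
    finally show "(F has_vector_derivative poly (legendre_L p) x * poly q x - poly p x * poly (legendre_L q) x) (at x within {-1..1})"
      by (simp add: has_field_derivative_at_within flip: has_real_derivative_iff_has_vector_derivative)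
  qed simp
  then have "integral {-1..1} (\<lambda>x. poly (legendre_L p) x * poly q x - poly p x * poly (legendre_L q) x) = 0"
    by (simp add: F_def has_integral_iff)
  then show ?thesis
    by (subst (asm) integral_diff) (auto intro!: integrable_continuous_real continuous_intros)
qed

lemma legendre_eigenvalue_inj: "legendre_eigenvalue n = legendre_eigenvalue m \<Longrightarrow> n = m"
proof (induction n m rule: linorder_wlog)
  case (le n m)
  show ?case
  proof (rule ccontr)
    assume "n \<noteq> m"
    with le have "real n < real m" by simp
    then have "legendre_eigenvalue n < legendre_eigenvalue m"
      unfolding legendre_eigenvalue_def by (intro mult_strict_mono) auto
    with le show False by simp
  qed
qed auto

text \<open>Eigenfunctions of a symmetric operator for distinct eigenvalues.\<close>

lemma legendre_P_orthogonal:
  assumes "n \<noteq> m"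
  shows "integral {-1..1} (\<lambda>x. legendre_P n x * legendre_P m x) = 0"
proof -
  let ?I = "integral {-1..1} (\<lambda>x. legendre_P n x * legendre_P m x)"
  have "legendre_eigenvalue n * ?I = legendre_eigenvalue m * ?I"
    using integral_legendre_L_symmetric[of "legendre_poly n" "legendre_poly m"]
    by (simp add: legendre_ode mult.assoc mult.left_commute[of _ "legendre_eigenvalue m"] flip: legendre_P_poly)
  with assms legendre_eigenvalue_inj show ?thesis by auto
qed

text \<open>The P_m with m < N span the polynomials of degree below N: a suitable multiple of P_N
  removes the coefficient at x^N, and induction handles the rest. The alternative
  \<open>p = 0\<close> covers N = 0, since the zero polynomial has \<open>degree\<close> 0.\<close>

lemma integral_poly_eq_0:
  fixes \<phi> :: "real \<Rightarrow> real"
  assumes \<phi>: "continuous_on {-1..1} \<phi>"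
    and "\<And>m. m < N \<Longrightarrow> integral {-1..1} (\<lambda>x. \<phi> x * legendre_P m x) = 0"
    and "p = 0 \<or> degree p < N"
  shows "integral {-1..1} (\<lambda>x. \<phi> x * poly p x) = 0"
  using assms(2,3)
proof (induction N arbitrary: p)
  case (Suc N)
  define c where "c = coeff p N / coeff (legendre_poly N) N"
  define q where "q = p - smult c (legendre_poly N)"
  have "coeff (legendre_poly N) N \<noteq> 0"
    using leading_coeff_0_iff[of "legendre_poly N"] legendre_P_1[of N]
    by (auto simp: degree_legendre_poly legendre_P_poly)
  then have "coeff q N = 0" by (simp add: q_def c_def)
  moreover have "degree q \<le> N"
    using Suc.prems(2) by (auto simp: q_def degree_legendre_poly intro!: degree_diff_le degree_smult_le[THEN order_trans])
  ultimately have "q = 0 \<or> degree q < N"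
    using leading_coeff_0_iff[of q] by (cases "degree q = N") auto
  from Suc.IH[OF _ this] Suc.prems(1) have "integral {-1..1} (\<lambda>x. \<phi> x * poly q x) = 0" by simp
  moreover have "integral {-1..1} (\<lambda>x. \<phi> x * poly p x) =
     integral {-1..1} (\<lambda>x. \<phi> x * poly q x + c * (\<phi> x * legendre_P N x))"
    by (simp add: q_def legendre_P_poly algebra_simps)
  moreover have "\<dots> = integral {-1..1} (\<lambda>x. \<phi> x * poly q x) + c * integral {-1..1} (\<lambda>x. \<phi> x * legendre_P N x)"
    by (subst integral_add) (auto intro!: integrable_continuous_real continuous_intros \<phi>)
  ultimately show ?case using Suc.prems(1)[of N] by simp
qed auto

text \<open>The polynomial r = x P_n' - n P_n has degree below n, hence is orthogonal to P_n. The
  derivative of x P_n^2 / 2 is P_n r + (n + 1/2) P_n^2, and its integral over [-1,1] is 1 because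
  P_n^2 = 1 at both ends.\<close>

lemma integral_legendre_P_square: "integral {-1..1} (\<lambda>x. (legendre_P n x)\<^sup>2) = 2 / (2 * real n + 1)"
proof -
  let ?P = "legendre_poly n"
  define r where "r = [:0, 1:] * pderiv ?P - smult (real n) ?P"
  have "coeff r n = 0"
    by (cases n) (auto simp: r_def coeff_pderiv coeff_pCons)
  moreover have "degree r \<le> n"
  proof -
    have "degree ([:0, 1:] * pderiv ?P) \<le> n"
    proof (cases "n = 0")
      case True
      then have "pderiv ?P = 0" by (simp add: pderiv_eq_0_iff degree_legendre_poly)
      then show ?thesis by simp
    next
      case False
      then have "pderiv ?P \<noteq> 0" by (simp add: pderiv_eq_0_iff degree_legendre_poly)
      with False show ?thesis by (subst degree_mult_eq) (auto simp: degree_pderiv degree_legendre_poly)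
    qed
    then show ?thesis
      unfolding r_def by (intro degree_diff_le) (auto simp: degree_legendre_poly intro: degree_smult_le[THEN order_trans])
  qed
  ultimately have "r = 0 \<or> degree r < n"
    using leading_coeff_0_iff[of r] by (cases "degree r = n") auto
  with legendre_P_orthogonal[of n] have 0: "integral {-1..1} (\<lambda>x. legendre_P n x * poly r x) = 0"
    by (intro integral_poly_eq_0[of _ n]) (auto intro!: continuous_intros)
  have "((\<lambda>x. legendre_P n x * poly r x + (real n + 1 / 2) * (legendre_P n x)\<^sup>2) has_integral
      1 * (legendre_P n 1)\<^sup>2 / 2 - (- 1) * (legendre_P n (-1))\<^sup>2 / 2) {-1..1}"
  proof (rule fundamental_theorem_of_calculus)
    fix x :: real
    have "((\<lambda>x. x * (poly ?P x)\<^sup>2 / 2) has_real_derivative poly ?P x * poly r x + (real n + 1 / 2) * (poly ?P x)\<^sup>2) (at x)"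
      by (auto intro!: derivative_eq_intros simp: r_def algebra_simps power2_eq_square)
    then show "((\<lambda>x. x * (legendre_P n x)\<^sup>2 / 2) has_vector_derivative legendre_P n x * poly r x + (real n + 1 / 2)
        * (legendre_P n x)\<^sup>2) (at x within {-1..1})"
      by (simp add: has_field_derivative_at_within legendre_P_poly flip: has_real_derivative_iff_has_vector_derivative)
  qed simp
  then have "integral {-1..1} (\<lambda>x. legendre_P n x * poly r x + (real n + 1 / 2) * (legendre_P n x)\<^sup>2) = 1"
    by (simp add: has_integral_iff legendre_P_1 legendre_P_minus_1 flip: power_mult)
  then have "(real n + 1 / 2) * integral {-1..1} (\<lambda>x. (legendre_P n x)\<^sup>2) = 1"
    by (subst (asm) integral_add) (auto intro!: integrable_continuous_real continuous_intros simp: 0)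
  then show ?thesis by (simp add: field_simps)
qed

text \<open>By Weierstrass there is a polynomial g within e of \<phi>. As \<phi> is orthogonal to g,
  the integral of \<phi>^2 equals that of \<phi> (\<phi> - g), which is at most e times the integral
  of the modulus of \<phi>.\<close>

lemma legendre_P_complete:
  fixes \<phi> :: "real \<Rightarrow> real"
  assumes \<phi>: "continuous_on {-1..1} \<phi>"
    and 0: "\<And>n. integral {-1..1} (\<lambda>x. \<phi> x * legendre_P n x) = 0"
    and x: "x \<in> {-1..1}"
  shows "\<phi> x = 0"
proof -
  define J where "J = integral {-1..1} (\<lambda>x. \<bar>\<phi> x\<bar>)"
  have le: "integral {-1..1} (\<lambda>x. (\<phi> x)\<^sup>2) \<le> e * J" if e: "e > 0" for e
  proof -
    obtain g where g: "real_polynomial_function g" "\<And>x. x \<in> {-1..1} \<Longrightarrow> \<bar>\<phi> x - g x\<bar> < e"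
      using Stone_Weierstrass_real_polynomial_function[OF compact_Icc \<phi> e] by blast
    from g(1) obtain a n where "g = (\<lambda>x. \<Sum>i\<le>n. a i * x ^ i)"
      unfolding real_polynomial_function_iff_sum by blast
    then have gp: "g = poly (\<Sum>i\<le>n. monom (a i) i)" by (simp add: poly_sum poly_monom fun_eq_iff)
    have cg: "continuous_on A g" for A unfolding gp by (intro continuous_intros)
    have "integral {-1..1} (\<lambda>x. \<phi> x * g x) = 0"
      unfolding gp by (rule integral_poly_eq_0[OF \<phi> 0, where N = "Suc (degree (\<Sum>i\<le>n. monom (a i) i))"]) auto
    moreover have "integral {-1..1} (\<lambda>x. (\<phi> x)\<^sup>2) = integral {-1..1} (\<lambda>x. \<phi> x * (\<phi> x - g x) + \<phi> x * g x)"
      by (simp add: power2_eq_square algebra_simps)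
    moreover have "\<dots> = integral {-1..1} (\<lambda>x. \<phi> x * (\<phi> x - g x)) + integral {-1..1} (\<lambda>x. \<phi> x * g x)"
      by (rule integral_add) (auto intro!: integrable_continuous_real continuous_intros \<phi> cg)
    moreover have "integral {-1..1} (\<lambda>x. \<phi> x * (\<phi> x - g x)) \<le> integral {-1..1} (\<lambda>x. e * \<bar>\<phi> x\<bar>)"
    proof (rule integral_le)
      show "\<phi> x * (\<phi> x - g x) \<le> e * \<bar>\<phi> x\<bar>" if "x \<in> {-1..1}" for x
      proof -
        have "\<phi> x * (\<phi> x - g x) \<le> \<bar>\<phi> x\<bar> * \<bar>\<phi> x - g x\<bar>" by (simp flip: abs_mult)
        also have "\<dots> \<le> \<bar>\<phi> x\<bar> * e" using g(2)[OF that] by (intro mult_left_mono) auto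
        finally show ?thesis by (simp add: mult.commute)
      qed
    qed (auto intro!: integrable_continuous_real continuous_intros \<phi> cg)
    ultimately show ?thesis by (simp add: J_def)
  qed
  have "integral {-1..1} (\<lambda>x. (\<phi> x)\<^sup>2) \<le> 0"
  proof (rule tendsto_lowerbound)
    show "((\<lambda>e. e * J) \<longlongrightarrow> 0) (at_right 0)" by (auto intro!: tendsto_eq_intros)
    show "\<forall>\<^sub>F e in at_right 0. integral {-1..1} (\<lambda>x. (\<phi> x)\<^sup>2) \<le> e * J"
      using eventually_at_right_less[of 0] by eventually_elim (rule le)
  qed simp
  moreover have "0 \<le> integral {-1..1} (\<lambda>x. (\<phi> x)\<^sup>2)"
    by (rule integral_nonneg) (auto intro!: integrable_continuous_real continuous_intros \<phi>)
  moreover have "(\<lambda>x. (\<phi> x)\<^sup>2) integrable_on {-1..1}"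
    by (auto intro!: integrable_continuous_real continuous_intros \<phi>)
  ultimately have "((\<lambda>x. (\<phi> x)\<^sup>2) has_integral 0) (cbox (-1) 1)"
    by (simp add: has_integral_iff)
  from has_integral_0_cbox_imp_0[OF _ _ this, of x] x \<phi> show ?thesis
    by (auto intro!: continuous_intros)
qed

section \<open>Mittag-Leffler functions and fractional integrals\<close>

text \<open>The two-parameter Mittag-Leffler function E_{a,b}.\<close>

definition mlf :: "real \<Rightarrow> real \<Rightarrow> real \<Rightarrow> real" where
  "mlf a b z = (\<Sum>k. z ^ k / Gamma (a * real k + b))"

lemma mittag_leffler_eq: "mittag_leffler a = mlf a 1"
  by (simp add: mittag_leffler_def mlf_def fun_eq_iff)

text \<open>Euler's integral restricted to [R, R+1]. As R is free, this shows that Gamma outgrows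
  every geometric sequence, which is all that the convergence of the series needs.\<close>

lemma Gamma_ge_powr:
  fixes R y :: real
  assumes "0 < R" "1 \<le> y"
  shows "R powr (y - 1) * exp (- (R + 1)) \<le> Gamma y"
proof -
  have G: "((\<lambda>t. t powr (y - 1) / exp t) has_integral Gamma y) {0..}"
    using assms by (intro Gamma_integral_real) auto
  have "((\<lambda>t. R powr (y - 1) * exp (- (R + 1))) has_integral R powr (y - 1) * exp (- (R + 1))) {R..R+1}"
    using has_integral_const_real[of "R powr (y - 1) * exp (- (R + 1))" R "R + 1"] by simp
  then have "((\<lambda>t. if t \<in> {R..R+1} then R powr (y - 1) * exp (- (R + 1)) else 0) has_integral R powr (y - 1) * exp (- (R + 1))) {0..}"
    using assms by (subst has_integral_restrict) auto
  then show ?thesis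
  proof (rule has_integral_le[OF _ G])
    fix t :: real assume "t \<in> {0..}"
    show "(if t \<in> {R..R+1} then R powr (y - 1) * exp (- (R + 1)) else 0) \<le> t powr (y - 1) / exp t"
    proof (cases "t \<in> {R..R+1}")
      case True
      then have "R powr (y - 1) * exp (- (R + 1)) \<le> t powr (y - 1) * exp (- t)"
        using assms by (intro mult_mono powr_mono2) auto
      with True show ?thesis by (simp add: exp_minus divide_inverse)
    qed (auto simp: divide_inverse)
  qed
qed

lemma summable_mlf:
  assumes "0 < a" "0 < b"
  shows "summable (\<lambda>k. norm (z ^ k / Gamma (a * real k + b)))"
proof -
  \<comment> \<open>This choice gives R^a = 2 |z| + 1, so Gamma(a k + b) is at least a constant
    times (2 |z| + 1)^k and the terms are eventually dominated by a multiple of 2^-k.\<close>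
  define R where "R = (2 * \<bar>z\<bar> + 1) powr (1 / a)"
  have R: "0 < R" "R powr a = 2 * \<bar>z\<bar> + 1"
    using assms by (auto simp: R_def powr_powr)
  define C where "C = inverse (R powr (b - 1) * exp (- (R + 1)))"
  have "C > 0" using R by (simp add: C_def)
  show ?thesis
  proof (rule summable_comparison_test_ev)
    show "summable (\<lambda>k. C * (1 / 2) ^ k)" by (intro summable_mult summable_geometric) simp
    have "filterlim (\<lambda>k. a * real k + b) at_top sequentially"
      using assms by real_asymp
    then have "\<forall>\<^sub>F k in sequentially. 1 \<le> a * real k + b"
      by (simp add: filterlim_at_top)
    then show "\<forall>\<^sub>F k in sequentially. norm (norm (z ^ k / Gamma (a * real k + b))) \<le> C * (1 / 2) ^ k"
    proof eventually_elim
      case (elim k)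
      have "R powr (a * real k + b - 1) = (R powr a) ^ k * R powr (b - 1)"
        using R(1) by (simp add: powr_powr powr_realpow[symmetric] add_diff_eq flip: powr_add)
      with Gamma_ge_powr[OF R(1) elim] have G: "(2 * \<bar>z\<bar> + 1) ^ k * inverse C \<le> Gamma (a * real k + b)"
        by (simp add: C_def R(2) mult_ac)
      have "\<bar>z\<bar> ^ k * 2 ^ k \<le> (2 * \<bar>z\<bar> + 1) ^ k"
        by (subst power_mult_distrib[symmetric], intro power_mono) auto
      then have "\<bar>z\<bar> ^ k * 2 ^ k * inverse C \<le> Gamma (a * real k + b)"
        using \<open>C > 0\<close> by (intro order_trans[OF _ G] mult_right_mono) auto
      moreover have "0 < Gamma (a * real k + b)"
        using elim by (intro Gamma_real_pos) auto
      ultimately show ?case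
        using \<open>C > 0\<close> by (simp add: power_abs abs_mult field_simps power_one_over)
    qed
  qed
qed

lemma summable_mlf': "0 < a \<Longrightarrow> 0 < b \<Longrightarrow> summable (\<lambda>k. z ^ k / Gamma (a * real k + b))"
  by (rule summable_norm_cancel) (rule summable_mlf)

lemma mlf_0: "mlf a b 0 = 1 / Gamma b"
  unfolding mlf_def
  by (subst suminf_finite[of "{0}"]) auto

lemma mlf_rec:
  assumes "0 < a" "0 < b"
  shows "mlf a b z = 1 / Gamma b + z * mlf a (a + b) z"
proof -
  have "mlf a b z - 1 / Gamma b = (\<Sum>k. z ^ Suc k / Gamma (a * real (Suc k) + b))"
    unfolding mlf_def
    using suminf_split_head[OF summable_mlf'[OF assms, of z]] by simp
  also have "\<dots> = (\<Sum>k. z * (z ^ k / Gamma (a * real k + (a + b))))"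
    by (simp add: algebra_simps)
  also have "\<dots> = z * mlf a (a + b) z"
    unfolding mlf_def using assms by (intro suminf_mult summable_mlf') auto
  finally show ?thesis by simp
qed

lemma mlf_deriv_exists:
  assumes "0 < a" "0 < b"
  shows "(mlf a b has_real_derivative (\<Sum>k. diffs (\<lambda>k. 1 / Gamma (a * real k + b)) k * z ^ k)) (at z)"
proof -
  have "((\<lambda>x. \<Sum>k. (1 / Gamma (a * real k + b)) * x ^ k) has_real_derivative
      (\<Sum>k. diffs (\<lambda>k. 1 / Gamma (a * real k + b)) k * z ^ k)) (at z)"
    using summable_mlf'[OF assms] by (intro termdiffs_strong_converges_everywhere) simp
  then show ?thesis by (simp add: mlf_def[abs_def])
qed

text \<open>Termwise differentiation, using Gamma(a (k+1) + 1) = (k+1) a Gamma(a k + a).\<close>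

lemma mlf_deriv:
  assumes "0 < a"
  shows "(mlf a 1 has_real_derivative mlf a a z / a) (at z)"
proof -
  have *: "diffs (\<lambda>k. 1 / Gamma (a * real k + 1)) k = 1 / a * (1 / Gamma (a * real k + a))" for k
  proof -
    have "a * real k + a > 0" using assms by (simp add: add_nonneg_pos)
    then have "Gamma (a * real k + a + 1) = (a * real k + a) * Gamma (a * real k + a)"
      by (intro Gamma_plus1) (auto elim!: nonpos_Ints_cases)
    also have "a * real k + a = real (Suc k) * a" by (simp add: algebra_simps)
    finally have "Gamma (a * real (Suc k) + 1) = real (Suc k) * (a * Gamma (a * real k + a))"
      by (simp add: algebra_simps)
    then show ?thesis unfolding diffs_def by (simp del: of_nat_Suc)
  qed
  have "(\<Sum>k. diffs (\<lambda>k. 1 / Gamma (a * real k + 1)) k * z ^ k) = (\<Sum>k. 1 / a * (z ^ k / Gamma (a * real k + a)))"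
    by (simp add: *)
  also have "\<dots> = mlf a a z / a"
    unfolding mlf_def
    using suminf_mult[OF summable_mlf'[OF assms assms, of z], of "1 / a"] by simp
  finally show ?thesis
    using mlf_deriv_exists[OF assms zero_less_one, of z] by simp
qed

lemma continuous_on_mlf [continuous_intros]:
  assumes "0 < a" "0 < b" "continuous_on A f"
  shows "continuous_on A (\<lambda>x. mlf a b (f x))"
proof -
  have "continuous_on UNIV (mlf a b)"
    by (intro continuous_at_imp_continuous_on ballI DERIV_isCont[OF mlf_deriv_exists] assms)
  then show ?thesis using assms(3) by (rule continuous_on_compose2) auto
qed

section \<open>Fractional-integral kernels and their convolutions\<close>

text \<open>Kernel of the Riemann-Liouville integral J^c; for c = 1 it is the constant 1 on positive
  arguments.\<close>

definition pker :: "real \<Rightarrow> real \<Rightarrow> real" where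
  "pker c s = s powr (c - 1) / Gamma c"

text \<open>The kernel with Laplace transform p^(a-b) / (p^a + l). For b = a it is the resolvent of
  l times \<open>pker a\<close>, for b = 1 it is E_a(-l s^a).\<close>

definition mlk :: "real \<Rightarrow> real \<Rightarrow> real \<Rightarrow> real \<Rightarrow> real" where
  "mlk a l b s = s powr (b - 1) * mlf a b (- l * s powr a)"

text \<open>Laplace convolution. The integral is total, so convergence is recorded separately by
  \<open>conv_integrable\<close>.\<close>

definition conv :: "(real \<Rightarrow> real) \<Rightarrow> (real \<Rightarrow> real) \<Rightarrow> real \<Rightarrow> real" where
  "conv f g t = (\<integral>s. indicator {0<..<t} s * (f (t - s) * g s) \<partial>lborel)"

definition conv_integrable :: "(real \<Rightarrow> real) \<Rightarrow> (real \<Rightarrow> real) \<Rightarrow> real \<Rightarrow> bool" where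
  "conv_integrable f g t \<longleftrightarrow> integrable lborel (\<lambda>s. indicator {0<..<t} s * (f (t - s) * g s))"

lemma conv_cong:
  assumes "\<And>s. 0 < s \<Longrightarrow> s < t \<Longrightarrow> f s = f' s" "\<And>s. 0 < s \<Longrightarrow> s < t \<Longrightarrow> g s = g' s"
  shows "conv f g t = conv f' g' t" "conv_integrable f g t = conv_integrable f' g' t"
  unfolding conv_def conv_integrable_def
  by (intro Bochner_Integration.integral_cong Bochner_Integration.integrable_cong; auto simp: indicator_def assms)+

lemma conv_commute: "conv f g t = conv g f t"
  unfolding conv_def
  by (subst lborel_integral_real_affine[where c = "- 1" and t = t])
     (auto intro!: Bochner_Integration.integral_cong simp: indicator_def)

lemma conv_integrable_commute: "conv_integrable f g t = conv_integrable g f t"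
  unfolding conv_integrable_def
  by (subst lborel_integrable_real_affine_iff[where c = "- 1" and t = t, symmetric])
     (auto intro!: Bochner_Integration.integrable_cong simp: indicator_def)

lemma conv_nonneg: "(\<And>s. 0 < s \<Longrightarrow> s < t \<Longrightarrow> 0 \<le> f s) \<Longrightarrow> (\<And>s. 0 < s
    \<Longrightarrow> s < t \<Longrightarrow> 0 \<le> g s) \<Longrightarrow> 0 \<le> conv f g t"
  unfolding conv_def by (intro Bochner_Integration.integral_nonneg) (auto simp: indicator_def)

lemma pker_measurable [measurable]: "pker c \<in> borel_measurable borel"
  unfolding pker_def[abs_def] by measurable

lemma pker_nonneg: "0 < c \<Longrightarrow> 0 \<le> pker c s"
  by (simp add: pker_def Gamma_real_pos less_imp_le)

lemma pker_1: "0 < s \<Longrightarrow> pker 1 s = 1"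
  by (simp add: pker_def)

text \<open>The semigroup law of fractional integration: scaling (0,t) to (0,1) leaves Euler's Beta
  integral, and Beta b c = Gamma b Gamma c / Gamma (b + c).\<close>

lemma conv_pker:
  assumes "0 < c" "0 < b" "0 < t"
  shows "conv_integrable (pker c) (pker b) t" (is ?A)
    "conv (pker c) (pker b) t = pker (b + c) t" (is ?B)
proof -
  have "((\<lambda>s. s powr (b - 1) * (1 - s) powr (c - 1)) has_integral Beta b c) {0<..<1}"
    using has_integral_Beta_real[OF assms(2,1)] by (simp add: has_integral_Icc_iff_Ioo)
  then have "integral\<^sup>N lborel (\<lambda>s. indicator {0<..<1} s * (s powr (b - 1) * (1 - s) powr (c - 1))) = Beta b c"
    by (intro nn_integral_has_integral_lebesgue) auto
  moreover have "0 \<le> Beta b c" using assms by (simp add: Beta_def Gamma_real_pos less_imp_le)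
  ultimately have "has_bochner_integral lborel (\<lambda>s. indicator {0<..<1} s * (s powr (b - 1) * (1 - s) powr (c - 1))) (Beta b c)"
    by (intro has_bochner_integral_nn_integral) (auto simp: ennreal_mult' ennreal_indicator)
  from lborel_has_bochner_integral_real_affine_iff[where c = "1 / t" and t = 0, THEN iffD1, OF _ this] assms
  have "has_bochner_integral lborel (\<lambda>s. indicator {0<..<1} (s / t) * ((s / t) powr (b - 1) * (1 - s / t) powr (c - 1))) (Beta b c * t)"
    by (simp add: mult.commute)
  from has_bochner_integral_mult_right[OF this, of "t powr (b + c - 2) / (Gamma b * Gamma c)"]
  have "has_bochner_integral lborel (\<lambda>s. t powr (b + c - 2) / (Gamma b * Gamma c) *
      (indicator {0<..<1} (s / t) * ((s / t) powr (b - 1) * (1 - s / t) powr (c - 1))))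
      (t powr (b + c - 2) / (Gamma b * Gamma c) * (Beta b c * t))" by simp
  moreover have "t powr (b + c - 2) / (Gamma b * Gamma c) * (Beta b c * t) = pker (b + c) t"
  proof -
    have "t powr (b + c - 2) * t = t powr (b + c - 1)"
      using assms(3) powr_add[of t "b + c - 2" 1] by simp
    then show ?thesis using assms by (simp add: Beta_def pker_def Gamma_real_pos less_imp_neq[symmetric])
  qed
  moreover have "t powr (b + c - 2) / (Gamma b * Gamma c) *
      (indicator {0<..<1} (s / t) * ((s / t) powr (b - 1) * (1 - s / t) powr (c - 1)))
      = indicator {0<..<t} s * (pker c (t - s) * pker b s)" for s
  proof (cases "s \<in> {0<..<t}")
    case True
    have "1 - s / t = (t - s) / t" using assms by (simp add: field_simps)
    moreover have "t powr (b + c - 2) = t powr (b - 1) * t powr (c - 1)"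
      by (simp flip: powr_add)
    ultimately show ?thesis using True assms
      by (simp add: pker_def indicator_def powr_divide mult_ac)
  qed (use assms in \<open>auto simp: indicator_def field_simps\<close>)
  ultimately have "has_bochner_integral lborel (\<lambda>s. indicator {0<..<t} s * (pker c (t - s) * pker b s)) (pker (b + c) t)"
    by simp
  then show ?A ?B by (auto simp: has_bochner_integral_iff conv_def conv_integrable_def)
qed

text \<open>This Neumann series expresses \<open>mlk\<close> through powers of the fractional
  integral and so reduces its convolutions to \<open>conv_pker\<close>.\<close>

lemma mlk_sums:
  assumes "0 < a" "0 < b" "0 < s"
  shows "(\<lambda>k. (- l) ^ k * pker (a * real k + b) s) sums mlk a l b s"
    "summable (\<lambda>k. norm ((- l) ^ k * pker (a * real k + b) s))"
proof -
  have eq: "s powr (b - 1) * ((- l * s powr a) ^ k / Gamma (a * real k + b)) = (- l) ^ k * pker (a * real k + b) s" for k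
  proof -
    have "s powr (b - 1) * (s powr a) ^ k = s powr (a * real k + b - 1)"
      using assms by (simp add: powr_powr powr_realpow[symmetric] algebra_simps flip: powr_add)
    moreover have "(- l * s powr a) ^ k = (- l) ^ k * (s powr a) ^ k" by (rule power_mult_distrib)
    ultimately show ?thesis
      unfolding pker_def by (metis (no_types, opaque_lifting) mult.left_commute times_divide_eq_right)
  qed
  show "(\<lambda>k. (- l) ^ k * pker (a * real k + b) s) sums mlk a l b s"
    unfolding eq[symmetric] mlk_def mlf_def
    by (intro sums_mult summable_sums summable_mlf' assms)
  show "summable (\<lambda>k. norm ((- l) ^ k * pker (a * real k + b) s))"
    unfolding eq[symmetric] norm_mult
    by (intro summable_mult summable_mlf[unfolded norm_mult] assms)
qed

text \<open>Convolve the Neumann series term by term. The L1 norms of the terms form the absolutely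
  convergent series for \<open>mlk a l (b + c) t\<close>, which justifies the exchange.\<close>

lemma conv_mlk:
  assumes "0 < a" "0 < b" "0 < c" "0 < t"
  shows "conv_integrable (pker c) (mlk a l b) t" (is ?A)
    "conv (pker c) (mlk a l b) t = mlk a l (b + c) t" (is ?B)
proof -
  define f where "f k s = indicator {0<..<t} s * (pker c (t - s) * ((- l) ^ k * pker (a * real k + b) s))" for k :: nat and s
  have f: "f k s = (- l) ^ k * (indicator {0<..<t} s * (pker c (t - s) * pker (a * real k + b) s))" for k s
    by (simp add: f_def)
  have pos: "0 < a * real k + b" for k using assms by (simp add: add_nonneg_pos)
  have int: "integrable lborel (f k)" for k
    unfolding f using conv_pker(1)[OF assms(3) pos assms(4)]
    by (intro integrable_mult_right) (simp add: conv_integrable_def)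
  have I: "integral\<^sup>L lborel (f k) = (- l) ^ k * pker (a * real k + (b + c)) t" for k
    unfolding f using conv_pker(2)[OF assms(3) pos assms(4)]
    by (simp add: conv_def add.assoc)
  have nf: "norm (f k s) = norm ((- l) ^ k) * (indicator {0<..<t} s * (pker c (t - s) * pker (a * real k + b) s))" for k s
    unfolding f by (simp add: abs_mult pker_nonneg assms pos)
  have In: "(\<integral>s. norm (f k s) \<partial>lborel) = norm ((- l) ^ k * pker (a * real k + (b + c)) t)" for k
  proof -
    have "0 < a * real k + (b + c)" using pos[of k] assms by simp
    then show ?thesis
      using conv_pker(2)[OF assms(3) pos assms(4), of k]
      by (simp only: nf) (simp add: conv_def add.assoc abs_mult pker_nonneg)
  qed
  have sum1: "AE s in lborel. summable (\<lambda>k. norm (f k s))"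
  proof (rule AE_I2)
    fix s
    show "summable (\<lambda>k. norm (f k s))"
    proof (cases "s \<in> {0<..<t}")
      case True
      then have "summable (\<lambda>k. \<bar>pker c (t - s)\<bar> * norm ((- l) ^ k * pker (a * real k + b) s))"
        by (intro summable_mult mlk_sums assms) auto
      with True show ?thesis by (simp add: f_def abs_mult)
    qed (simp add: f_def)
  qed
  have sum2: "summable (\<lambda>k. \<integral>s. norm (f k s) \<partial>lborel)"
    unfolding In using assms by (intro mlk_sums) auto
  have eq: "(\<Sum>k. f k s) = indicator {0<..<t} s * (pker c (t - s) * mlk a l b s)" for s
  proof (cases "s \<in> {0<..<t}")
    case True
    then have "(\<lambda>k. f k s) sums (pker c (t - s) * mlk a l b s)"
      unfolding f_def using sums_mult[OF mlk_sums(1)[of a b s l], of "pker c (t - s)"] assms by simp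
    with True show ?thesis by (simp add: sums_iff)
  qed (simp add: f_def)
  show ?A unfolding conv_integrable_def eq[symmetric] by (rule integrable_suminf[OF int sum1 sum2])
  have "conv (pker c) (mlk a l b) t = (\<Sum>k. integral\<^sup>L lborel (f k))"
    unfolding conv_def eq[symmetric] by (rule integral_suminf[OF int sum1 sum2])
  also have "\<dots> = mlk a l (b + c) t"
    unfolding I using mlk_sums(1)[of a "b + c" t l] assms by (simp add: sums_iff)
  finally show ?B .
qed

text \<open>By \<open>conv_mlk\<close>, \<open>mlk a l (a + b)\<close> is the convolution of
  \<open>pker a\<close> with \<open>mlk a l b\<close>, so this is the resolvent equation in solved
  form.\<close>

lemma mlk_rec:
  assumes "0 < a" "0 < b" "0 < s"
  shows "mlk a l b s = pker b s - l * mlk a l (a + b) s"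
proof -
  have "s powr (b - 1) * s powr a = s powr (a + b - 1)"
    by (simp flip: powr_add) (simp add: algebra_simps)
  then show ?thesis
    unfolding mlk_def pker_def by (subst mlf_rec[OF assms(1,2)]) (simp add: algebra_simps)
qed

text \<open>With \<open>k = pker a\<close> log-convex, the resolvent equation
  \<open>e = k - k * e\<close> gives \<open>0 \<ge> e / k (t\<^sub>0) \<ge> e / k (\<tau>) - C
      \<integral>\<^sub>\<tau>\<^bsup>t\<^sub>0\<^esup> k (t\<^sub>0 - s) (e / k) (s) ds\<close> at a first zero
      \<open>t\<^sub>0\<close> of \<open>e\<close>,
  so \<open>e\<close> vanishes shortly before \<open>t\<^sub>0\<close>.\<close>

lemma mlf_nonneg_diag:
  assumes a: "0 < a" "a \<le> 1" and x: "0 \<le> x"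
  shows "0 \<le> mlf a a (- x)"
proof (rule ccontr)
  assume neg: "\<not> ?thesis"
  define k where "k = pker a"
  \<comment> \<open>For a < 1 both \<open>k\<close> and \<open>e\<close> are singular at 0, but
    their quotient \<open>r\<close> is continuous there with value 1, so it has a first point
    \<open>t0\<close> with r <= 0 if it ever becomes negative.\<close>
  define r where "r t = Gamma a * mlf a a (- (t powr a))" for t
  define e where "e = mlk a 1 a"
  have Ga: "0 < Gamma a" using a by (simp add: Gamma_real_pos)
  have kpos: "0 < k t" if "0 < t" for t using that Ga by (simp add: k_def pker_def)
  have er: "e t = k t * r t" for t using Ga by (simp add: e_def k_def r_def mlk_def pker_def)
  have r_eq: "r t = 1 - conv k e t / k t" if "0 < t" for t
  proof -
    have "e t = k t - conv k e t"
      using mlk_rec[OF a(1) a(1) that, of 1] conv_mlk(2)[OF a(1) a(1) a(1) that, of 1]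
      by (simp add: e_def k_def)
    then show ?thesis using kpos[OF that] unfolding er by (simp add: field_simps)
  qed
  have kint: "conv_integrable k e t" if "0 < t" for t
    unfolding k_def e_def using that a by (intro conv_mlk) auto
  have r0: "r 0 = 1" using a less_imp_neq[OF Ga] by (simp add: r_def mlf_0)
  have cont_r: "continuous_on A r" if "A \<subseteq> {0..}" for A
    unfolding r_def using a that
    by (intro continuous_on_mult_left continuous_on_mlf continuous_on_minus continuous_on_powr'
        continuous_on_id continuous_on_const) auto
  \<comment> \<open>The argument -t^a equals -x at t = x^(1/a), so the single kernel with l = 1
    tests every x.\<close>
  define t1 where "t1 = x powr (1 / a)"
  have t1: "0 \<le> t1" "r t1 < 0"
  proof -
    have "t1 powr a = x" using a x by (simp add: t1_def powr_powr)
    then show "r t1 < 0" using neg Ga by (simp add: r_def mult_pos_neg)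
  qed (simp add: t1_def)
  have "closed ({0..t1} \<inter> r -` {..0})"
    by (intro continuous_closed_preimage cont_r) auto
  then have "compact ({0..t1} \<inter> ({0..t1} \<inter> r -` {..0}))"
    by (intro compact_Int_closed) auto
  also have "{0..t1} \<inter> ({0..t1} \<inter> r -` {..0}) = {t \<in> {0..t1}. r t \<le> 0}" by auto
  finally have "compact {t \<in> {0..t1}. r t \<le> 0}" .
  then obtain t0 where t0: "t0 \<in> {0..t1}" "r t0 \<le> 0" "\<And>t. t \<in> {0..t1} \<Longrightarrow> r t \<le> 0 \<Longrightarrow> t0 \<le> t"
    using compact_attains_inf[of "{t \<in> {0..t1}. r t \<le> 0}"] t1 by fastforce
  have t0pos: "0 < t0" using t0(1,2) r0 by (cases "t0 = 0") auto
  have rpos: "0 < r t" if "0 \<le> t" "t < t0" for t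
    using t0(1) t0(3)[of t] that by force
  \<comment> \<open>Split the convolution at \<open>t0\<close> in two. On (0,t), log-convexity
    compares it with the convolution at \<open>t\<close>; on (t,t0), e <= k(t) m and the integral of
    k(t0 - s) is \<open>pker (a + 1) (t0 - t)\<close>. Then r(t0) <= 0 is inserted.\<close>
  have step: "r t \<le> k t / k t0 * m * pker (a + 1) (t0 - t)"
    if t: "0 < t" "t < t0" and m: "\<And>s. t \<le> s \<Longrightarrow> s \<le> t0 \<Longrightarrow> r s \<le> m" for t m
  proof -
    have "0 \<le> m" using m[of t] rpos[of t] t by simp
    define g where "g s = k t0 / k t * (indicator {0<..<t} s * (k (t - s) * e s)) +
        k t * m * (indicator {t<..<t0} s * k (t0 - s))" for s
    have i1: "integrable lborel (\<lambda>s. indicator {0<..<t} s * (k (t - s) * e s))"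
      using kint[OF t(1)] by (simp add: conv_integrable_def)
    have "conv_integrable (pker a) (pker 1) (t0 - t)" "conv (pker a) (pker 1) (t0 - t) = pker (a + 1) (t0 - t)"
      using conv_pker[of a 1 "t0 - t"] a t by (auto simp: add.commute)
    then have "has_bochner_integral lborel (\<lambda>s. indicator {0<..<t0 - t} s * (pker a (t0 - t - s) * pker 1 s)) (pker (a + 1) (t0 - t))"
      by (auto simp: has_bochner_integral_iff conv_def conv_integrable_def)
    from lborel_has_bochner_integral_real_affine_iff[where c = 1 and t = "- t", THEN iffD1, OF _ this]
    have i2: "has_bochner_integral lborel (\<lambda>s. indicator {t<..<t0} s * k (t0 - s)) (pker (a + 1) (t0 - t))"
      by (rule has_bochner_integral_cong[THEN iffD1, rotated -1])
         (auto simp: indicator_def k_def pker_1)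
    have "conv k e t0 \<le> integral\<^sup>L lborel g"
      unfolding conv_def
    proof (rule integral_mono_AE)
      show "integrable lborel (\<lambda>s. indicator {0<..<t0} s * (k (t0 - s) * e s))"
        using kint[OF t0pos] by (simp add: conv_integrable_def)
      show "integrable lborel g" unfolding g_def
        using i2 by (intro Bochner_Integration.integrable_add integrable_mult_right i1) (auto simp: has_bochner_integral_iff)
      show "AE s in lborel. indicator {0<..<t0} s * (k (t0 - s) * e s) \<le> g s"
        using AE_lborel_singleton[of t]
      proof eventually_elim
        case (elim s)
        then consider "s \<notin> {0<..<t0}" | "0 < s" "s < t" | "t < s" "s < t0" by fastforce
        then show ?case
        proof cases
          case 2
          \<comment> \<open>This is log-convexity of \<open>k\<close> in the form k(t0 - s) / k(t0)
            <= k(t - s) / k(t).\<close>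
          have "(1 - s / t0) powr (a - 1) \<le> (1 - s / t) powr (a - 1)"
            using 2 t a by (intro powr_mono2') (auto intro: divide_left_mono)
          then have "((t0 - s) / t0) powr (a - 1) \<le> ((t - s) / t) powr (a - 1)"
            using t by (simp add: diff_divide_distrib)
          then have "k (t0 - s) \<le> k t0 / k t * k (t - s)"
            using 2 t Ga by (simp add: k_def pker_def powr_divide field_simps)
          moreover have "0 \<le> e s" unfolding er using 2 t by (intro mult_nonneg_nonneg less_imp_le[OF kpos] less_imp_le[OF rpos]) auto
          ultimately have "k (t0 - s) * e s \<le> k t0 / k t * k (t - s) * e s" by (rule mult_right_mono)
          then show ?thesis using 2 t by (simp add: g_def indicator_def mult_ac)
        next
          case 3
          have "k s \<le> k t" using 3 t a Ga by (auto simp: k_def pker_def intro!: divide_right_mono powr_mono2')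
          then have "e s \<le> k t * m" unfolding er
            using 3 t m[of s] kpos[of t] rpos[of s] by (intro mult_mono) auto
          then have "k (t0 - s) * e s \<le> k (t0 - s) * (k t * m)"
            using kpos[of "t0 - s"] 3 by (intro mult_left_mono) auto
          then show ?thesis using 3 t by (simp add: g_def indicator_def mult_ac)
        next
          case 1
          then have "indicator {0<..<t0} s = (0::real)" "indicator {0<..<t} s = (0::real)" "indicator {t<..<t0} s = (0::real)"
            using t by (auto simp: indicator_def)
          then show ?thesis by (simp add: g_def)
        qed
      qed
    qed
    also have "integral\<^sup>L lborel g = k t0 / k t * conv k e t + k t * m * pker (a + 1) (t0 - t)"
      unfolding g_def conv_def using i2 i1
      by (subst Bochner_Integration.integral_add) (auto simp: has_bochner_integral_iff)
    finally have "conv k e t0 / k t0 \<le> conv k e t / k t + k t / k t0 * m * pker (a + 1) (t0 - t)"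
      using kpos[OF t0pos] kpos[OF t(1)] by (simp add: field_simps)
    then show ?thesis using r_eq[OF t0pos] r_eq[OF t(1)] t0(2) by simp
  qed
  \<comment> \<open>The factor in \<open>step\<close> is made smaller than 1 by going only a short
    distance d below \<open>t0\<close>. Staying above t0 / 2 lets k(t0 / 2) majorize the
    nonincreasing \<open>k\<close>.\<close>
  have "((\<lambda>d. k (t0 / 2) / k t0 * pker (a + 1) d) \<longlongrightarrow> 0) (at_right 0)"
    unfolding pker_def using a less_imp_neq[OF kpos[OF t0pos]] less_imp_neq[OF Gamma_real_pos[of "a + 1"]]
    by (auto intro!: tendsto_eq_intros tendsto_powr' simp: eventually_at_filter)
  then have "\<forall>\<^sub>F d in at_right 0. k (t0 / 2) / k t0 * pker (a + 1) d < 1"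
    by (rule order_tendstoD) simp
  moreover have "\<forall>\<^sub>F d in at_right 0. d \<in> {0<..<t0 / 2}"
    using t0pos by (intro eventually_at_right_real) simp
  ultimately have "\<forall>\<^sub>F d in at_right (0::real). k (t0 / 2) / k t0 * pker (a + 1) d < 1 \<and> d \<in> {0<..<t0 / 2}"
    by eventually_elim simp
  then obtain d where d: "k (t0 / 2) / k t0 * pker (a + 1) d < 1" "0 < d" "d < t0 / 2"
    using eventually_happens[of _ "at_right (0::real)"] by (auto simp: trivial_limit_at_right_real)
  define t where "t = t0 - d"
  have t: "t0 / 2 < t" "0 < t" "t < t0" using d t0pos by (auto simp: t_def)
  \<comment> \<open>At a maximum \<tau> of \<open>r\<close> on [t,t0] the bound m in
    \<open>step\<close> is r(\<tau>) itself, and a factor below 1 contradicts r(\<tau>) > 0.\<close>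
  obtain \<tau> where \<tau>: "\<tau> \<in> {t..t0}" "\<And>s. s \<in> {t..t0} \<Longrightarrow> r s \<le> r \<tau>"
    using continuous_attains_sup[of "{t..t0}" r] t cont_r[of "{t..t0}"] by fastforce
  have "0 < r \<tau>" using \<tau>(2)[of t] rpos[of t] t by simp
  then have "\<tau> < t0" using \<tau>(1) t0(2) by (cases "\<tau> = t0") auto
  have "r \<tau> \<le> k \<tau> / k t0 * r \<tau> * pker (a + 1) (t0 - \<tau>)"
    using \<tau> t \<open>\<tau> < t0\<close> by (intro step) auto
  also have "\<dots> \<le> k (t0 / 2) / k t0 * r \<tau> * pker (a + 1) d"
  proof (intro mult_mono divide_right_mono)
    show "k \<tau> \<le> k (t0 / 2)"
      using \<tau>(1) t a Ga t0pos by (auto simp: k_def pker_def intro!: divide_right_mono powr_mono2')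
    show "pker (a + 1) (t0 - \<tau>) \<le> pker (a + 1) d"
      using \<tau>(1) a by (auto simp: pker_def t_def Gamma_real_pos less_imp_le intro!: divide_right_mono powr_mono2)
  qed (use \<open>0 < r \<tau>\<close> kpos[OF t0pos] kpos[of "t0 / 2"] t0pos pker_nonneg[of "a + 1"] a in simp_all)
  also have "\<dots> = r \<tau> * (k (t0 / 2) / k t0 * pker (a + 1) d)" by simp
  also have "\<dots> < r \<tau> * 1" using d(1) \<open>0 < r \<tau>\<close> by (intro mult_strict_left_mono)
  finally show False by simp
qed

section \<open>Bounds, monotonicity and strict positivity\<close>

text \<open>For b > a the value is that of \<open>mlk a x b\<close> at time 1, the convolution of
  the positive kernel \<open>pker (b - a)\<close> with the nonnegative
  \<open>mlk a x a\<close>.\<close>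

lemma mlf_nonneg:
  assumes a: "0 < a" "a \<le> 1" and b: "a \<le> b" and x: "0 \<le> x"
  shows "0 \<le> mlf a b (- x)"
proof (cases "a = b")
  case True
  then show ?thesis using mlf_nonneg_diag assms by simp
next
  case False
  have "mlf a b (- x) = mlk a x (a + (b - a)) 1" by (simp add: mlk_def)
  also have "\<dots> = conv (pker (b - a)) (mlk a x a) 1"
    using assms False by (intro conv_mlk(2)[symmetric]) auto
  also have "\<dots> \<ge> 0"
    using assms False by (intro conv_nonneg pker_nonneg) (auto simp: mlk_def intro!: mult_nonneg_nonneg mlf_nonneg_diag)
  finally show ?thesis .
qed

lemma mlf_le:
  assumes a: "0 < a" "a \<le> 1" and b: "a \<le> b" and x: "0 \<le> x"
  shows "mlf a b (- x) \<le> 1 / Gamma b"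
  using mlf_rec[of a b "- x"] mlf_nonneg[of a "a + b" x] assms by simp

lemma mlf_antimono:
  assumes a: "0 < a" "a \<le> 1" and x: "0 \<le> x" "x \<le> y"
  shows "mlf a 1 (- y) \<le> mlf a 1 (- x)"
proof (rule DERIV_nonneg_imp_nondecreasing[of "- y" "- x" "mlf a 1"])
  show "\<exists>D. (mlf a 1 has_real_derivative D) (at z) \<and> 0 \<le> D" if "z \<le> - x" for z
    using mlf_deriv[OF a(1), of z] mlf_nonneg_diag[OF a, of "- z"] that x a by auto
qed (use x in simp)

text \<open>The derivative at 0 is positive, which gives strict inequality for small arguments;
  monotonicity carries it to all x > 0.\<close>

lemma mlf_less_1:
  assumes a: "0 < a" "a \<le> 1" and x: "0 < x"
  shows "mlf a 1 (- x) < 1"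
proof -
  have "mlf a a 0 / a > 0" using a by (simp add: mlf_0 Gamma_real_pos)
  from DERIV_pos_inc_left[OF mlf_deriv[OF a(1), of 0] this]
  obtain d where d: "0 < d" "\<And>h. 0 < h \<Longrightarrow> h < d \<Longrightarrow> mlf a 1 (0 - h) < mlf a 1 0"
    by blast
  define h where "h = min x (d / 2)"
  have "mlf a 1 (- x) \<le> mlf a 1 (- h)"
    using x d by (intro mlf_antimono a) (auto simp: h_def)
  also have "\<dots> < mlf a 1 0" using d(2)[of h] d(1) x by (auto simp: h_def)
  finally show ?thesis by (simp add: mlf_0)
qed

text \<open>From 1 - E_a(-x) = x E_{a,a+1}(-x) and the strict bound on E_a; at x = 0 the value is 1
  / Gamma(a + 1).\<close>

lemma mlf_pos:
  assumes a: "0 < a" "a \<le> 1" and x: "0 \<le> x"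
  shows "0 < mlf a (a + 1) (- x)"
proof (cases "x = 0")
  case True
  then show ?thesis using a by (simp add: mlf_0 Gamma_real_pos)
next
  case False
  then have "0 < x * mlf a (a + 1) (- x)"
    using mlf_rec[of a 1 "- x"] mlf_less_1[OF a, of x] a x by simp
  then show ?thesis using x False by (simp add: zero_less_mult_iff)
qed

lemma mlk_1_deriv:
  assumes "0 < a" "0 < s"
  shows "(mlk a l 1 has_real_derivative - l * mlk a l a s) (at s)"
proof -
  have "((\<lambda>s. mlf a 1 (- l * s powr a)) has_real_derivative
      mlf a a (- l * s powr a) / a * (- l * (a * s powr (a - 1)))) (at s)"
    by (rule DERIV_chain2[OF mlf_deriv[OF assms(1)]])
       (use assms in \<open>auto intro!: derivative_eq_intros\<close>)
  then have "((\<lambda>s. mlf a 1 (- l * s powr a)) has_real_derivative - l * mlk a l a s) (at s)"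
    by (rule DERIV_cong) (use assms in \<open>simp add: mlk_def\<close>)
  then show ?thesis
    by (rule has_field_derivative_transform_within_open[where S = "{0<..}"]) (use assms in \<open>auto simp: mlk_def\<close>)
qed

lemma mlk_measurable [measurable]:
  assumes "0 < a" "0 < b"
  shows "mlk a l b \<in> borel_measurable borel"
proof -
  have [measurable]: "mlf a b \<in> borel_measurable borel"
    by (intro borel_measurable_continuous_onI continuous_on_mlf[OF assms continuous_on_id])
  show ?thesis unfolding mlk_def[abs_def] by measurable
qed

text \<open>Fubini on the triangle 0 < s < r < t. Since f and g are nonnegative, the inner integral
  of the modulus is conv f g (t - s) times |y s|, so \<open>fgy\<close> is exactly the absolute
  integrability that Fubini requires; y may change sign.\<close>

lemma conv_assoc:
  assumes [measurable]: "f \<in> borel_measurable borel" "g \<in> borel_measurable borel" "y \<in> borel_measurable borel"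
    and nonneg: "\<And>s. 0 < s \<Longrightarrow> s < t \<Longrightarrow> 0 \<le> f s" "\<And>s. 0 < s \<Longrightarrow> s < t
        \<Longrightarrow> 0 \<le> g s"
    and fg: "\<And>s. 0 < s \<Longrightarrow> s < t \<Longrightarrow> conv_integrable f g s"
    and fgy: "conv_integrable (conv f g) (\<lambda>s. \<bar>y s\<bar>) t"
  shows "conv f (conv g y) t = conv (conv f g) y t" "conv_integrable f (conv g y) t"
proof -
  define F where "F s r = indicator {0<..<t} s * (indicator {s<..<t} r * (f (t - r) * (g (r - s) * y s)))" for s r
  have [measurable]: "(\<lambda>(s, r). F s r) \<in> borel_measurable (lborel \<Otimes>\<^sub>M lborel)"
  proof -
    have "(\<lambda>(s, r). F s r) = (\<lambda>(s, r). (if 0 < s \<and> s < t \<and> s < r \<and> r < t then f (t - r) * (g (r - s) * y s) else 0))"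
      by (auto simp: F_def fun_eq_iff indicator_def)
    also have "\<dots> \<in> borel_measurable (lborel \<Otimes>\<^sub>M lborel)" by measurable
    finally show ?thesis .
  qed
  have inner: "has_bochner_integral lborel (\<lambda>r. indicator {s<..<t} r * (f (t - r) * g (r - s))) (conv f g (t - s))" if "0 < s" "s < t" for s
  proof -
    have "has_bochner_integral lborel (\<lambda>r. indicator {0<..<t - s} r * (f (t - s - r) * g r)) (conv f g (t - s))"
      using fg[of "t - s"] that by (auto simp: has_bochner_integral_iff conv_def conv_integrable_def)
    from lborel_has_bochner_integral_real_affine_iff[where c = 1 and t = "- s", THEN iffD1, OF _ this]
    show ?thesis
      by (rule has_bochner_integral_cong[THEN iffD1, rotated -1]) (auto simp: indicator_def)
  qed
  have Fint: "has_bochner_integral lborel (F s) (indicator {0<..<t} s * (conv f g (t - s) * y s))" for s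
  proof (cases "s \<in> {0<..<t}")
    case True
    then show ?thesis
      using has_bochner_integral_mult_left[OF inner[of s], of "y s"] by (simp add: F_def[abs_def] mult_ac)
  qed (auto simp: F_def[abs_def] has_bochner_integral_zero)
  have nFint: "has_bochner_integral lborel (\<lambda>r. norm (F s r)) (indicator {0<..<t} s * (conv f g (t - s) * \<bar>y s\<bar>))" for s
  proof (cases "s \<in> {0<..<t}")
    case True
    then have "has_bochner_integral lborel (\<lambda>r. indicator {s<..<t} r * (f (t - r) * g (r - s)) * \<bar>y s\<bar>) (conv f
        g (t - s) * \<bar>y s\<bar>)"
      by (intro has_bochner_integral_mult_left inner) auto
    then have "has_bochner_integral lborel (\<lambda>r. norm (F s r)) (conv f g (t - s) * \<bar>y s\<bar>)"
      by (rule has_bochner_integral_cong[THEN iffD1, rotated -1])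
         (use True nonneg in \<open>auto simp: F_def indicator_def abs_mult\<close>)
    then show ?thesis using True by simp
  qed (auto simp: F_def[abs_def] has_bochner_integral_zero)
  have "integrable (lborel \<Otimes>\<^sub>M lborel) (\<lambda>(s, r). F s r)"
  proof (rule lborel_pair.Fubini_integrable)
    have "integrable lborel (\<lambda>s. indicator {0<..<t} s * (conv f g (t - s) * \<bar>y s\<bar>))"
      using fgy by (simp add: conv_integrable_def)
    then show "integrable lborel (\<lambda>s. \<integral>r. norm (case (s, r) of (s, r) \<Rightarrow> F s r) \<partial>lborel)"
      using nFint by (simp add: has_bochner_integral_iff)
    show "AE s in lborel. integrable lborel (\<lambda>r. case (s, r) of (s, r) \<Rightarrow> F s r)"
      using Fint by (simp add: has_bochner_integral_iff)
  qed simp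
  from lborel_pair.Fubini_integral[OF this] lborel_pair.integrable_snd[OF this]
  have swap: "(\<integral>r. (\<integral>s. F s r \<partial>lborel) \<partial>lborel) = (\<integral>s. (\<integral>r. F s r
      \<partial>lborel) \<partial>lborel)"
    and int: "integrable lborel (\<lambda>r. \<integral>s. F s r \<partial>lborel)" by simp_all
  have "(\<integral>r. (\<integral>s. F s r \<partial>lborel) \<partial>lborel) = (\<integral>s. (\<integral>r. F s r
      \<partial>lborel) \<partial>lborel)" by (rule swap)
  also have "\<dots> = conv (conv f g) y t"
    unfolding conv_def[of "conv f g"] using Fint by (simp add: has_bochner_integral_iff)
  finally have *: "(\<integral>r. (\<integral>s. F s r \<partial>lborel) \<partial>lborel) = conv (conv f g) y t" .
  have **: "(\<integral>s. F s r \<partial>lborel) = indicator {0<..<t} r * (f (t - r) * conv g y r)" for r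
  proof (cases "r \<in> {0<..<t}")
    case True
    then have "(\<integral>s. F s r \<partial>lborel) = (\<integral>s. f (t - r) * (indicator {0<..<r} s * (g (r - s) * y s)) \<partial>lborel)"
      by (intro Bochner_Integration.integral_cong) (auto simp: F_def indicator_def)
    with True show ?thesis by (simp add: conv_def)
  next
    case False
    then have "F s r = 0" for s by (auto simp: F_def indicator_def)
    with False show ?thesis by simp
  qed
  show "conv f (conv g y) t = conv (conv f g) y t"
    using * by (simp add: conv_def[of f] **)
  show "conv_integrable f (conv g y) t"
    using int by (simp add: conv_integrable_def **)
qed

section \<open>Decay of Legendre coefficients\<close>

text \<open>The regularity of the data: \<open>f1\<close>, \<open>f2\<close>, \<open>f3\<close> are the first three derivatives
    of \<open>f\<close>, extended
  continuously to the end points, and \<open>g\<close>, cut off outside \<open>(-1,1)\<close>, is the fourth one.\<close>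

definition H4_derivs :: "(real \<Rightarrow> real) \<Rightarrow> (real \<Rightarrow> real) \<Rightarrow> (real \<Rightarrow>
    real) \<Rightarrow> (real \<Rightarrow> real) \<Rightarrow> (real \<Rightarrow> real) \<Rightarrow> bool" where
  "H4_derivs f f1 f2 f3 g \<longleftrightarrow>
     continuous_on {-1..1} f \<and> continuous_on {-1..1} f1 \<and> continuous_on {-1..1} f2 \<and> continuous_on {-1..1} f3 \<and>
     (\<forall>x\<in>{-1<..<1}. (f has_real_derivative f1 x) (at x) \<and> (f1 has_real_derivative f2 x) (at x) \<and>
        (f2 has_real_derivative f3 x) (at x)) \<and>
     integrable lborel g \<and> integrable lborel (\<lambda>x. (g x)\<^sup>2) \<and> (\<forall>x. x \<notin> {-1<..<1}
         \<longrightarrow> g x = 0) \<and>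
     (\<exists>c. \<forall>x\<in>{-1..1}. f3 x = c + integral {-1..x} g)"

text \<open>A primitive of \<open>h\<close> over the closed interval, normalised at 0, has the same
  derivative as F inside and therefore agrees with it there.\<close>

lemma continuous_extension_from_derivative:
  fixes F h :: "real \<Rightarrow> real"
  assumes h: "continuous_on {-1..1} h" and F: "\<And>x. x \<in> {-1<..<1} \<Longrightarrow> (F has_real_derivative h x) (at x)"
  obtains H where "continuous_on {-1..1} H" "\<And>x. x \<in> {-1<..<1} \<Longrightarrow> H x = F x"
proof -
  define H where "H x = F 0 + (integral {-1..x} h - integral {-1..0} h)" for x
  have H': "(H has_real_derivative h x) (at x within {-1..1})" if "x \<in> {-1..1}" for x
    unfolding H_def using integral_has_real_derivative[OF h that] by (auto intro!: derivative_eq_intros)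
  have cont: "continuous_on {-1..1} H" by (rule DERIV_continuous_on[OF H'])
  have "H x = F x" if x: "x \<in> {-1<..<1}" for x
  proof -
    have "((\<lambda>x. H x - F x) has_real_derivative 0) (at y within {-1<..<1})" if "y \<in> {-1<..<1}" for y
    proof -
      have "(H has_real_derivative h y) (at y within {-1<..<1})"
        using H'[of y] that by (intro DERIV_subset[OF H']) auto
      moreover have "(F has_real_derivative h y) (at y within {-1<..<1})"
        using F[OF that] by (rule has_field_derivative_at_within)
      ultimately show ?thesis by (auto intro!: derivative_eq_intros)
    qed
    then obtain c where "\<And>y. y \<in> {-1<..<1} \<Longrightarrow> H y - F y = c"
      using has_field_derivative_zero_constant[of "{-1<..<1}" "\<lambda>x. H x - F x"] by auto
    from this[of 0] this[of x] x show ?thesis by (simp add: H_def)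
  qed
  with cont that show thesis by blast
qed

text \<open>Since |g| <= 1 + g^2, the square integrable g is integrable on (-1,1), so its indefinite
  integral extends the third derivative continuously to the end points. Integrating downwards
  extends the second and then the first one.\<close>

lemma H4_derivs_exist:
  assumes v: "continuous_on {-1..1} v" "C_k_on 3 {-1<..<1} v" "deriv_in_L2 (-1) 1 ((deriv ^^ 3) v)"
  shows "\<exists>f1 f2 f3 g. H4_derivs v f1 f2 f3 g"
proof -
  let ?I = "{-1<..<1::real}"
  obtain g0 where g0: "set_borel_measurable lborel ?I g0" "set_integrable lborel ?I (\<lambda>x. (g0 x)\<^sup>2)"
    "\<And>c d. -1 < c \<Longrightarrow> c \<le> d \<Longrightarrow> d < 1 \<Longrightarrow> (deriv ^^ 3) v d - (deriv ^^ 3) v c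
        = (LBINT x:{c..d}. g0 x)"
    using v(3) unfolding deriv_in_L2_def by auto
  define g where "g x = indicator ?I x * g0 x" for x
  have [measurable]: "g \<in> borel_measurable borel"
    using g0(1) by (simp add: set_borel_measurable_def g_def[abs_def])
  have g2: "integrable lborel (\<lambda>x. (g x)\<^sup>2)"
  proof -
    have "(g x)\<^sup>2 = indicator ?I x *\<^sub>R (g0 x)\<^sup>2" for x by (simp add: g_def indicator_def)
    then show ?thesis using g0(2) by (simp add: set_integrable_def)
  qed
  have g1: "integrable lborel g"
  proof (rule Bochner_Integration.integrable_bound)
    show "integrable lborel (\<lambda>x. indicator ?I x + (g x)\<^sup>2)" by (intro Bochner_Integration.integrable_add g2) auto
    have "\<bar>g x\<bar> \<le> indicator ?I x + (g x)\<^sup>2" for x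
    proof (cases "x \<in> ?I")
      case True
      have "0 \<le> (\<bar>g x\<bar> - 1)\<^sup>2 + \<bar>g x\<bar>" by simp
      also have "\<dots> = 1 + (g x)\<^sup>2 - \<bar>g x\<bar>" by (simp add: power2_eq_square algebra_simps)
      finally show ?thesis using True by simp
    qed (simp add: g_def)
    then show "AE x in lborel. norm (g x) \<le> norm (indicator ?I x + (g x)\<^sup>2)"
      by (intro AE_I2) (auto intro: order_trans[OF _ abs_ge_self])
  qed simp
  have gi: "g integrable_on {a..b}" for a b
    using integrable_on_subinterval[OF integrable_on_lborel[OF g1], of a b] by simp
  have set_g: "set_integrable lborel {a..b} g" for a b
    using g1 unfolding set_integrable_def by (intro integrable_mult_indicator) auto
  define c where "c = (deriv ^^ 3) v 0 - integral {-1..0} g"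
  define f3 where "f3 x = c + integral {-1..x} g" for x
  have step: "(deriv ^^ 3) v b - (deriv ^^ 3) v a = integral {a..b} g" if "-1 < a" "a \<le> b" "b < 1" for a b
  proof -
    have "(LBINT x:{a..b}. g0 x) = (LBINT x:{a..b}. g x)"
      unfolding set_lebesgue_integral_def
      by (intro Bochner_Integration.integral_cong) (use that in \<open>auto simp: g_def indicator_def\<close>)
    also have "\<dots> = integral {a..b} g" by (rule set_borel_integral_eq_integral(2)[OF set_g])
    finally show ?thesis using g0(3)[OF that] by simp
  qed
  have f3: "f3 x = (deriv ^^ 3) v x" if "x \<in> ?I" for x
  proof (cases "0 \<le> x")
    case True
    then have "integral {-1..0} g + integral {0..x} g = integral {-1..x} g"
      using that by (intro Henstock_Kurzweil_Integration.integral_combine gi) auto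
    then show ?thesis using step[of 0 x] True that by (simp add: f3_def c_def)
  next
    case False
    then have "integral {-1..x} g + integral {x..0} g = integral {-1..0} g"
      using that by (intro Henstock_Kurzweil_Integration.integral_combine gi) auto
    then show ?thesis using step[of x 0] False that by (simp add: f3_def c_def)
  qed
  have cf3: "continuous_on {-1..1} f3"
    unfolding f3_def by (intro continuous_intros indefinite_integral_continuous_1 gi)
  have d: "((deriv ^^ j) v has_real_derivative (deriv ^^ Suc j) v x) (at x)" if "j < 3" "x \<in> ?I" for j x
    using v(2) that by (auto simp: C_k_on_def DERIV_deriv_iff_real_differentiable)
  obtain f2 where f2: "continuous_on {-1..1} f2" "\<And>x. x \<in> ?I \<Longrightarrow> f2 x = (deriv ^^ 2) v x"
  proof (rule continuous_extension_from_derivative[OF cf3])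
    show "((deriv ^^ 2) v has_real_derivative f3 x) (at x)" if "x \<in> ?I" for x
      using d[of 2 x] that f3[OF that] by (simp add: numeral_eq_Suc)
  qed blast
  obtain f1 where f1: "continuous_on {-1..1} f1" "\<And>x. x \<in> ?I \<Longrightarrow> f1 x = deriv v x"
  proof (rule continuous_extension_from_derivative[OF f2(1)])
    show "(deriv v has_real_derivative f2 x) (at x)" if "x \<in> ?I" for x
      using d[of 1 x] that f2(2)[OF that] by (simp add: numeral_eq_Suc)
  qed blast
  have "(v has_real_derivative f1 x) (at x)" if "x \<in> ?I" for x
    using d[of 0 x] that f1(2)[OF that] by simp
  moreover have "(f1 has_real_derivative f2 x) (at x)" if x: "x \<in> ?I" for x
  proof -
    have "(deriv v has_real_derivative f2 x) (at x)"
      using d[of 1 x] that f2(2)[OF that] by (simp add: numeral_eq_Suc)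
    then show ?thesis
      by (rule has_field_derivative_transform_within_open[where S = ?I]) (use f1(2) x in auto)
  qed
  moreover have "(f2 has_real_derivative f3 x) (at x)" if x: "x \<in> ?I" for x
  proof -
    have "((deriv ^^ 2) v has_real_derivative f3 x) (at x)"
      using d[of 2 x] that f3[OF that] by (simp add: numeral_eq_Suc)
    then show ?thesis
      by (rule has_field_derivative_transform_within_open[where S = ?I]) (use f2(2) x in auto)
  qed
  moreover have "g x = 0" if "x \<notin> ?I" for x using that by (auto simp: g_def)
  ultimately have "H4_derivs v f1 f2 f3 g"
    unfolding H4_derivs_def using v(1) f1(1) f2(1) cf3 g1 g2 by (auto simp: f3_def)
  then show ?thesis by blast
qed

lemma H4_derivs_diff:
  assumes "H4_derivs w w1 w2 w3 p" "H4_derivs v v1 v2 v3 q"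
  shows "H4_derivs (\<lambda>x. w x - v x) (\<lambda>x. w1 x - v1 x) (\<lambda>x. w2 x - v2 x) (\<lambda>x. w3 x - v3 x) (\<lambda>x. p x - q x)"
proof -
  have pq: "integrable lborel p" "integrable lborel q" "integrable lborel (\<lambda>x. (p x)\<^sup>2)" "integrable lborel (\<lambda>x. (q x)\<^sup>2)"
    using assms by (auto simp: H4_derivs_def)
  then have [measurable]: "p \<in> borel_measurable lborel" "q \<in> borel_measurable lborel" by auto
  have "integrable lborel (\<lambda>x. (p x - q x)\<^sup>2)"
  proof (rule Bochner_Integration.integrable_bound)
    show "integrable lborel (\<lambda>x. 2 * (p x)\<^sup>2 + 2 * (q x)\<^sup>2)" using pq by auto
    have "(p x - q x)\<^sup>2 \<le> 2 * (p x)\<^sup>2 + 2 * (q x)\<^sup>2" for x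
      using zero_le_power2[of "p x + q x"] by (simp add: power2_eq_square algebra_simps)
    then show "AE x in lborel. norm ((p x - q x)\<^sup>2) \<le> norm (2 * (p x)\<^sup>2 + 2 * (q x)\<^sup>2)" by auto
  qed measurable
  moreover obtain c d where "\<And>x. x \<in> {-1..1} \<Longrightarrow> w3 x = c + integral {-1..x} p"
    "\<And>x. x \<in> {-1..1} \<Longrightarrow> v3 x = d + integral {-1..x} q"
    using assms unfolding H4_derivs_def by metis
  moreover have "integral {-1..x} (\<lambda>x. p x - q x) = integral {-1..x} p - integral {-1..x} q" for x
    using integrable_on_subinterval[OF integrable_on_lborel[OF pq(1)], of "-1" x]
      integrable_on_subinterval[OF integrable_on_lborel[OF pq(2)], of "-1" x]
    by (intro integral_diff) auto
  ultimately have "\<exists>c. \<forall>x\<in>{-1..1}. w3 x - v3 x = c + integral {-1..x} (\<lambda>x. p x - q x)"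
    by (intro exI[of _ "c - d"]) auto
  with \<open>integrable lborel (\<lambda>x. (p x - q x)\<^sup>2)\<close> pq assms show ?thesis
    unfolding H4_derivs_def by (auto intro!: continuous_intros derivative_eq_intros)
qed

section \<open>Integration by parts up to the fourth derivative\<close>

text \<open>Integration by parts for a factor that is only an indefinite Lebesgue integral. Fubini
  on s <= x turns the inner integral of p' over [s,1] into p(1) - p(s) = - p(s).\<close>

lemma integral_primitive_mult_deriv:
  fixes g :: "real \<Rightarrow> real" and p :: "real poly"
  assumes g: "integrable lborel g" "\<And>x. x \<notin> {-1<..<1} \<Longrightarrow> g x = 0" and p: "poly p 1 = 0"
  shows "integral {-1..1} (\<lambda>x. integral {-1..x} g * poly (pderiv p) x) = - (\<integral>x. g x * poly p x \<partial>lborel)"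
proof -
  have [measurable]: "g \<in> borel_measurable borel" using g(1) by auto
  define \<phi>' where "\<phi>' = poly (pderiv p)"
  have c\<phi>': "continuous_on A \<phi>'" for A unfolding \<phi>'_def by (intro continuous_intros)
  have [measurable]: "\<phi>' \<in> borel_measurable borel" by (intro borel_measurable_continuous_onI c\<phi>')
  define F where "F s x = (if -1 < s \<and> s \<le> x \<and> x \<le> 1 then g s * \<phi>' x else 0)" for s x
  have [measurable]: "(\<lambda>(s, x). F s x) \<in> borel_measurable (lborel \<Otimes>\<^sub>M lborel)"
    unfolding F_def by measurable
  have ind: "integrable lborel (\<lambda>x. indicator {a..b} x * h x)" if "continuous_on {a..b} h" for a b and h :: "real \<Rightarrow> real"
    using borel_integrable_compact[OF compact_Icc that] by simp
  have F1: "F s x = g s * (indicator {s..1} x * \<phi>' x)" for s x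
    using g(2)[of s] by (auto simp: F_def indicator_def)
  have "bounded (\<phi>' ` {-1..1})"
    by (intro compact_imp_bounded compact_continuous_image c\<phi>' compact_Icc)
  then obtain B where "\<forall>y\<in>\<phi>' ` {-1..1}. norm y \<le> B" unfolding bounded_iff by blast
  then have B: "\<And>x. x \<in> {-1..1} \<Longrightarrow> \<bar>\<phi>' x\<bar> \<le> B" by auto
  have "integrable (lborel \<Otimes>\<^sub>M lborel) (\<lambda>(s, x). F s x)"
  proof (rule lborel_pair.Fubini_integrable)
    show "integrable lborel (\<lambda>s. \<integral>x. norm (case (s, x) of (s, x) \<Rightarrow> F s x) \<partial>lborel)"
    proof (rule Bochner_Integration.integrable_bound)
      show "integrable lborel (\<lambda>s. \<bar>g s\<bar> * (2 * B))" using g(1) by auto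
      have "(\<integral>x. norm (F s x) \<partial>lborel) \<le> \<bar>g s\<bar> * (2 * B)" for s
      proof -
        have "(\<integral>x. norm (F s x) \<partial>lborel) \<le> (\<integral>x. \<bar>g s\<bar> * B * indicator {-1..1::real} x \<partial>lborel)"
        proof (rule Bochner_Integration.integral_mono)
          show "integrable lborel (\<lambda>x. norm (F s x))"
            unfolding F1 by (intro integrable_norm integrable_mult_right ind c\<phi>')
          show "norm (F s x) \<le> \<bar>g s\<bar> * B * indicator {-1..1} x" for x
            using B[of x] by (auto simp: F_def abs_mult indicator_def intro!: mult_left_mono mult_nonneg_nonneg)
        qed (simp add: integrable_mult_right)
        then show ?thesis by simp
      qed
      then show "AE s in lborel. norm (\<integral>x. norm (case (s, x) of (s, x) \<Rightarrow> F s x) \<partial>lborel) \<le>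
          norm (\<bar>g s\<bar> * (2 * B))"
        by (intro AE_I2) (force intro: order_trans[OF _ abs_ge_self])
    qed measurable
    show "AE s in lborel. integrable lborel (\<lambda>x. case (s, x) of (s, x) \<Rightarrow> F s x)"
      unfolding F1 prod.case by (intro AE_I2 integrable_mult_right ind c\<phi>')
  qed simp
  from lborel_pair.Fubini_integral[OF this] lborel_pair.integrable_snd[OF this]
  have eq: "(\<integral>x. (\<integral>s. F s x \<partial>lborel) \<partial>lborel) = (\<integral>s. (\<integral>x. F s x
      \<partial>lborel) \<partial>lborel)"
    and int: "integrable lborel (\<lambda>x. \<integral>s. F s x \<partial>lborel)" by simp_all
  have "(\<integral>x. F s x \<partial>lborel) = - (g s * poly p s)" for s
  proof (cases "s \<in> {-1<..<1}")
    case True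
    have "(\<integral>x. indicator {s..1} x *\<^sub>R \<phi>' x \<partial>lborel) = poly p 1 - poly p s"
      unfolding \<phi>'_def using True by (intro integral_FTC_atLeastAtMost) 
        (auto intro!: has_field_derivative_at_within poly_DERIV continuous_intros simp flip: has_real_derivative_iff_has_vector_derivative)
    then show ?thesis unfolding F1 using p by simp
  qed (simp add: F1 g(2))
  then have "(\<integral>s. (\<integral>x. F s x \<partial>lborel) \<partial>lborel) = - (\<integral>s. g s * poly p s \<partial>lborel)" by simp
  moreover have Fx: "(\<integral>s. F s x \<partial>lborel) = indicator {-1..1} x * (integral {-1..x} g * \<phi>' x)" for x
  proof (cases "x \<in> {-1..1}")
    case True
    have "(\<integral>s. F s x \<partial>lborel) = (\<integral>s. (indicator {-1..x} s *\<^sub>R g s) * \<phi>' x \<partial>lborel)"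
      using True g(2)[of "-1"] by (intro Bochner_Integration.integral_cong) (auto simp: F_def indicator_def)
    also have "\<dots> = (LBINT s:{-1..x}. g s) * \<phi>' x" unfolding set_lebesgue_integral_def by simp
    also have "(LBINT s:{-1..x}. g s) = integral {-1..x} g"
      by (intro set_borel_integral_eq_integral(2)) (use integrable_mult_indicator[of "{-1..x}" lborel g] g(1) in \<open>simp add:
          set_integrable_def\<close>)
    finally show ?thesis using True by simp
  next
    case False
    then have "F s x = 0" for s by (auto simp: F_def)
    with False show ?thesis by simp
  qed
  moreover have "(\<integral>x. (\<integral>s. F s x \<partial>lborel) \<partial>lborel) = integral {-1..1} (\<lambda>x. integral
      {-1..x} g * \<phi>' x)"
    using set_borel_integral_eq_integral(2)[of "{-1..1}" "\<lambda>x. integral {-1..x} g * \<phi>' x"] int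
    by (simp add: set_lebesgue_integral_def set_integrable_def Fx)
  ultimately show ?thesis using eq by (simp add: \<phi>'_def)
qed

lemma legendre_L_smult: "legendre_L (smult c p) = smult c (legendre_L p)"
  by (simp add: legendre_L_def pderiv_smult)

text \<open>Moves the operator from p to f by two integrations by parts. The boundary function
  contains 1 - x^2, so continuity up to the ends and derivatives in the interior suffice.\<close>

lemma integral_legendre_L_C2:
  fixes f f1 f2 :: "real \<Rightarrow> real"
  assumes c: "continuous_on {-1..1} f" "continuous_on {-1..1} f1" "continuous_on {-1..1} f2"
    and d: "\<And>x. x \<in> {-1<..<1} \<Longrightarrow> (f has_real_derivative f1 x) (at x)"
      "\<And>x. x \<in> {-1<..<1} \<Longrightarrow> (f1 has_real_derivative f2 x) (at x)"
  shows "integral {-1..1} (\<lambda>x. f x * poly (legendre_L p) x) =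
    integral {-1..1} (\<lambda>x. ((1 - x\<^sup>2) * f2 x - 2 * x * f1 x) * poly p x)"
proof -
  define \<Phi> where "\<Phi> x = (1 - x\<^sup>2) * (f x * poly (pderiv p) x - f1 x * poly p x)" for x
  have "((\<lambda>x. f x * poly (legendre_L p) x - ((1 - x\<^sup>2) * f2 x - 2 * x * f1 x) * poly p x) has_integral \<Phi> 1 - \<Phi> (-1)) {-1..1}"
  proof (rule fundamental_theorem_of_calculus_interior)
    show "continuous_on {-1..1} \<Phi>" unfolding \<Phi>_def by (intro continuous_intros c)
    fix x :: real assume x: "x \<in> {-1<..<1}"
    have "(\<Phi> has_real_derivative (- 2 * x) * (f x * poly (pderiv p) x - f1 x * poly p x) + (1 - x\<^sup>2) *
       (f1 x * poly (pderiv p) x + f x * poly (pderiv (pderiv p)) x - (f2 x * poly p x + f1 x * poly (pderiv p) x))) (at x)"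
      unfolding \<Phi>_def using d[OF x] by (auto intro!: derivative_eq_intros simp: algebra_simps)
    then have "(\<Phi> has_real_derivative f x * poly (legendre_L p) x - ((1 - x\<^sup>2) * f2 x - 2 * x * f1 x) * poly p x) (at x)"
      by (rule DERIV_cong) (simp add: legendre_L_def pderiv_mult pderiv_pCons power2_eq_square algebra_simps
          del: pCons_mult)
    then show "(\<Phi> has_vector_derivative f x * poly (legendre_L p) x - ((1 - x\<^sup>2) * f2 x - 2 * x * f1 x) * poly p x) (at x)"
      by (simp flip: has_real_derivative_iff_has_vector_derivative)
  qed simp
  then have "integral {-1..1} (\<lambda>x. f x * poly (legendre_L p) x - ((1 - x\<^sup>2) * f2 x - 2 * x * f1 x) * poly p x) = 0"
    by (simp add: \<Phi>_def has_integral_iff)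
  then show ?thesis
    by (subst (asm) integral_diff) (auto intro!: integrable_continuous_real continuous_intros c)
qed

text \<open>Formally, applying the Legendre operator twice to f gives (1 - x^2)^2 g + Q, where Q
  collects the derivatives of f of order at most three.\<close>

lemma integral_legendre_L_H4:
  assumes "H4_derivs f f1 f2 f3 g"
  defines "Q \<equiv> \<lambda>x. (1 - x\<^sup>2) * (- 6 * f2 x - 8 * x * f3 x) + 2 * x * (4 * x * f2 x + 2 * f1 x)"
  shows "continuous_on {-1..1} Q"
    "integral {-1..1} (\<lambda>x. f x * poly (legendre_L (legendre_L p)) x) =
    (\<integral>x. g x * ((1 - x\<^sup>2)\<^sup>2 * poly p x) \<partial>lborel) + integral {-1..1} (\<lambda>x. Q x * poly p x)"
proof -
  note H = assms(1)[unfolded H4_derivs_def]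
  have c: "continuous_on {-1..1} f" "continuous_on {-1..1} f1" "continuous_on {-1..1} f2" "continuous_on {-1..1} f3"
    and d: "\<And>x. x \<in> {-1<..<1} \<Longrightarrow> (f has_real_derivative f1 x) (at x)"
      "\<And>x. x \<in> {-1<..<1} \<Longrightarrow> (f1 has_real_derivative f2 x) (at x)"
      "\<And>x. x \<in> {-1<..<1} \<Longrightarrow> (f2 has_real_derivative f3 x) (at x)"
    and g: "integrable lborel g" "\<And>x. x \<notin> {-1<..<1} \<Longrightarrow> g x = 0"
    using H by auto
  obtain c3 where f3: "\<And>x. x \<in> {-1..1} \<Longrightarrow> f3 x = c3 + integral {-1..x} g"
    using H by blast
  show "continuous_on {-1..1} Q" unfolding Q_def by (intro continuous_intros c)
  define F where "F x = (1 - x\<^sup>2) * f2 x - 2 * x * f1 x" for x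
  define q where "q = [:1, 0, -1:] ^ 2 * p"
  have q: "poly q x = (1 - x\<^sup>2)\<^sup>2 * poly p x" for x
    by (simp add: q_def power2_eq_square algebra_simps)
  have q': "poly (pderiv q) x = (1 - x\<^sup>2)\<^sup>2 * poly (pderiv p) x - 4 * x * (1 - x\<^sup>2) * poly p x" for x
    by (simp add: q_def power2_eq_square pderiv_mult pderiv_pCons algebra_simps del: pCons_mult)
  \<comment> \<open>Green's boundary function would be (1 - x^2)(F p' - F' p), but F' contains (1 -
    x^2) f3, and f3 need not be differentiable at every point. That part, equal to - f3 q, is left
    out here and treated by \<open>integral_primitive_mult_deriv\<close>.\<close>
  define \<Phi> where "\<Phi> x = (1 - x\<^sup>2) * (F x * poly (pderiv p) x + (4 * x * f2 x + 2 * f1 x) * poly p x)" for x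
  have "((\<lambda>x. F x * poly (legendre_L p) x - (Q x * poly p x - f3 x * poly (pderiv q) x)) has_integral \<Phi> 1 - \<Phi> (-1)) {-1..1}"
  proof (rule fundamental_theorem_of_calculus_interior)
    show "continuous_on {-1..1} \<Phi>" unfolding \<Phi>_def F_def by (intro continuous_intros c)
    fix x :: real assume x: "x \<in> {-1<..<1}"
    have "(\<Phi> has_real_derivative (- 2 * x) * (F x * poly (pderiv p) x + (4 * x * f2 x + 2 * f1 x) * poly p x) + (1 - x\<^sup>2) *
       (((- 2 * x) * f2 x + (1 - x\<^sup>2) * f3 x - (2 * f1 x + 2 * x * f2 x)) * poly (pderiv p) x + F x * poly (pderiv (pderiv p)) x
        + (4 * f2 x + 4 * x * f3 x + 2 * f2 x) * poly p x + (4 * x * f2 x + 2 * f1 x) * poly (pderiv p) x)) (at x)"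
      unfolding \<Phi>_def F_def using d[OF x] by (auto intro!: derivative_eq_intros simp: algebra_simps power2_eq_square power3_eq_cube)
    then have "(\<Phi> has_real_derivative F x * poly (legendre_L p) x - (Q x * poly p x - f3 x * poly (pderiv q) x)) (at x)"
      by (rule DERIV_cong) (simp add: legendre_L_def pderiv_mult pderiv_pCons power2_eq_square q' Q_def algebra_simps
          del: pCons_mult)
    then show "(\<Phi> has_vector_derivative F x * poly (legendre_L p) x - (Q x * poly p x - f3 x * poly (pderiv q) x)) (at x)"
      by (simp flip: has_real_derivative_iff_has_vector_derivative)
  qed simp
  then have "integral {-1..1} (\<lambda>x. F x * poly (legendre_L p) x - (Q x * poly p x - f3 x * poly (pderiv q) x)) = 0"
    by (simp add: \<Phi>_def has_integral_iff)
  moreover have "(\<lambda>x. F x * poly (legendre_L p) x) integrable_on {-1..1}" "(\<lambda>x. Q x * poly p x) integrable_on {-1..1}"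
    "(\<lambda>x. f3 x * poly (pderiv q) x) integrable_on {-1..1}"
    unfolding F_def Q_def by (intro integrable_continuous_real continuous_intros c)+
  ultimately have 1: "integral {-1..1} (\<lambda>x. F x * poly (legendre_L p) x) =
      integral {-1..1} (\<lambda>x. Q x * poly p x) - integral {-1..1} (\<lambda>x. f3 x * poly (pderiv q) x)"
    by (simp only: integral_diff integrable_diff)
  have "integral {-1..1} (\<lambda>x. f3 x * poly (pderiv q) x) = integral {-1..1} (\<lambda>x. c3 * poly (pderiv q) x + integral
      {-1..x} g * poly (pderiv q) x)"
    by (intro Henstock_Kurzweil_Integration.integral_cong) (auto simp: f3 algebra_simps)
  also have "\<dots> = c3 * integral {-1..1} (poly (pderiv q)) + integral {-1..1} (\<lambda>x. integral {-1..x} g * poly (pderiv q) x)"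
  proof -
    have "g integrable_on {-1..1}"
      using integrable_on_subinterval[OF integrable_on_lborel[OF g(1)]] by simp
    from indefinite_integral_continuous_1[OF this] show ?thesis
      by (subst integral_add) (auto intro!: integrable_continuous_real continuous_intros)
  qed
  also have "integral {-1..1} (\<lambda>x. integral {-1..x} g * poly (pderiv q) x) = - (\<integral>x. g x * poly q x \<partial>lborel)"
    by (intro integral_primitive_mult_deriv g) (simp_all add: q[of 1])
  also have "integral {-1..1} (poly (pderiv q)) = poly q 1 - poly q (-1)"
    by (intro integral_unique fundamental_theorem_of_calculus)
       (auto intro!: has_field_derivative_at_within poly_DERIV simp flip: has_real_derivative_iff_has_vector_derivative)
  finally have 2: "integral {-1..1} (\<lambda>x. f3 x * poly (pderiv q) x) = - (\<integral>x. g x * poly q x \<partial>lborel)"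
    by (simp add: q)
  have 0: "integral {-1..1} (\<lambda>x. f x * poly (legendre_L (legendre_L p)) x) = integral {-1..1} (\<lambda>x. F x * poly (legendre_L p) x)"
    unfolding F_def by (rule integral_legendre_L_C2[OF c(1-3) d(1,2)])
  show "integral {-1..1} (\<lambda>x. f x * poly (legendre_L (legendre_L p)) x) =
    (\<integral>x. g x * ((1 - x\<^sup>2)\<^sup>2 * poly p x) \<partial>lborel) + integral {-1..1} (\<lambda>x. Q x * poly p x)"
    unfolding 0 1 2 q by linarith
qed

section \<open>Summability of the weighted coefficients\<close>

text \<open>A substitute for Cauchy-Schwarz: integrate |h| |P_n| <= \<sigma> h^2 + P_n^2 / \<sigma>
  with \<sigma> the L2 norm of P_n. Only the decay of order n^(-1/2) matters later.\<close>

lemma integral_mult_legendre_P_le: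
  assumes [measurable]: "h \<in> borel_measurable borel" and h: "integrable lborel (\<lambda>x. (h x)\<^sup>2)"
    and 0: "\<And>x. x \<notin> {-1..1} \<Longrightarrow> h x = 0"
    and \<psi>: "continuous_on UNIV \<psi>" "\<And>x. x \<in> {-1..1} \<Longrightarrow> \<bar>\<psi> x\<bar> \<le> 1"
  shows "\<bar>\<integral>x. h x * (\<psi> x * legendre_P n x) \<partial>lborel\<bar> \<le> ((\<integral>x. (h x)\<^sup>2
      \<partial>lborel) + 1) * sqrt (2 / (2 * real n + 1))"
proof -
  define \<sigma> where "\<sigma> = sqrt (2 / (2 * real n + 1))"
  have \<sigma>: "0 < \<sigma>" "\<sigma>\<^sup>2 = 2 / (2 * real n + 1)" by (auto simp: \<sigma>_def)
  have [measurable]: "legendre_P n \<in> borel_measurable borel" "\<psi> \<in> borel_measurable borel"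
    by (intro borel_measurable_continuous_onI continuous_on_legendre_P \<psi>)+
  have iP: "integrable lborel (\<lambda>x. indicator {-1..1} x *\<^sub>R (legendre_P n x)\<^sup>2)"
    by (intro borel_integrable_compact continuous_intros compact_Icc)
  have IP: "(\<integral>x. indicator {-1..1} x *\<^sub>R (legendre_P n x)\<^sup>2 \<partial>lborel) = \<sigma>\<^sup>2"
    using set_borel_integral_eq_integral(2)[of "{-1..1}" "\<lambda>x. (legendre_P n x)\<^sup>2"] iP
    by (simp add: set_lebesgue_integral_def set_integrable_def integral_legendre_P_square \<sigma>)
  let ?b = "\<lambda>x. \<sigma> * (h x)\<^sup>2 + (indicator {-1..1} x *\<^sub>R (legendre_P n x)\<^sup>2) / \<sigma>"
  have ib: "integrable lborel ?b"
    by (intro Bochner_Integration.integrable_add integrable_mult_right integrable_divide iP h)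
  have le: "norm (h x * (\<psi> x * legendre_P n x)) \<le> ?b x" for x
  proof (cases "x \<in> {-1..1}")
    case True
    have "\<bar>h x * (\<psi> x * legendre_P n x)\<bar> \<le> \<bar>h x\<bar> * (1 * \<bar>legendre_P n x\<bar>)"
      unfolding abs_mult using \<psi>(2)[OF True] by (intro mult_left_mono mult_right_mono) auto
    also have "\<dots> \<le> \<sigma> * \<bar>h x\<bar>\<^sup>2 + \<bar>legendre_P n x\<bar>\<^sup>2 / \<sigma>"
    proof -
      have "0 \<le> (\<sigma> * \<bar>h x\<bar> - \<bar>legendre_P n x\<bar>)\<^sup>2 + \<sigma> * \<bar>h x\<bar> *
          \<bar>legendre_P n x\<bar>" using \<sigma>(1) by simp
      also have "\<dots> \<le> \<sigma> * (\<sigma> * \<bar>h x\<bar>\<^sup>2 + \<bar>legendre_P n x\<bar>\<^sup>2 / \<sigma> -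
          \<bar>h x\<bar> * \<bar>legendre_P n x\<bar>)"
        using \<sigma>(1) by (simp add: power2_eq_square algebra_simps)
      finally show ?thesis using \<sigma>(1) by (simp add: zero_le_mult_iff)
    qed
    finally show ?thesis using True by simp
  qed (use 0 in \<open>simp add: \<sigma>(1)\<close>)
  have "\<bar>\<integral>x. h x * (\<psi> x * legendre_P n x) \<partial>lborel\<bar> \<le> (\<integral>x. norm (h x * (\<psi> x *
      legendre_P n x)) \<partial>lborel)"
    using integral_norm_bound[of lborel "\<lambda>x. h x * (\<psi> x * legendre_P n x)"] by simp
  also have "\<dots> \<le> integral\<^sup>L lborel ?b"
  proof (rule Bochner_Integration.integral_mono[OF _ ib le])
    show "integrable lborel (\<lambda>x. norm (h x * (\<psi> x * legendre_P n x)))"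
      using le by (intro Bochner_Integration.integrable_bound[OF ib] AE_I2) (auto intro: order_trans[OF _ abs_ge_self])
  qed
  also have "\<dots> = \<sigma> * (\<integral>x. (h x)\<^sup>2 \<partial>lborel) + \<sigma>\<^sup>2 / \<sigma>"
    using h iP by (subst Bochner_Integration.integral_add) (auto simp: IP[simplified])
  also have "\<dots> = ((\<integral>x. (h x)\<^sup>2 \<partial>lborel) + 1) * \<sigma>"
    using \<sigma>(1) by (simp add: power2_eq_square algebra_simps)
  finally show ?thesis by (simp add: \<sigma>_def)
qed

lemma legendre_coeff_eq:
  assumes "continuous_on {-1..1} f"
  shows "legendre_coeff f n = (2 * real n + 1) / 2 * integral {-1..1} (\<lambda>x. f x * legendre_P n x)"
  unfolding legendre_coeff_def
  by (subst set_borel_integral_eq_integral)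
     (auto simp: set_integrable_def simp del: real_scaleR_def intro!: borel_integrable_compact continuous_intros assms)

lemma legendre_coeff_diff:
  assumes "continuous_on {-1..1} f" "continuous_on {-1..1} g"
  shows "legendre_coeff (\<lambda>x. f x - g x) n = legendre_coeff f n - legendre_coeff g n"
proof -
  have "integral {-1..1} (\<lambda>x. (f x - g x) * legendre_P n x) =
    integral {-1..1} (\<lambda>x. f x * legendre_P n x) - integral {-1..1} (\<lambda>x. g x * legendre_P n x)"
    unfolding left_diff_distrib by (intro integral_diff integrable_continuous_real continuous_intros assms)
  then show ?thesis
    using assms by (simp add: legendre_coeff_eq continuous_on_diff right_diff_distrib)
qed

text \<open>Moving the operator twice onto f bounds lambda_n^2 times the integral of f P_n by a
  multiple of n^(-1/2). The factor (2n + 1)/2 of the coefficient and one lambda_n are then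
  affordable: the terms are O(n^(-3/2)).\<close>

lemma summable_eigenvalue_legendre_coeff:
  assumes H: "H4_derivs f f1 f2 f3 g"
  shows "summable (\<lambda>n. legendre_eigenvalue n * \<bar>legendre_coeff f n\<bar>)"
proof -
  define Q where "Q x = (1 - x\<^sup>2) * (- 6 * f2 x - 8 * x * f3 x) + 2 * x * (4 * x * f2 x + 2 * f1 x)" for x
  have cf: "continuous_on {-1..1} f" using H by (simp add: H4_derivs_def)
  have cQ: "continuous_on {-1..1} Q"
    using integral_legendre_L_H4(1)[OF H] by (simp add: Q_def[abs_def])
  define Q0 where "Q0 x = indicator {-1..1} x *\<^sub>R Q x" for x
  have Q0: "Q0 \<in> borel_measurable borel" "integrable lborel (\<lambda>x. (Q0 x)\<^sup>2)"
  proof -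
    have "integrable lborel Q0"
      unfolding Q0_def[abs_def] by (intro borel_integrable_compact compact_Icc cQ)
    then show "Q0 \<in> borel_measurable borel" by auto
    have "(Q0 x)\<^sup>2 = indicator {-1..1} x *\<^sub>R (Q x)\<^sup>2" for x by (simp add: Q0_def indicator_def)
    then show "integrable lborel (\<lambda>x. (Q0 x)\<^sup>2)"
      by (simp del: scaleR_conv_of_real real_scaleR_def) (intro borel_integrable_compact compact_Icc continuous_intros cQ)
  qed
  have g: "g \<in> borel_measurable borel" "integrable lborel (\<lambda>x. (g x)\<^sup>2)" "\<And>x. x \<notin> {-1..1} \<Longrightarrow> g x = 0"
    using H by (auto simp: H4_derivs_def)
  define C where "C = (\<integral>x. (g x)\<^sup>2 \<partial>lborel) + 1 + ((\<integral>x. (Q0 x)\<^sup>2 \<partial>lborel) + 1)"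
  have bound: "(legendre_eigenvalue n)\<^sup>2 * \<bar>integral {-1..1} (\<lambda>x. f x * legendre_P n x)\<bar> \<le> C * sqrt
      (2 / (2 * real n + 1))" for n
  proof -
    have "(\<integral>x. Q0 x * legendre_P n x \<partial>lborel) = (LBINT x:{-1..1}. Q x * legendre_P n x)"
      by (simp add: set_lebesgue_integral_def Q0_def mult.assoc)
    also have "\<dots> = integral {-1..1} (\<lambda>x. Q x * legendre_P n x)"
      by (intro set_borel_integral_eq_integral)
         (auto simp: set_integrable_def simp del: real_scaleR_def intro!: borel_integrable_compact continuous_intros cQ)
    finally have Q: "integral {-1..1} (\<lambda>x. Q x * legendre_P n x) = (\<integral>x. Q0 x * (1 * legendre_P n x) \<partial>lborel)" by simp
    have "legendre_L (legendre_L (legendre_poly n)) = smult ((legendre_eigenvalue n)\<^sup>2) (legendre_poly n)"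
      by (simp only: legendre_ode legendre_L_smult smult_smult) (simp add: power2_eq_square)
    then have "(\<lambda>x. f x * poly (legendre_L (legendre_L (legendre_poly n))) x) =
        (\<lambda>x. (legendre_eigenvalue n)\<^sup>2 * (f x * legendre_P n x))"
      by (simp add: legendre_P_poly mult.left_commute)
    then have "(legendre_eigenvalue n)\<^sup>2 * integral {-1..1} (\<lambda>x. f x * legendre_P n x) =
        integral {-1..1} (\<lambda>x. f x * poly (legendre_L (legendre_L (legendre_poly n))) x)" by simp
    also have "\<dots> = (\<integral>x. g x * ((1 - x\<^sup>2)\<^sup>2 * legendre_P n x) \<partial>lborel) + integral {-1..1}
        (\<lambda>x. Q x * legendre_P n x)"
      unfolding legendre_P_poly Q_def by (rule integral_legendre_L_H4(2)[OF H])
    finally have "(legendre_eigenvalue n)\<^sup>2 * integral {-1..1} (\<lambda>x. f x * legendre_P n x) =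
        (\<integral>x. g x * ((1 - x\<^sup>2)\<^sup>2 * legendre_P n x) \<partial>lborel) + (\<integral>x. Q0 x * (1 * legendre_P
            n x) \<partial>lborel)"
      unfolding Q .
    from arg_cong[OF this, of abs]
    have "(legendre_eigenvalue n)\<^sup>2 * \<bar>integral {-1..1} (\<lambda>x. f x * legendre_P n x)\<bar> =
        \<bar>(\<integral>x. g x * ((1 - x\<^sup>2)\<^sup>2 * legendre_P n x) \<partial>lborel) + (\<integral>x. Q0 x * (1 *
            legendre_P n x) \<partial>lborel)\<bar>"
      unfolding abs_mult abs_power2 .
    also have "\<dots> \<le> \<bar>\<integral>x. g x * ((1 - x\<^sup>2)\<^sup>2 * legendre_P n x) \<partial>lborel\<bar> +
        \<bar>\<integral>x. Q0 x * (1 * legendre_P n x) \<partial>lborel\<bar>"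
      by (rule abs_triangle_ineq)
    also have "\<dots> \<le> ((\<integral>x. (g x)\<^sup>2 \<partial>lborel) + 1) * sqrt (2 / (2 * real n + 1)) + ((\<integral>x.
        (Q0 x)\<^sup>2 \<partial>lborel) + 1) * sqrt (2 / (2 * real n + 1))"
    proof (intro add_mono integral_mult_legendre_P_le g Q0)
      show "\<bar>(1 - x\<^sup>2)\<^sup>2\<bar> \<le> 1" if "x \<in> {-1..1}" for x :: real
      proof -
        have "x\<^sup>2 \<le> 1" using that by (simp add: abs_square_le_1 abs_le_iff)
        then have "\<bar>1 - x\<^sup>2\<bar> \<le> 1" by (simp add: abs_le_iff)
        then show ?thesis by (simp add: abs_square_le_1)
      qed
    qed (auto simp: Q0_def intro!: continuous_intros)
    finally show ?thesis by (simp add: C_def distrib_right)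
  qed
  show ?thesis
  proof (rule summable_comparison_test_ev)
    show "summable (\<lambda>n. 2 * C * real n powr (- 3 / 2))"
      by (intro summable_mult) (simp add: summable_real_powr_iff)
    show "\<forall>\<^sub>F n in sequentially. norm (legendre_eigenvalue n * \<bar>legendre_coeff f n\<bar>) \<le> 2 * C * real n powr (- 3 / 2)"
      using eventually_gt_at_top[of 0]
    proof eventually_elim
      case (elim n)
      define l where "l = legendre_eigenvalue n"
      define I where "I = \<bar>integral {-1..1} (\<lambda>x. f x * legendre_P n x)\<bar>"
      define m where "m = (2 * real n + 1) / 2"
      have "C \<ge> 0" unfolding C_def by (intro add_nonneg_nonneg Bochner_Integration.integral_nonneg) auto
      have l: "l > 0" "(real n)\<^sup>2 \<le> l" using elim by (auto simp: l_def legendre_eigenvalue_def power2_eq_square algebra_simps add_pos_pos)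
      have m: "0 < m" "m \<le> 4 * real n" using elim by (auto simp: m_def)
      have "2 / (2 * real n + 1) = 1 / m" by (simp add: m_def)
      with bound[of n] have "l\<^sup>2 * I \<le> C * sqrt (1 / m)" by (simp add: l_def I_def)
      \<comment> \<open>The factor m / l turns l^2 I into l (m I), which is the term of the series,
        since m I is the modulus of the coefficient.\<close>
      then have "l\<^sup>2 * I * (m / l) \<le> C * sqrt (1 / m) * (m / l)"
        using m l by (intro mult_right_mono) auto
      also have "l\<^sup>2 * I * (m / l) = l * (m * I)" using l by (simp add: power2_eq_square field_simps)
      also have "C * sqrt (1 / m) * (m / l) = C * sqrt m / l"
      proof -
        have "sqrt (1 / m) * m = sqrt m" using m by (simp add: real_sqrt_divide real_div_sqrt)
        then show ?thesis by (metis mult.assoc times_divide_eq_right)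
      qed
      also have "\<dots> \<le> C * sqrt (4 * real n) / (real n)\<^sup>2"
        using l m elim \<open>C \<ge> 0\<close> by (intro frac_le mult_left_mono) auto
      also have "\<dots> = 2 * C * (real n powr (1 / 2) / real n powr 2)"
        using elim by (simp add: real_sqrt_mult powr_half_sqrt)
      also have "\<dots> = 2 * C * real n powr (- 3 / 2)" by (subst powr_diff[symmetric]) simp
      finally show ?case
        using l by (simp add: legendre_coeff_eq[OF cf] l_def I_def m_def abs_mult)
    qed
  qed
qed

section \<open>Uniqueness\<close>

lemma caputo_integrand:
  assumes "0 < a" "a < 1"
  shows "pker (1 - a) (t - s) * d = 1 / Gamma (1 - a) * (d / (t - s) powr a)"
  by (simp add: pker_def powr_minus_divide)

lemma caputo_eq_conv:
  assumes "0 < a" "a < 1"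
  shows "caputo a u t = conv (pker (1 - a)) (deriv u) t"
proof -
  have "conv (pker (1 - a)) (deriv u) t =
      (\<integral>s. 1 / Gamma (1 - a) * (indicator {0<..<t} s * (deriv u s / (t - s) powr a)) \<partial>lborel)"
    unfolding conv_def caputo_integrand[OF assms] by (intro Bochner_Integration.integral_cong) auto
  also have "\<dots> = caputo a u t"
    by (subst integral_mult_right_zero) (simp add: caputo_def set_lebesgue_integral_def)
  finally show ?thesis by simp
qed

lemma caputo_exists_iff:
  assumes "0 < a" "a < 1"
  shows "caputo_exists a u t \<longleftrightarrow>
    (\<forall>s\<in>{0<..<t}. u differentiable (at s)) \<and> conv_integrable (pker (1 - a)) (deriv u) t"
proof -
  have eq: "(\<lambda>s. indicator {0<..<t} s * (pker (1 - a) (t - s) * deriv u s)) =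
     (\<lambda>s. 1 / Gamma (1 - a) * (indicator {0<..<t} s * (deriv u s / (t - s) powr a)))"
    unfolding caputo_integrand[OF assms] by (auto simp: fun_eq_iff)
  have "Gamma (1 - a) > 0" using assms by (simp add: Gamma_real_pos)
  then have "conv_integrable (pker (1 - a)) (deriv u) t \<longleftrightarrow>
     integrable lborel (\<lambda>s. indicator {0<..<t} s * (deriv u s / (t - s) powr a))"
    unfolding conv_integrable_def eq
    by (subst integrable_mult_left_iff) simp
  then show ?thesis by (simp add: caputo_exists_def set_integrable_def)
qed

lemma conv_integrable_bounded:
  assumes k: "conv_integrable k (\<lambda>_. 1) t" and [measurable]: "y \<in> borel_measurable borel"
    and B: "\<And>s. 0 < s \<Longrightarrow> s < t \<Longrightarrow> \<bar>y s\<bar> \<le> B"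
  shows "conv_integrable k y t"
proof -
  have i: "integrable lborel (\<lambda>s. indicator {0<..<t} s * k (t - s))"
    using k by (simp add: conv_integrable_def)
  then have [measurable]: "(\<lambda>s. indicator {0<..<t} s * k (t - s)) \<in> borel_measurable borel" by auto
  have eq: "indicator {0<..<t} s * (k (t - s) * y s) = (indicator {0<..<t} s * k (t - s)) * y s" for s by simp
  show ?thesis
    unfolding conv_integrable_def eq
  proof (rule Bochner_Integration.integrable_bound)
    show "integrable lborel (\<lambda>s. B * (indicator {0<..<t} s * k (t - s)))" by (intro integrable_mult_right i)
    show "AE s in lborel. norm (indicator {0<..<t} s * k (t - s) * y s) \<le> norm (B * (indicator {0<..<t} s * k (t - s)))"
    proof (intro AE_I2)
      fix s
      show "norm (indicator {0<..<t} s * k (t - s) * y s) \<le> norm (B * (indicator {0<..<t} s * k (t - s)))"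
      proof (cases "s \<in> {0<..<t}")
        case True
        then have "\<bar>k (t - s)\<bar> * \<bar>y s\<bar> \<le> \<bar>k (t - s)\<bar> * \<bar>B\<bar>"
          using B[of s] by (intro mult_left_mono) auto
        with True show ?thesis by (simp add: abs_mult mult.commute)
      qed simp
    qed
  qed measurable
qed

lemma conv_1: "conv_integrable (\<lambda>_. 1) y t \<Longrightarrow> conv (\<lambda>_. 1) y t = integral {0..t} y"
  using set_borel_integral_eq_integral(2)[of "{0<..<t}" y]
  by (simp add: conv_def conv_integrable_def set_lebesgue_integral_def set_integrable_def integral_open_interval_real)

lemma conv_pker_1: "conv (pker 1) y t = conv (\<lambda>_. 1) y t"
    "conv_integrable (pker 1) y t = conv_integrable (\<lambda>_. 1) y t"
  unfolding conv_def conv_integrable_def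
  by (intro Bochner_Integration.integral_cong Bochner_Integration.integrable_cong; auto simp: indicator_def pker_1)+

lemma conv_add:
  assumes "conv_integrable f g t" "conv_integrable f h t"
  shows "conv f (\<lambda>s. c * g s + d * h s) t = c * conv f g t + d * conv f h t"
proof -
  have "conv f (\<lambda>s. c * g s + d * h s) t = (\<integral>s. c * (indicator {0<..<t} s * (f (t - s) * g s)) + d * (indicator
      {0<..<t} s * (f (t - s) * h s)) \<partial>lborel)"
    unfolding conv_def by (intro Bochner_Integration.integral_cong) (auto simp: algebra_simps)
  also have "\<dots> = c * conv f g t + d * conv f h t"
    using assms by (subst Bochner_Integration.integral_add) (auto simp: conv_def conv_integrable_def)
  finally show ?thesis .
qed

text \<open>With \<open>J\<^bsup>b\<^esup>\<close> the convolution with \<open>pker b\<close>: \<open>J\<^bsup>1\<^esup>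
    J\<^bsup>1-a\<^esup> u' = J\<^bsup>1-a\<^esup> J\<^bsup>1\<^esup> u' = J\<^bsup>1-a\<^esup> u\<close>.\<close>

lemma integral_caputo:
  assumes a: "0 < a" "a < 1" and t: "0 < t"
    and u: "continuous_on {0..t} u" "u 0 = 0"
    and ex: "caputo_exists a u t"
  shows "conv (\<lambda>_. 1) (caputo a u) t = conv (pker (1 - a)) u t"
    "conv_integrable (\<lambda>_. 1) (caputo a u) t"
proof -
  let ?k = "pker (1 - a)"
  have dif: "\<And>s. 0 < s \<Longrightarrow> s < t \<Longrightarrow> u differentiable (at s)" and int: "conv_integrable ?k (deriv u) t"
    using ex caputo_exists_iff[OF a] by auto
  have kpos: "0 < ?k r" if "0 < r" for r using that a by (simp add: pker_def Gamma_real_pos)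
  define y where "y s = indicator {0<..<t} s * deriv u s" for s
  \<comment> \<open>Measurability of \<open>deriv u\<close> is not given. It is recovered by
    dividing the integrable Caputo integrand by its positive kernel.\<close>
  have yk: "y s = (indicator {0<..<t} s * (?k (t - s) * deriv u s)) / ?k (t - s)" for s
    using kpos[of "t - s"] by (cases "s \<in> {0<..<t}") (auto simp: y_def)
  have [measurable]: "(\<lambda>s. indicator {0<..<t} s * (?k (t - s) * deriv u s)) \<in> borel_measurable borel"
    using int unfolding conv_integrable_def by auto
  have [measurable]: "y \<in> borel_measurable borel"
    unfolding yk[abs_def] by measurable
  \<comment> \<open>The kernel is smallest at t, so integrability of the Caputo integrand forces
    integrability of the derivative itself on (0,t).\<close>
  have k_ge: "?k t \<le> ?k r" if "0 < r" "r \<le> t" for r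
    using that a by (auto simp: pker_def Gamma_real_pos less_imp_le intro!: divide_right_mono powr_mono2')
  have yint: "integrable lborel y"
  proof (rule Bochner_Integration.integrable_bound)
    show "integrable lborel (\<lambda>s. (indicator {0<..<t} s * (?k (t - s) * deriv u s)) / ?k t)"
      using int unfolding conv_integrable_def by (rule integrable_divide)
    have "norm (y s) \<le> norm ((indicator {0<..<t} s * (?k (t - s) * deriv u s)) / ?k t)" for s
    proof (cases "s \<in> {0<..<t}")
      case True
      then have "\<bar>deriv u s\<bar> * 1 \<le> \<bar>deriv u s\<bar> * (?k (t - s) / ?k t)"
        using k_ge[of "t - s"] kpos[OF t] by (intro mult_left_mono) auto
      then show ?thesis using True kpos[OF t] kpos[of "t - s"] by (simp add: y_def abs_mult mult_ac)
    qed (simp add: y_def)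
    then show "AE s in lborel. norm (y s) \<le> norm ((indicator {0<..<t} s * (?k (t - s) * deriv u s)) / ?k t)" by simp
  qed simp
  have k1: "conv_integrable (pker 1) ?k s" "conv (pker 1) ?k s = pker (2 - a) s"
      "conv_integrable ?k (pker 1) s" "conv ?k (pker 1) s = pker (2 - a) s" if "0 < s" for s
    using conv_pker[of 1 "1 - a" s] conv_pker[of "1 - a" 1 s] a that by auto
  \<comment> \<open>The composed kernel \<open>pker (2 - a)\<close> has the positive exponent 1 - a,
    hence is bounded on (0,t), and integrability of y suffices.\<close>
  have k2: "conv_integrable (pker (2 - a)) (\<lambda>s. \<bar>y s\<bar>) t"
    unfolding conv_integrable_def
  proof (rule Bochner_Integration.integrable_bound)
    show "integrable lborel (\<lambda>s. pker (2 - a) t * y s)" using yint by simp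
    show "AE s in lborel. norm (indicator {0<..<t} s * (pker (2 - a) (t - s) * \<bar>y s\<bar>)) \<le> norm (pker (2 - a) t * y s)"
    proof (intro AE_I2)
      fix s
      show "norm (indicator {0<..<t} s * (pker (2 - a) (t - s) * \<bar>y s\<bar>)) \<le> norm (pker (2 - a) t * y s)"
      proof (cases "s \<in> {0<..<t}")
        case True
        then have "pker (2 - a) (t - s) \<le> pker (2 - a) t"
          using a by (auto simp: pker_def Gamma_real_pos less_imp_le intro!: divide_right_mono powr_mono2)
        then show ?thesis using True pker_nonneg[of "2 - a"] a by (simp add: abs_mult mult_right_mono)
      qed simp
    qed
  qed measurable
  have ky: "conv ?k y s = caputo a u s" if "0 < s" "s \<le> t" for s
    unfolding caputo_eq_conv[OF a] using that by (intro conv_cong) (auto simp: y_def)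
  have k3: "conv_integrable (conv (pker 1) ?k) (\<lambda>s. \<bar>y s\<bar>) t"
      "conv_integrable (conv ?k (pker 1)) (\<lambda>s. \<bar>y s\<bar>) t"
    using k2 conv_cong(2)[of t "conv (pker 1) ?k" "pker (2 - a)" "\<lambda>s. \<bar>y s\<bar>"] 
    by (auto simp: conv_integrable_def k1 indicator_def intro!: Bochner_Integration.integrable_cong[THEN iffD1, OF _ _
        k2[unfolded conv_integrable_def]])
  have A: "conv (pker 1) (conv ?k y) t = conv (conv (pker 1) ?k) y t"
      "conv_integrable (pker 1) (conv ?k y) t"
    by (rule conv_assoc; use a k1 k3 in \<open>auto intro!: pker_nonneg\<close>)+
  have B: "conv ?k (conv (pker 1) y) t = conv (conv ?k (pker 1)) y t"
    by (rule conv_assoc; use a k1 k3 in \<open>auto intro!: pker_nonneg\<close>)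
  have C: "conv (pker 1) y s = u s" if s: "0 < s" "s < t" for s
  proof -
    have "integrable lborel (\<lambda>r. indicator {0<..<s} r *\<^sub>R y r)"
      by (rule integrable_mult_indicator[OF _ yint]) simp
    then have "conv_integrable (\<lambda>_. 1) y s" by (simp add: conv_integrable_def)
    then have "conv (pker 1) y s = integral {0..s} y"
      unfolding conv_pker_1 by (rule conv_1)
    also have "(y has_integral u s - u 0) {0..s}"
    proof (rule fundamental_theorem_of_calculus_interior)
      show "(u has_vector_derivative y r) (at r)" if "r \<in> {0<..<s}" for r
        using dif[of r] that s
        by (simp add: y_def DERIV_deriv_iff_real_differentiable flip: has_real_derivative_iff_has_vector_derivative)
    qed (use s u in \<open>auto intro: continuous_on_subset\<close>)
    then have "integral {0..s} y = u s" using u by (simp add: has_integral_iff)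
    finally show ?thesis .
  qed
  have "conv (pker 1) (caputo a u) t = conv (pker 1) (conv ?k y) t"
    by (intro conv_cong) (auto simp: ky)
  also have "\<dots> = conv (conv ?k (pker 1)) y t"
    unfolding A by (rule conv_cong(1)) (auto simp: k1)
  also have "\<dots> = conv ?k u t"
    unfolding B[symmetric] by (intro conv_cong) (auto simp: C)
  finally show "conv (\<lambda>_. 1) (caputo a u) t = conv ?k u t" by (simp add: conv_pker_1)
  have "conv_integrable (pker 1) (caputo a u) t = conv_integrable (pker 1) (conv ?k y) t"
    by (intro conv_cong) (auto simp: ky)
  with A(2) show "conv_integrable (\<lambda>_. 1) (caputo a u) t" by (simp add: conv_pker_1)
qed

section \<open>The scalar relaxation equation\<close>

lemma continuous_on_integral_0_imp_eq_0:
  fixes \<phi> :: "real \<Rightarrow> real"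
  assumes c: "continuous_on {0..T} \<phi>" and T: "0 < T" and 0: "\<And>t. 0 < t \<Longrightarrow> t < T \<Longrightarrow> integral {0..t} \<phi> = 0"
    and t: "t \<in> {0..T}"
  shows "\<phi> t = 0"
proof -
  have "\<phi> t = 0" if t: "t \<in> {0<..<T}" for t
  proof -
    have "((\<lambda>t. integral {0..t} \<phi>) has_real_derivative \<phi> t) (at t within {0..T})"
      using t by (intro integral_has_real_derivative c) auto
    then have "((\<lambda>t. integral {0..t} \<phi>) has_real_derivative \<phi> t) (at t)"
      using t at_within_Icc_at[of 0 t T] by simp
    then have "((\<lambda>t. 0) has_real_derivative \<phi> t) (at t)"
      by (rule has_field_derivative_transform_within_open[where S = "{0<..<T}"]) (use 0 t in auto)
    then show ?thesis by (rule DERIV_unique) simp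
  qed
  then have "\<phi> ` {0<..<T} \<subseteq> {0}" by auto
  moreover have "closure {0<..<T} = {0..T}" using T by simp
  ultimately have "\<phi> ` {0..T} \<subseteq> {0}"
    using image_closure_subset[of "{0<..<T}" \<phi> "{0}"] c by simp
  with imageI[OF t, of \<phi>] show ?thesis by auto
qed

text \<open>Convolving \<open>J\<^bsup>1-a\<^esup> y + l J\<^bsup>1\<^esup> y = H t\<close> with the resolvent \<open>mlk a l a\<close> gives
  \<open>J\<^bsup>1\<^esup> y = H J\<^bsup>1\<^esup> (mlk a l (a + 1))\<close>, and \<open>mlk a l (a + 1)\<close> does not
      vanish at \<open>T\<close>.\<close>

lemma fractional_relaxation_unique:
  fixes y :: "real \<Rightarrow> real"
  assumes a: "0 < a" "a < 1" and l: "0 \<le> l" and T: "0 < T"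
    and y: "continuous_on UNIV y" and B: "\<And>t. \<bar>y t\<bar> \<le> B" and yT: "y T = 0"
    and eq: "\<And>t. 0 < t \<Longrightarrow> t < T \<Longrightarrow> conv (pker (1 - a)) y t + l * integral {0..t} y = t * H"
    and t: "t \<in> {0..T}"
  shows "y t = 0"
proof -
  let ?e = "mlk a l a"
  have [measurable]: "y \<in> borel_measurable borel" by (rule borel_measurable_continuous_onI[OF y])
  have [measurable]: "mlk a l b \<in> borel_measurable borel" if "0 < b" for b using a(1) that by (rule mlk_measurable)
  have e_nonneg: "0 \<le> ?e s" if "0 < s" for s
    using a l that by (auto simp: mlk_def intro!: mult_nonneg_nonneg mlf_nonneg_diag)
  have ki: "conv_integrable (mlk a l b) (pker c) s" "conv (mlk a l b) (pker c) s = mlk a l (b + c) s"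
    if "0 < s" "0 < b" "0 < c" for b c s
    using conv_mlk[OF a(1) that(2,3,1), of l] conv_commute conv_integrable_commute by auto
  have bd: "conv_integrable (mlk a l b) f s" if "f \<in> borel_measurable borel" "\<And>t. \<bar>f t\<bar> \<le> B" "0 < s" "0 < b" for f b s
    using ki(1)[of s b 1] that conv_integrable_bounded[of "mlk a l b" s f B]
    by (auto simp: conv_integrable_commute[of "mlk a l b"] conv_pker_1)
  have assoc: "conv ?e (conv (pker c) y) t = conv (mlk a l (a + c)) y t"
     "conv_integrable ?e (conv (pker c) y) t" if t: "0 < t" and c: "0 < c" for c t
  proof -
    have "conv_integrable (mlk a l (a + c)) (\<lambda>s. \<bar>y s\<bar>) t"
      using t c a B by (intro bd) auto
    then have *: "conv_integrable (conv ?e (pker c)) (\<lambda>s. \<bar>y s\<bar>) t"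
      unfolding conv_integrable_def
      by (rule Bochner_Integration.integrable_cong[THEN iffD1, rotated -1])
         (auto simp: indicator_def ki a c)
    have "conv ?e (conv (pker c) y) t = conv (conv ?e (pker c)) y t"
       "conv_integrable ?e (conv (pker c) y) t"
      by (rule conv_assoc; use a c e_nonneg ki * in \<open>auto intro!: pker_nonneg\<close>)+
    moreover have "conv (conv ?e (pker c)) y t = conv (mlk a l (a + c)) y t"
      by (rule conv_cong(1)) (auto simp: ki a c)
    ultimately show "conv ?e (conv (pker c) y) t = conv (mlk a l (a + c)) y t"
       "conv_integrable ?e (conv (pker c) y) t" by simp_all
  qed
  have 1: "conv_integrable (\<lambda>_. 1) y s" if "0 < s" for s
    using that conv_integrable_bounded[of "\<lambda>_. 1" s y B] B conv_pker(1)[of 1 1 s] 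
    by (auto simp: conv_pker_1 conv_integrable_commute[of "\<lambda>_. 1" "pker 1"])
  \<comment> \<open>On the left the resolvent produces
    \<open>mlk a l 1 + l * mlk a l (a + 1)\<close>, which is the constant 1 by
    \<open>mlk_rec\<close>, so only the integral of y remains. On the right t is
    \<open>pker 2 t\<close>, which the resolvent maps to \<open>mlk a l (a + 2)\<close>.\<close>
  have main: "integral {0..t} y = H * mlk a l (a + 2) t" if t: "0 < t" "t < T" for t
  proof -
    have "conv ?e (\<lambda>s. 1 * conv (pker (1 - a)) y s + l * conv (pker 1) y s) t =
        conv ?e (\<lambda>s. H * pker 2 s) t"
      using t eq conv_1[OF 1] by (intro conv_cong) (auto simp: conv_pker_1 pker_def Gamma_numeral mult.commute)
    also have "conv ?e (\<lambda>s. H * pker 2 s) t = H * mlk a l (a + 2) t"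
      using conv_add[of ?e "pker 2" t "pker 2" H 0] ki[of t a 2] t a by simp
    also have "conv ?e (\<lambda>s. 1 * conv (pker (1 - a)) y s + l * conv (pker 1) y s) t =
        1 * conv ?e (conv (pker (1 - a)) y) t + l * conv ?e (conv (pker 1) y) t"
      using t a by (intro conv_add assoc) auto
    also have "\<dots> = 1 * conv (mlk a l 1) y t + l * conv (mlk a l (a + 1)) y t"
      using assoc(1)[of t "1 - a"] assoc(1)[of t 1] a t by simp
    also have "\<dots> = conv y (\<lambda>s. 1 * mlk a l 1 s + l * mlk a l (a + 1) s) t"
      unfolding conv_commute[of _ y] using bd[of y t 1] bd[of y t "a + 1"] a t B
      by (intro conv_add[symmetric]) (auto simp: conv_integrable_commute[of y])
    also have "\<dots> = conv y (\<lambda>_. 1) t"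
      using mlk_rec[OF a(1) zero_less_one, of _ l] by (intro conv_cong) (auto simp: pker_1)
    also have "\<dots> = integral {0..t} y"
      using conv_1[OF 1] t by (simp add: conv_commute[of y])
    finally show ?thesis by simp
  qed
  have c1: "continuous_on {0..T} (mlk a l (a + 1))"
    unfolding mlk_def using a
    by (intro continuous_on_mult continuous_on_mlf continuous_on_powr' continuous_on_id continuous_on_const) auto
  have "y t - H * mlk a l (a + 1) t = 0" if "t \<in> {0..T}" for t
  proof (rule continuous_on_integral_0_imp_eq_0[OF _ T _ that])
    show "continuous_on {0..T} (\<lambda>t. y t - H * mlk a l (a + 1) t)"
      by (intro continuous_intros continuous_on_subset[OF y] c1) auto
    fix t assume t: "0 < t" "t < T"
    have "mlk a l (a + 2) t = conv (pker 1) (mlk a l (a + 1)) t"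
      using conv_mlk(2)[of a "a + 1" 1 t l] a t by (simp add: add.commute add.left_commute)
    also have "\<dots> = integral {0..t} (mlk a l (a + 1))"
      using conv_mlk(1)[of a "a + 1" 1 t l] a t by (simp add: conv_pker_1 conv_1)
    finally have "integral {0..t} y = H * integral {0..t} (mlk a l (a + 1))" using main[OF t] by simp
    then show "integral {0..t} (\<lambda>t. y t - H * mlk a l (a + 1) t) = 0"
      using t by (subst integral_diff)
        (auto intro!: integrable_continuous_real continuous_intros continuous_on_subset[OF y] continuous_on_subset[OF c1])
  qed
  moreover from this[of T] yT T have "H * mlk a l (a + 1) T = 0" by simp
  moreover have "mlk a l (a + 1) T > 0"
    using mlf_pos[of a "l * T powr a"] a l T by (simp add: mlk_def)
  ultimately show ?thesis using t by auto
qed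

lemma continuous_on_sections:
  assumes "continuous_on (S \<times> X) (\<lambda>(t, x). f t x)"
  shows "t \<in> S \<Longrightarrow> X' \<subseteq> X \<Longrightarrow> continuous_on X' (f t)" "x \<in> X \<Longrightarrow> S'
      \<subseteq> S \<Longrightarrow> continuous_on S' (\<lambda>t. f t x)"
proof -
  show "continuous_on X' (f t)" if "t \<in> S" "X' \<subseteq> X"
  proof -
    have "continuous_on X' (\<lambda>x. (\<lambda>(t, x). f t x) (t, x))"
      by (rule continuous_on_compose2[OF assms]) (use that in \<open>auto intro!: continuous_intros\<close>)
    then show ?thesis by simp
  qed
  show "continuous_on S' (\<lambda>t. f t x)" if "x \<in> X" "S' \<subseteq> S"
  proof -
    have "continuous_on S' (\<lambda>t. (\<lambda>(t, x). f t x) (t, x))"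
      by (rule continuous_on_compose2[OF assms]) (use that in \<open>auto intro!: continuous_intros\<close>)
    then show ?thesis by simp
  qed
qed

text \<open>Fubini with the majorant M k(t - s) on (0,t) x [-1,1]: the fractional integral in time
  commutes with taking Legendre coefficients in x.\<close>

lemma conv_integral_swap:
  fixes v :: "real \<Rightarrow> real \<Rightarrow> real"
  assumes v: "continuous_on UNIV (\<lambda>(s, x). v s x)" and M: "\<And>s x. x \<in> {-1..1} \<Longrightarrow> \<bar>v s x\<bar> \<le> M"
    and k: "conv_integrable k (\<lambda>_. 1) t" "k \<in> borel_measurable borel" "\<And>s. 0 < s \<Longrightarrow> s < t
        \<Longrightarrow> 0 \<le> k s"
  shows "(\<lambda>x. conv k (\<lambda>s. v s x) t) integrable_on {-1..1}"
    "integral {-1..1} (\<lambda>x. conv k (\<lambda>s. v s x) t) = conv k (\<lambda>s. integral {-1..1} (v s)) t"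
proof -
  note [measurable] = k(2)
  have [measurable]: "(\<lambda>(s, x). v s x) \<in> borel_measurable (lborel \<Otimes>\<^sub>M lborel)"
    using borel_measurable_continuous_onI[OF v] by (simp add: borel_prod lborel_prod)
  have cv: "continuous_on A (v s)" for A s
    using v by (intro continuous_on_sections(1)[of UNIV UNIV v]) auto
  define F where "F s x = indicator {0<..<t} s * k (t - s) * (indicator {-1..1} x *\<^sub>R v s x)" for s x
  have [measurable]: "(\<lambda>(s, x). F s x) \<in> borel_measurable (lborel \<Otimes>\<^sub>M lborel)"
    unfolding F_def by measurable
  have ik: "integrable lborel (\<lambda>s. indicator {0<..<t} s * k (t - s))"
    using k(1) by (simp add: conv_integrable_def)
  have iv: "integrable lborel (\<lambda>x. indicator {-1..1} x *\<^sub>R v s x)" for s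
    by (intro borel_integrable_compact compact_Icc cv)
  have Fint: "integrable lborel (F s)" for s
    unfolding F_def[abs_def] by (intro integrable_mult_right iv)
  have "integrable (lborel \<Otimes>\<^sub>M lborel) (\<lambda>(s, x). F s x)"
  proof (rule lborel_pair.Fubini_integrable)
    show "integrable lborel (\<lambda>s. \<integral>x. norm (case (s, x) of (s, x) \<Rightarrow> F s x) \<partial>lborel)"
    proof (rule Bochner_Integration.integrable_bound)
      show "integrable lborel (\<lambda>s. (2 * M) * (indicator {0<..<t} s * k (t - s)))" by (intro integrable_mult_right ik)
      have "norm (\<integral>x. norm (F s x) \<partial>lborel) \<le> norm ((2 * M) * (indicator {0<..<t} s * k (t - s)))" for s
      proof -
        have "(\<integral>x. norm (F s x) \<partial>lborel) \<le> (\<integral>x. \<bar>indicator {0<..<t} s * k (t - s)\<bar> * M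
            * indicator {-1..1::real} x \<partial>lborel)"
        proof (rule Bochner_Integration.integral_mono)
          show "integrable lborel (\<lambda>x. norm (F s x))" by (intro integrable_norm Fint)
          show "norm (F s x) \<le> \<bar>indicator {0<..<t} s * k (t - s)\<bar> * M * indicator {-1..1} x" for x
          proof (cases "x \<in> {-1..1}")
            case True
            then show ?thesis using M[OF True, of s] by (simp add: F_def abs_mult mult_left_mono)
          qed (simp add: F_def)
        qed simp
        also have "\<dots> = \<bar>indicator {0<..<t} s * k (t - s)\<bar> * (2 * M)" by simp
        also have "\<dots> \<le> norm ((2 * M) * (indicator {0<..<t} s * k (t - s)))"
          using M[of 0 s] by (simp add: abs_mult mult.commute mult_left_mono)
        finally show ?thesis by (subst real_norm_def, subst abs_of_nonneg) simp_all
      qed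
      then show "AE s in lborel. norm (\<integral>x. norm (case (s, x) of (s, x) \<Rightarrow> F s x) \<partial>lborel) \<le>
          norm ((2 * M) * (indicator {0<..<t} s * k (t - s)))"
        by simp
    qed measurable
    show "AE s in lborel. integrable lborel (\<lambda>x. case (s, x) of (s, x) \<Rightarrow> F s x)" using Fint by simp
  qed simp
  from lborel_pair.Fubini_integral[OF this] lborel_pair.integrable_snd[OF this]
  have eq: "(\<integral>x. (\<integral>s. F s x \<partial>lborel) \<partial>lborel) = (\<integral>s. (\<integral>x. F s x
      \<partial>lborel) \<partial>lborel)"
    and int: "integrable lborel (\<lambda>x. \<integral>s. F s x \<partial>lborel)" by simp_all
  have Fx: "(\<integral>s. F s x \<partial>lborel) = indicator {-1..1} x *\<^sub>R conv k (\<lambda>s. v s x) t" for x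
    by (cases "x \<in> {-1..1}") (simp_all add: F_def conv_def mult.assoc)
  have Fs: "(\<integral>x. F s x \<partial>lborel) = indicator {0<..<t} s * (k (t - s) * integral {-1..1} (v s))" for s
    using set_borel_integral_eq_integral(2)[of "{-1..1}" "v s"] iv[of s]
    by (simp add: F_def set_integrable_def set_lebesgue_integral_def mult.assoc)
  have si: "set_integrable lborel {-1..1} (\<lambda>x. conv k (\<lambda>s. v s x) t)"
    using int unfolding Fx set_integrable_def .
  from set_borel_integral_eq_integral[OF this]
  show "(\<lambda>x. conv k (\<lambda>s. v s x) t) integrable_on {-1..1}"
    "integral {-1..1} (\<lambda>x. conv k (\<lambda>s. v s x) t) = conv k (\<lambda>s. integral {-1..1} (v s)) t"
    using eq by (simp_all add: Fx Fs conv_def[of k "\<lambda>s. integral {-1..1} (v s)"] set_lebesgue_integral_def)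
qed

lemma abs_conv_le:
  assumes k: "conv_integrable k (\<lambda>_. 1) t" "\<And>s. 0 < s \<Longrightarrow> s < t \<Longrightarrow> 0 \<le> k s"
    and y: "y \<in> borel_measurable borel" "\<And>s. \<bar>y s\<bar> \<le> B"
  shows "\<bar>conv k y t\<bar> \<le> B * conv k (\<lambda>_. 1) t"
proof -
  have "\<bar>conv k y t\<bar> \<le> (\<integral>s. norm (indicator {0<..<t} s * (k (t - s) * y s)) \<partial>lborel)"
    unfolding conv_def using integral_norm_bound[of lborel "\<lambda>s. indicator {0<..<t} s * (k (t - s) * y s)"] by simp
  also have "\<dots> \<le> (\<integral>s. B * (indicator {0<..<t} s * (k (t - s) * 1)) \<partial>lborel)"
  proof (rule Bochner_Integration.integral_mono)
    show "integrable lborel (\<lambda>s. norm (indicator {0<..<t} s * (k (t - s) * y s)))"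
      using conv_integrable_bounded[OF k(1) y] unfolding conv_integrable_def by (rule integrable_norm)
    show "integrable lborel (\<lambda>s. B * (indicator {0<..<t} s * (k (t - s) * 1)))"
      using k(1) unfolding conv_integrable_def by (rule integrable_mult_right)
    show "norm (indicator {0<..<t} s * (k (t - s) * y s)) \<le> B * (indicator {0<..<t} s * (k (t - s) * 1))" for s
    proof (cases "s \<in> {0<..<t}")
      case True
      have "k (t - s) * \<bar>y s\<bar> \<le> k (t - s) * B" using True y k(2)[of "t - s"] by (intro mult_left_mono) auto
      with True k(2)[of "t - s"] show ?thesis by (simp add: abs_mult mult.commute)
    qed simp
  qed
  also have "\<dots> = B * conv k (\<lambda>_. 1) t" by (simp add: conv_def)
  finally show ?thesis .
qed

text \<open>The indefinite integral is continuous, whatever the values of the integrand near the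
  ends.\<close>

lemma tendsto_integral_symmetric:
  fixes \<phi> :: "real \<Rightarrow> real"
  assumes "\<phi> integrable_on {-1..1}"
  shows "((\<lambda>b. integral {-b..b} \<phi>) \<longlongrightarrow> integral {-1..1} \<phi>) (at_left 1)"
proof -
  define I where "I x = integral {-1..x} \<phi>" for x
  have "continuous_on {-1..1} I"
    unfolding I_def[abs_def] by (rule indefinite_integral_continuous_1[OF assms])
  then have "continuous_on {0..1} I" "continuous_on {0..1} (\<lambda>b. I (- b))"
    by (rule continuous_on_subset continuous_on_compose2; auto intro!: continuous_on_minus continuous_on_id)+
  then have "continuous_on {0..1} (\<lambda>b. I b - I (- b))" by (rule continuous_on_diff)
  then have "((\<lambda>b. I b - I (- b)) \<longlongrightarrow> I 1 - I (- 1)) (at 1 within {0..1})"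
    unfolding continuous_on_def by (rule bspec) simp
  then have "((\<lambda>b. I b - I (- b)) \<longlongrightarrow> I 1 - I (- 1)) (at_left 1)"
    by (simp add: at_within_Icc_at_left)
  moreover have "\<forall>\<^sub>F b in at_left (1::real). I b - I (- b) = integral {-b..b} \<phi>"
    using eventually_at_left_real[of 0 1]
  proof (rule eventually_mono)
    show "I b - I (- b) = integral {-b..b} \<phi>" if "b \<in> {0<..<1}" for b
    proof -
      have "integral {-1..-b} \<phi> + integral {-b..b} \<phi> = integral {-1..b} \<phi>"
        using that by (intro Henstock_Kurzweil_Integration.integral_combine integrable_on_subinterval[OF assms]) auto
      then show ?thesis by (simp add: I_def)
    qed
  qed simp
  ultimately show ?thesis by (simp add: I_def tendsto_cong)
qed

section \<open>The homogeneous problem satisfied by the difference of two solutions\<close>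

locale homogeneous_problem =
  fixes a T :: real and u :: "real \<Rightarrow> real \<Rightarrow> real" and h :: "real \<Rightarrow> real"
  assumes a: "0 < a" "a < 1" and T: "0 < T"
    and sol: "inverse_source_solution a T (\<lambda>_. 0) (\<lambda>_. 0) u h"
begin

lemma cu: "continuous_on ({0..T} \<times> {-1..1}) (\<lambda>(t, x). u t x)"
  and cL: "continuous_on ({0<..<T} \<times> {-1<..<1}) (\<lambda>(t, x). legendre_op (u t) x)"
  and ch: "continuous_on {-1<..<1} h"
  using sol by (auto simp: inverse_source_solution_def)

lemma pde:
  assumes "t \<in> {0<..<T}" "x \<in> {-1<..<1}"
  shows "caputo_exists a (\<lambda>s. u s x) t" "u t differentiable (at x)"
    "(\<lambda>y. (1 - y\<^sup>2) * deriv (u t) y) differentiable (at x)"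
    "caputo a (\<lambda>s. u s x) t = legendre_op (u t) x + h x"
  using sol assms by (auto simp: inverse_source_solution_def)

lemma u0: "x \<in> {-1..1} \<Longrightarrow> u 0 x = 0" and uT: "x \<in> {-1..1} \<Longrightarrow> u T x = 0"
  using sol by (auto simp: inverse_source_solution_def)

text \<open>Clamping both variables extends \<open>u\<close> to a bounded continuous function on the
  plane, as the Fubini and convolution lemmas ask for global continuity and bounds.\<close>

definition uc :: "real \<Rightarrow> real \<Rightarrow> real" where
  "uc t x = u (max 0 (min T t)) (max (- 1) (min 1 x))"

lemma uc_eq: "t \<in> {0..T} \<Longrightarrow> x \<in> {-1..1} \<Longrightarrow> uc t x = u t x"
  by (simp add: uc_def)

lemma cuc: "continuous_on UNIV (\<lambda>(t, x). uc t x)"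
proof -
  have "continuous_on UNIV (\<lambda>p. (\<lambda>(t, x). u t x) (max 0 (min T (fst p)), max (- 1) (min 1 (snd p))))"
    by (rule continuous_on_compose2[OF cu]) (use T in \<open>auto intro!: continuous_intros\<close>)
  then show ?thesis by (simp add: uc_def case_prod_unfold)
qed

lemma uc_bounded: "\<exists>M. \<forall>t x. \<bar>uc t x\<bar> \<le> M"
proof -
  have "compact ((\<lambda>(t, x). u t x) ` ({0..T} \<times> {-1..1}))"
    by (intro compact_continuous_image cu compact_Times compact_Icc)
  then have "bounded ((\<lambda>(t, x). u t x) ` ({0..T} \<times> {-1..1}))" by (rule compact_imp_bounded)
  then obtain M where M: "\<And>z. z \<in> (\<lambda>(t, x). u t x) ` ({0..T} \<times> {-1..1}) \<Longrightarrow> norm z \<le> M"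
    unfolding bounded_iff by blast
  have "\<bar>uc t x\<bar> \<le> M" for t x
    using M[of "uc t x"] T by (force simp: uc_def)
  then show ?thesis by blast
qed

text \<open>The Legendre coefficient of \<open>u\<close>, without the factor (2n + 1)/2 and defined
  for all real times.\<close>

definition y :: "nat \<Rightarrow> real \<Rightarrow> real" where
  "y n t = integral {-1..1} (\<lambda>x. uc t x * legendre_P n x)"

lemma cucP: "continuous_on A (\<lambda>(t, x). uc t x * legendre_P n x)"
proof -
  have "continuous_on A (\<lambda>p. (\<lambda>(t, x). uc t x) p * legendre_P n (snd p))"
    by (intro continuous_on_mult continuous_on_subset[OF cuc] continuous_on_compose2[OF continuous_on_legendre_P[of UNIV]] continuous_intros) auto
  then show ?thesis by (simp add: case_prod_unfold)
qed

lemma cy: "continuous_on UNIV (y n)"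
  unfolding y_def[abs_def] using integral_continuous_on_param[of UNIV "-1" "1::real", OF cucP] by simp

lemma bounded_y: "\<exists>B. \<forall>t. \<bar>y n t\<bar> \<le> B"
proof -
  obtain M where M: "\<And>t x. \<bar>uc t x\<bar> \<le> M" using uc_bounded by blast
  have "norm (y n t) \<le> M * (1 - (- 1))" for t
    unfolding y_def
  proof (rule integral_bound)
    show "continuous_on {-1..1} (\<lambda>x. uc t x * legendre_P n x)"
      using cucP[of "UNIV \<times> UNIV" n] by (rule continuous_on_sections) auto
    show "norm (uc t x * legendre_P n x) \<le> M" if "x \<in> {-1..1}" for x
    proof -
      from that
      have "\<bar>uc t x\<bar> * \<bar>legendre_P n x\<bar> \<le> M * 1"
        using M[of t x] by (intro mult_mono abs_legendre_P_le) auto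
      then show ?thesis by (simp add: abs_mult)
    qed
  qed simp
  then show ?thesis by auto
qed

lemma yT: "y n T = 0"
proof -
  have "y n T = integral {-1..1} (\<lambda>x::real. 0)"
    unfolding y_def using T by (intro Henstock_Kurzweil_Integration.integral_cong) (simp add: uc_eq uT)
  then show ?thesis by simp
qed

text \<open>The fractional integral J^{1-a} of \<open>u\<close> in time, whose time derivative is
  formally the Caputo derivative.\<close>

definition A :: "real \<Rightarrow> real \<Rightarrow> real" where
  "A t x = conv (pker (1 - a)) (\<lambda>s. uc s x) t"

text \<open>By \<open>pde\<close> this is the Caputo derivative inside the rectangle, written in the
  form whose joint continuity is visible.\<close>

definition g :: "real \<Rightarrow> real \<Rightarrow> real" where
  "g t x = legendre_op (u t) x + h x"

lemma cg: "continuous_on ({0<..<T} \<times> {-1<..<1}) (\<lambda>(t, x). g t x)"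
proof -
  have "continuous_on ({0<..<T} \<times> {-1<..<1}) (\<lambda>p. (\<lambda>(t, x). legendre_op (u t) x) p + h (snd p))"
    by (intro continuous_on_add cL continuous_on_compose2[OF ch] continuous_intros) auto
  then show ?thesis by (simp add: g_def case_prod_unfold)
qed

text \<open>Subtract \<open>integral_caputo\<close> at the two times. On [t1,t2], which stays away
  from 0 and T, the equation replaces the Caputo derivative by \<open>g\<close>.\<close>

lemma A_diff:
  assumes t: "0 < t1" "t1 < t2" "t2 < T" and x: "x \<in> {-1<..<1}"
  shows "A t2 x - A t1 x = integral {t1..t2} (\<lambda>s. g s x)"
proof -
  let ?c = "caputo a (\<lambda>s. u s x)"
  have cont: "continuous_on {0..t} (\<lambda>s. u s x)" if "t < T" for t
    using cu by (rule continuous_on_sections) (use that x in auto)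
  have AI: "A t x = integral {0..t} ?c" "?c integrable_on {0..t}" if t: "0 < t" "t < T" for t
  proof -
    note I = integral_caputo[OF a t(1) cont[OF t(2)] _ pde(1)]
    have "conv (\<lambda>_. 1) ?c t = conv (pker (1 - a)) (\<lambda>s. u s x) t"
      and int: "conv_integrable (\<lambda>_. 1) ?c t"
      using I t x u0[of x] by auto
    moreover have "conv (pker (1 - a)) (\<lambda>s. u s x) t = A t x"
      unfolding A_def using t x by (intro conv_cong) (auto simp: uc_eq)
    ultimately show "A t x = integral {0..t} ?c" by (simp add: conv_1)
    have "?c integrable_on {0<..<t}"
      using int by (intro set_borel_integral_eq_integral) (simp add: conv_integrable_def set_integrable_def)
    then show "?c integrable_on {0..t}" by (simp add: integrable_on_open_interval_real)
  qed
  have "integral {0..t1} ?c + integral {t1..t2} ?c = integral {0..t2} ?c"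
    using t by (intro Henstock_Kurzweil_Integration.integral_combine AI) auto
  moreover have "integral {t1..t2} ?c = integral {t1..t2} (\<lambda>s. g s x)"
    using t x by (intro Henstock_Kurzweil_Integration.integral_cong) (auto simp: g_def pde)
  ultimately show ?thesis using AI(1)[of t1] AI(1)[of t2] t by simp
qed

text \<open>The boundary term of Green's formula is \<open>O(1 - b\<^sup>2)\<close> uniformly in time because
  \<open>u\<close> and \<open>u\<^sub>x\<close> are bounded near the ends.\<close>

lemma green:
  "\<exists>\<delta> C. 0 < \<delta> \<and> (\<forall>b s. s \<in> {0<..<T} \<longrightarrow> 0 < b \<longrightarrow> 1 -
      \<delta> < b \<longrightarrow> b < 1 \<longrightarrow>
    \<bar>integral {-b..b} (\<lambda>x. g s x * legendre_P n x) + legendre_eigenvalue n * integral {-b..b} (\<lambda>x. uc s x * legendre_P n x)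
      - integral {-b..b} (\<lambda>x. h x * legendre_P n x)\<bar> \<le> C * (1 - b\<^sup>2))"
proof -
  let ?P = "legendre_P n" and ?l = "legendre_eigenvalue n"
  define P' where "P' = poly (pderiv (legendre_poly n))"
  obtain \<delta> M where \<delta>: "\<delta> > 0" and M: "\<And>t x. t \<in> {0<..<T} \<Longrightarrow> x \<in> {-1<..<1}
      \<Longrightarrow> 1 - \<delta> < \<bar>x\<bar> \<Longrightarrow>
        \<bar>u t x\<bar> \<le> M \<and> \<bar>deriv (u t) x\<bar> \<le> M"
    using sol unfolding inverse_source_solution_def by metis
  have *: "\<bar>integral {-b..b} (\<lambda>x. g s x * ?P x) + ?l * integral {-b..b} (\<lambda>x. uc s x * ?P x)
      - integral {-b..b} (\<lambda>x. h x * ?P x)\<bar> \<le> 2 * (M * 1 + M * (?l / 2)) * (1 - b\<^sup>2)"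
    if s: "s \<in> {0<..<T}" and b: "0 < b" "1 - \<delta> < b" "b < 1" for s b
  proof -
    define q where "q x = (1 - x\<^sup>2) * deriv (u s) x" for x
    \<comment> \<open>Green's boundary function (1 - x^2)(u_x P_n - u P_n'). The product (1 - x^2)
      u_x is kept together as \<open>q\<close>, because it is the quantity whose derivative the
      notion of solution provides.\<close>
    define \<Psi> where "\<Psi> x = q x * ?P x - u s x * ((1 - x\<^sup>2) * P' x)" for x
    have sub: "{-b..b} \<subseteq> {-1<..<1}" "{-b..b} \<subseteq> {-1..1}" using b by auto
    have d\<Psi>: "(\<Psi> has_real_derivative legendre_op (u s) x * ?P x + ?l * (u s x * ?P x)) (at x)" if x: "x \<in> {-1<..<1}" for x
    proof -
      have 1: "(u s has_real_derivative deriv (u s) x) (at x)"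
        using pde(2)[OF s x] by (simp add: DERIV_deriv_iff_real_differentiable)
      have 2: "(q has_real_derivative legendre_op (u s) x) (at x)"
        using pde(3)[OF s x] by (simp add: DERIV_deriv_iff_real_differentiable q_def[abs_def] legendre_op_def)
      have 3: "(?P has_real_derivative P' x) (at x)" unfolding P'_def by (rule has_real_derivative_legendre_P)
      have 4: "((\<lambda>x. (1 - x\<^sup>2) * P' x) has_real_derivative - ?l * ?P x) (at x)"
      proof -
        have "((\<lambda>x. (1 - x\<^sup>2) * P' x) has_real_derivative (- 2 * x) * P' x + (1 - x\<^sup>2) * poly (pderiv (pderiv
            (legendre_poly n))) x) (at x)"
          unfolding P'_def by (auto intro!: derivative_eq_intros)
        then show ?thesis by (rule DERIV_cong) (use legendre_ode_at[of x n] in \<open>simp add: P'_def\<close>)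
      qed
      show ?thesis
        unfolding \<Psi>_def
        by (rule DERIV_cong[OF DERIV_diff[OF DERIV_mult[OF 2 3] DERIV_mult[OF 1 4]]]) (simp add: q_def algebra_simps)
    qed
    have cu': "continuous_on {-b..b} (u s)"
      using cu by (rule continuous_on_sections) (use s sub in auto)
    have cL': "continuous_on {-b..b} (legendre_op (u s))"
      using cL by (rule continuous_on_sections) (use s sub in auto)
    have ch': "continuous_on {-b..b} h" using continuous_on_subset[OF ch sub(1)] .
    have "((\<lambda>x. legendre_op (u s) x * ?P x + ?l * (u s x * ?P x)) has_integral \<Psi> b - \<Psi> (- b)) {-b..b}"
    proof (rule fundamental_theorem_of_calculus)
      fix x assume "x \<in> {-b..b}"
      then have "x \<in> {-1<..<1}" using sub by blast
      from has_field_derivative_at_within[OF d\<Psi>[OF this], of "{-b..b}"]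
      show "(\<Psi> has_vector_derivative legendre_op (u s) x * ?P x + ?l * (u s x * ?P x)) (at x within {-b..b})"
        by (simp only: has_real_derivative_iff_has_vector_derivative)
    qed (use b in simp)
    then have "integral {-b..b} (\<lambda>x. legendre_op (u s) x * ?P x + ?l * (u s x * ?P x)) = \<Psi> b - \<Psi> (- b)"
      by (rule integral_unique)
    then have "integral {-b..b} (\<lambda>x. legendre_op (u s) x * ?P x) + ?l * integral {-b..b} (\<lambda>x. u s x * ?P x) = \<Psi> b - \<Psi> (- b)"
      by (subst (asm) integral_add) (auto intro!: integrable_continuous_real continuous_intros cu' cL')
    moreover have "integral {-b..b} (\<lambda>x. g s x * ?P x) = integral {-b..b} (\<lambda>x. legendre_op (u s) x * ?P x) +
        integral {-b..b} (\<lambda>x. h x * ?P x)"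
      unfolding g_def distrib_right by (intro integral_add integrable_continuous_real continuous_intros cL' ch')
    moreover have "integral {-b..b} (\<lambda>x. uc s x * ?P x) = integral {-b..b} (\<lambda>x. u s x * ?P x)"
      using s sub by (intro Henstock_Kurzweil_Integration.integral_cong) (auto simp: uc_eq subset_iff)
    ultimately have eq: "integral {-b..b} (\<lambda>x. g s x * ?P x) + ?l * integral {-b..b} (\<lambda>x. uc s x * ?P x)
      - integral {-b..b} (\<lambda>x. h x * ?P x) = \<Psi> b - \<Psi> (- b)" by simp
    have "\<bar>\<Psi> x\<bar> \<le> (1 - b\<^sup>2) * (M * 1 + M * (?l / 2))" if x: "\<bar>x\<bar> = b" for x
    proof -
      have x1: "x \<in> {-1<..<1}" "x \<in> {-1..1}" using b x by auto
      have Mx: "\<bar>u s x\<bar> \<le> M" "\<bar>deriv (u s) x\<bar> \<le> M" using M[OF s x1(1)] x b by auto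
      have "x\<^sup>2 = b\<^sup>2" using x by (metis power2_abs)
      then have "\<Psi> x = (1 - b\<^sup>2) * (deriv (u s) x * ?P x - u s x * P' x)"
        by (simp add: \<Psi>_def q_def algebra_simps)
      moreover have "0 \<le> 1 - b\<^sup>2" using b by (simp add: abs_square_le_1)
      moreover have "\<bar>deriv (u s) x * ?P x - u s x * P' x\<bar> \<le> M * 1 + M * (?l / 2)"
      proof -
        have "\<bar>deriv (u s) x * ?P x - u s x * P' x\<bar> \<le> \<bar>deriv (u s) x\<bar> * \<bar>?P x\<bar> + \<bar>u s
            x\<bar> * \<bar>P' x\<bar>"
          by (metis abs_mult abs_triangle_ineq4)
        also have "\<dots> \<le> M * 1 + M * (?l / 2)"
          unfolding P'_def using Mx x1 by (intro add_mono mult_mono abs_legendre_P_le abs_legendre_P'_le) auto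
        finally show ?thesis .
      qed
      ultimately show ?thesis by (simp add: abs_mult mult_left_mono)
    qed
    from this[of b] this[of "- b"] b
    have "\<bar>\<Psi> b - \<Psi> (- b)\<bar> \<le> 2 * ((1 - b\<^sup>2) * (M * 1 + M * (?l / 2)))" by simp
    also have "\<dots> = 2 * (M * 1 + M * (?l / 2)) * (1 - b\<^sup>2)" by (simp only: mult_ac)
    finally show ?thesis unfolding eq .
  qed
  show ?thesis by (intro exI conjI allI impI, rule \<delta>, rule *)
qed

text \<open>H is the limit of the truncated integrals \<open>Hb b\<close> as b -> 1. The limit
  exists because every other term of the truncated identity converges, and it is common to all t1,
  t2 because h does not depend on time.\<close>

lemma integrated_equation:
  "\<exists>H. \<forall>t1 t2. 0 < t1 \<longrightarrow> t1 < t2 \<longrightarrow> t2 < T \<longrightarrow>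
    conv (pker (1 - a)) (y n) t2 - conv (pker (1 - a)) (y n) t1
      + legendre_eigenvalue n * integral {t1..t2} (y n) = (t2 - t1) * H"
proof -
  let ?P = "legendre_P n" and ?l = "legendre_eigenvalue n" and ?k = "pker (1 - a)"
  define Hb where "Hb b = integral {-b..b} (\<lambda>x. h x * ?P x)" for b
  define D where "D t1 t2 = conv ?k (y n) t2 - conv ?k (y n) t1 + ?l * integral {t1..t2} (y n)" for t1 t2
  obtain M where M: "\<And>t x. \<bar>uc t x\<bar> \<le> M" using uc_bounded by blast
  obtain \<delta> C where \<delta>: "0 < \<delta>" and green_n: "\<And>b s. s \<in> {0<..<T} \<Longrightarrow> 0 < b
      \<Longrightarrow> 1 - \<delta> < b \<Longrightarrow> b < 1 \<Longrightarrow>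
    \<bar>integral {-b..b} (\<lambda>x. g s x * ?P x) + ?l * integral {-b..b} (\<lambda>x. uc s x * ?P x) - Hb b\<bar> \<le> C * (1 - b\<^sup>2)"
    using green[of n, folded Hb_def] by blast
  have ki: "conv_integrable ?k (\<lambda>_. 1) t" if "0 < t" for t
    using conv_pker(1)[of "1 - a" 1 t] that a
    by (simp add: conv_integrable_commute[of ?k] conv_pker_1)
  have AP: "(\<lambda>x. A t x * ?P x) integrable_on {-1..1}" "integral {-1..1} (\<lambda>x. A t x * ?P x) = conv ?k (y n) t" if t: "0 < t" for t
  proof -
    have "\<bar>uc s x * ?P x\<bar> \<le> M" if "x \<in> {-1..1}" for s x
      using mult_mono[OF M[of s x] abs_legendre_P_le[OF that, of n]] M[of s x] by (simp add: abs_mult)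
    from conv_integral_swap[OF cucP[of _ n] this ki[OF t] pker_measurable pker_nonneg]
    have "(\<lambda>x. conv ?k (\<lambda>s. uc s x * ?P x) t) integrable_on {-1..1}"
       "integral {-1..1} (\<lambda>x. conv ?k (\<lambda>s. uc s x * ?P x) t) = conv ?k (\<lambda>s. integral {-1..1} (\<lambda>x. uc s x * ?P x)) t"
      using a by simp_all
    moreover have "conv ?k (\<lambda>s. uc s x * ?P x) t = A t x * ?P x" for x
      by (simp add: A_def conv_def mult.assoc[symmetric])
    ultimately show "(\<lambda>x. A t x * ?P x) integrable_on {-1..1}" "integral {-1..1} (\<lambda>x. A t x * ?P x) = conv ?k (y n) t"
      by (simp_all add: y_def[abs_def])
  qed
  have lim: "((\<lambda>b. (t2 - t1) * Hb b) \<longlongrightarrow> D t1 t2) (at_left 1)" if t: "0 < t1" "t1 < t2" "t2 < T" for t1 t2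
  proof -
    define V where "V x = integral {t1..t2} (\<lambda>s. uc s x * ?P x)" for x
    define \<phi> where "\<phi> x = A t2 x * ?P x - A t1 x * ?P x + ?l * V x" for x
    have swapV: "integral {c..d} V = integral {t1..t2} (\<lambda>s. integral {c..d} (\<lambda>x. uc s x * ?P x))" for c d
      unfolding V_def using integral_swap_continuous[OF cucP[of "cbox (t1, c) (t2, d)" n]] by simp
    have cV: "continuous_on {-1..1} V"
    proof -
      have "continuous_on ({-1..1} \<times> cbox t1 t2) (\<lambda>p. (\<lambda>(s, x). uc s x * ?P x) (snd p, fst p))"
        by (rule continuous_on_compose2[OF cucP[of UNIV n]]) (auto intro!: continuous_intros)
      then have "continuous_on ({-1..1} \<times> cbox t1 t2) (\<lambda>(x, s). uc s x * ?P x)" by (simp add: case_prod_unfold)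
      from integral_continuous_on_param[OF this] show ?thesis by (simp add: V_def[abs_def])
    qed
    have \<phi>i: "\<phi> integrable_on {-1..1}"
      unfolding \<phi>_def using t by (intro integrable_add integrable_diff AP integrable_continuous_real continuous_intros cV) auto
    have "integral {-1..1} \<phi> = D t1 t2"
    proof -
      have "integral {-1..1} \<phi> = integral {-1..1} (\<lambda>x. A t2 x * ?P x - A t1 x * ?P x) + integral {-1..1} (\<lambda>x. ?l * V x)"
        unfolding \<phi>_def using t by (intro integral_add integrable_diff AP integrable_continuous_real continuous_intros cV) auto
      also have "integral {-1..1} (\<lambda>x. A t2 x * ?P x - A t1 x * ?P x) = conv ?k (y n) t2 - conv ?k (y n) t1"
        using t by (subst integral_diff) (auto simp: AP)
      also have "integral {-1..1} (\<lambda>x. ?l * V x) = ?l * integral {t1..t2} (y n)"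
        by (simp add: swapV y_def[abs_def])
      finally show ?thesis by (simp add: D_def)
    qed
    with tendsto_integral_symmetric[OF \<phi>i]
    have lim1: "((\<lambda>b. integral {-b..b} \<phi>) \<longlongrightarrow> D t1 t2) (at_left 1)" by simp
    \<comment> \<open>On the compact rectangle [t1,t2] x [-b,b] the integrals may be exchanged, so
      the difference becomes a time integral of the expression estimated in
      \<open>green\<close>.\<close>
    have bound: "\<bar>integral {-b..b} \<phi> - (t2 - t1) * Hb b\<bar> \<le> C * (1 - b\<^sup>2) * (t2 - t1)" if b: "0 < b" "1 -
        \<delta> < b" "b < 1" for b
    proof -
      have sub: "{-b..b} \<subseteq> {-1<..<1}" "{t1..t2} \<subseteq> {0<..<T}" using b t by auto
      have cgP: "continuous_on ({t1..t2} \<times> {-b..b}) (\<lambda>(s, x). g s x * ?P x)"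
      proof -
        have "continuous_on ({t1..t2} \<times> {-b..b}) (\<lambda>p. (\<lambda>(s, x). g s x) p * ?P (snd p))"
          using sub by (intro continuous_on_mult continuous_on_subset[OF cg] continuous_on_compose2[OF
              continuous_on_legendre_P[of UNIV]] continuous_intros) auto
        then show ?thesis by (simp add: case_prod_unfold)
      qed
      define Gb where "Gb s = integral {-b..b} (\<lambda>x. g s x * ?P x)" for s
      define Ub where "Ub s = integral {-b..b} (\<lambda>x. uc s x * ?P x)" for s
      have cGb: "continuous_on {t1..t2} Gb"
        unfolding Gb_def[abs_def] using integral_continuous_on_param[of "{t1..t2}" "-b" b "\<lambda>s x. g s x * ?P x"] cgP by simp
      have cUb: "continuous_on {t1..t2} Ub"
        unfolding Ub_def[abs_def] using integral_continuous_on_param[of "{t1..t2}" "-b" b "\<lambda>s x. uc s x * ?P x"] cucP by simp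
      have gi: "(\<lambda>x. integral {t1..t2} (\<lambda>s. g s x * ?P x)) integrable_on {-b..b}"
      proof -
        have "continuous_on ({-b..b} \<times> cbox t1 t2) (\<lambda>p. (\<lambda>(s, x). g s x * ?P x) (snd p, fst p))"
          by (rule continuous_on_compose2[OF cgP]) (auto intro!: continuous_intros)
        then have "continuous_on ({-b..b} \<times> cbox t1 t2) (\<lambda>(x, s). g s x * ?P x)" by (simp add: case_prod_unfold)
        from integral_continuous_on_param[OF this] show ?thesis by (intro integrable_continuous_real) simp
      qed
      have "integral {-b..b} \<phi> = integral {-b..b} (\<lambda>x. integral {t1..t2} (\<lambda>s. g s x * ?P x) + ?l * V x)"
      proof (rule Henstock_Kurzweil_Integration.integral_cong)
        fix x assume "x \<in> {-b..b}"
        then have "A t2 x - A t1 x = integral {t1..t2} (\<lambda>s. g s x)" using sub t by (intro A_diff) auto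
        then have "A t2 x * ?P x - A t1 x * ?P x = integral {t1..t2} (\<lambda>s. g s x * ?P x)"
          by (simp flip: left_diff_distrib)
        then show "\<phi> x = integral {t1..t2} (\<lambda>s. g s x * ?P x) + ?l * V x" by (simp add: \<phi>_def)
      qed
      also have "\<dots> = integral {-b..b} (\<lambda>x. integral {t1..t2} (\<lambda>s. g s x * ?P x)) + integral {-b..b} (\<lambda>x. ?l * V x)"
        using b by (intro integral_add gi integrable_continuous_real continuous_intros continuous_on_subset[OF cV]) auto
      also have "integral {-b..b} (\<lambda>x. integral {t1..t2} (\<lambda>s. g s x * ?P x)) = integral {t1..t2} Gb"
        unfolding Gb_def using integral_swap_continuous[of t1 "-b" t2 b "\<lambda>s x. g s x * ?P x"] cgP
        by (simp add: cbox_Pair_eq)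
      also have "integral {-b..b} (\<lambda>x. ?l * V x) = ?l * integral {t1..t2} Ub"
        unfolding Ub_def by (simp add: swapV)
      also have "integral {t1..t2} Gb + ?l * integral {t1..t2} Ub - (t2 - t1) * Hb b =
          integral {t1..t2} (\<lambda>s. Gb s + ?l * Ub s - Hb b)"
      proof -
        have "integral {t1..t2} (\<lambda>s. Gb s + ?l * Ub s - Hb b) = integral {t1..t2} (\<lambda>s. Gb s + ?l * Ub s) -
            integral {t1..t2} (\<lambda>s. Hb b)"
          by (intro integral_diff integrable_continuous_real continuous_intros cGb cUb)
        also have "integral {t1..t2} (\<lambda>s. Gb s + ?l * Ub s) = integral {t1..t2} Gb + integral {t1..t2} (\<lambda>s. ?l * Ub s)"
          by (intro integral_add integrable_continuous_real continuous_intros cGb cUb)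
        finally show ?thesis using t by simp
      qed
      finally have "integral {-b..b} \<phi> - (t2 - t1) * Hb b = integral {t1..t2} (\<lambda>s. Gb s + ?l * Ub s - Hb b)"
        by linarith
      also have "norm \<dots> \<le> C * (1 - b\<^sup>2) * (t2 - t1)"
      proof (rule integral_bound)
        show "norm (Gb s + ?l * Ub s - Hb b) \<le> C * (1 - b\<^sup>2)" if "s \<in> {t1..t2}" for s
          using green_n[of s b] that b t by (simp add: Gb_def Ub_def)
      qed (use t in \<open>auto intro!: continuous_intros cGb cUb\<close>)
      finally show ?thesis by simp
    qed
    have "((\<lambda>b. integral {-b..b} \<phi> - (t2 - t1) * Hb b) \<longlongrightarrow> 0) (at_left 1)"
    proof (rule Lim_null_comparison)
      show "((\<lambda>b. C * (1 - b\<^sup>2) * (t2 - t1)) \<longlongrightarrow> 0) (at_left 1)"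
        by (auto intro!: tendsto_eq_intros)
      have "\<forall>\<^sub>F b in at_left 1. b \<in> {max 0 (1 - \<delta>)<..<1}"
        using \<delta> by (intro eventually_at_left_real) auto
      then show "\<forall>\<^sub>F b in at_left 1. norm (integral {-b..b} \<phi> - (t2 - t1) * Hb b) \<le> C * (1 - b\<^sup>2) * (t2 - t1)"
        by eventually_elim (use bound in auto)
    qed
    from tendsto_diff[OF lim1 this] show ?thesis by simp
  qed
  \<comment> \<open>Any two interior times would do: one instance of \<open>lim\<close> yields
    convergence of \<open>Hb\<close>, and the others then follow by uniqueness of limits.\<close>
  define H where "H = D (T / 3) (2 * T / 3) / (2 * T / 3 - T / 3)"
  have "((\<lambda>b. (2 * T / 3 - T / 3) * Hb b / (2 * T / 3 - T / 3)) \<longlongrightarrow> H) (at_left 1)"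
    unfolding H_def using T by (intro tendsto_divide lim tendsto_const) auto
  then have Hlim: "(Hb \<longlongrightarrow> H) (at_left 1)" using T by simp
  have "D t1 t2 = (t2 - t1) * H" if t: "0 < t1" "t1 < t2" "t2 < T" for t1 t2
    using tendsto_unique[OF _ lim[OF t] tendsto_mult[OF tendsto_const Hlim]] by simp
  then show ?thesis unfolding D_def by blast
qed

text \<open>Let t1 -> 0 in \<open>integrated_equation\<close>. For bounded y the fractional integral
  at time s is at most B s^(1-a) / Gamma(2 - a) in modulus, so it vanishes in the limit.\<close>

lemma relaxation_equation:
  "\<exists>H. \<forall>t. 0 < t \<longrightarrow> t < T \<longrightarrow>
    conv (pker (1 - a)) (y n) t + legendre_eigenvalue n * integral {0..t} (y n) = t * H"
proof -
  let ?l = "legendre_eigenvalue n" and ?k = "pker (1 - a)"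
  obtain H where H: "\<And>t1 t2. 0 < t1 \<Longrightarrow> t1 < t2 \<Longrightarrow> t2 < T \<Longrightarrow>
    conv ?k (y n) t2 - conv ?k (y n) t1 + ?l * integral {t1..t2} (y n) = (t2 - t1) * H"
    using integrated_equation by blast
  obtain B where B: "\<And>t. \<bar>y n t\<bar> \<le> B" using bounded_y by blast
  have conv0: "((\<lambda>s. conv ?k (y n) s) \<longlongrightarrow> 0) (at_right 0)"
  proof (rule Lim_null_comparison)
    show "((\<lambda>s. B * pker (2 - a) s) \<longlongrightarrow> 0) (at_right 0)"
      unfolding pker_def using a less_imp_neq[OF Gamma_real_pos[of "2 - a"]]
      by (auto intro!: tendsto_eq_intros tendsto_powr' simp: eventually_at_filter)
    show "\<forall>\<^sub>F s in at_right 0. norm (conv ?k (y n) s) \<le> B * pker (2 - a) s"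
      using eventually_at_right_less[of 0]
    proof eventually_elim
      case (elim s)
      have "conv_integrable ?k (\<lambda>_. 1) s" "conv ?k (\<lambda>_. 1) s = pker (2 - a) s"
        using conv_pker[of "1 - a" 1 s] elim a
        by (auto simp: conv_integrable_commute[of ?k] conv_commute[of ?k] conv_pker_1)
      with abs_conv_le[OF this(1) _ borel_measurable_continuous_onI[OF cy] B] pker_nonneg[of "1 - a"] a show ?case
        by simp
    qed
  qed
  have "conv ?k (y n) t + ?l * integral {0..t} (y n) = t * H" if t: "0 < t" "t < T" for t
  proof -
    have yi: "y n integrable_on {c..d}" for c d
      by (intro integrable_continuous_real continuous_on_subset[OF cy]) auto
    have "continuous_on {0..t} (\<lambda>s. integral {0..s} (y n))"
      by (intro indefinite_integral_continuous_1 yi)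
    then have I0: "((\<lambda>s. integral {0..s} (y n)) \<longlongrightarrow> integral {0..0} (y n)) (at_right 0)"
      using t unfolding continuous_on_def by (metis at_within_Icc_at_right atLeastAtMost_iff less_imp_le order_refl)
    have lim: "((\<lambda>s. conv ?k (y n) t - conv ?k (y n) s + ?l * (integral {0..t} (y n) - integral {0..s} (y n)) - (t - s) *
        H) \<longlongrightarrow>
       conv ?k (y n) t - 0 + ?l * (integral {0..t} (y n) - integral {0..0} (y n)) - (t - 0) * H) (at_right 0)"
      by (intro tendsto_intros conv0 I0)
    have ev: "\<forall>\<^sub>F s in at_right 0. conv ?k (y n) t - conv ?k (y n) s + ?l * (integral {0..t} (y n) - integral
        {0..s} (y n)) - (t - s) * H = 0"
      using eventually_at_right_real[OF t(1)]
    proof eventually_elim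
      case (elim s)
      have "integral {0..s} (y n) + integral {s..t} (y n) = integral {0..t} (y n)"
        using elim by (intro Henstock_Kurzweil_Integration.integral_combine yi) auto
      then have eq: "integral {0..t} (y n) - integral {0..s} (y n) = integral {s..t} (y n)" by simp
      show ?case unfolding eq using H[of s t] elim t by simp
    qed
    from tendsto_unique[OF _ iffD1[OF tendsto_cong[OF ev] lim] tendsto_const] show ?thesis by simp
  qed
  then show ?thesis by blast
qed

lemma u_eq_0:
  assumes t: "t \<in> {0..T}" and x: "x \<in> {-1..1}"
  shows "u t x = 0"
proof (rule legendre_P_complete[OF _ _ x])
  show "continuous_on {-1..1} (u t)" using cu by (rule continuous_on_sections) (use t in auto)
  fix n
  obtain H where H: "\<And>t. 0 < t \<Longrightarrow> t < T \<Longrightarrow>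
    conv (pker (1 - a)) (y n) t + legendre_eigenvalue n * integral {0..t} (y n) = t * H"
    using relaxation_equation by blast
  obtain B where B: "\<And>t. \<bar>y n t\<bar> \<le> B" using bounded_y by blast
  have "0 \<le> legendre_eigenvalue n" by (simp add: legendre_eigenvalue_def)
  from fractional_relaxation_unique[OF a this T cy B yT H t] have "y n t = 0" .
  moreover have "y n t = integral {-1..1} (\<lambda>x. u t x * legendre_P n x)"
    unfolding y_def using t by (intro Henstock_Kurzweil_Integration.integral_cong) (simp add: uc_eq)
  ultimately show "integral {-1..1} (\<lambda>x. u t x * legendre_P n x) = 0" by simp
qed

text \<open>Once u vanishes, the equation at any one interior time reduces to 0 = h(x).\<close>

lemma h_eq_0:
  assumes x: "x \<in> {-1<..<1}"
  shows "h x = 0"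
proof -
  define t where "t = T / 2"
  have t: "t \<in> {0<..<T}" using T by (simp add: t_def)
  have "deriv (\<lambda>s. u s x) s = 0" if "s \<in> {0<..<t}" for s
    by (rule DERIV_imp_deriv, rule has_field_derivative_transform_within_open[of "\<lambda>_. 0" _ _ "{0<..<T}"])
       (use that t x u_eq_0 in auto)
  then have "caputo a (\<lambda>s. u s x) t = conv (pker (1 - a)) (\<lambda>_. 0) t"
    unfolding caputo_eq_conv[OF a] by (intro conv_cong) auto
  then have "caputo a (\<lambda>s. u s x) t = 0" by (simp add: conv_def)
  moreover have "legendre_op (u t) x = 0"
  proof -
    have 1: "deriv (u t) z = 0" if "z \<in> {-1<..<1}" for z
      by (rule DERIV_imp_deriv, rule has_field_derivative_transform_within_open[of "\<lambda>_. 0" _ _ "{-1<..<1}"])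
         (use that t u_eq_0 in auto)
    show ?thesis
      unfolding legendre_op_def
      by (rule DERIV_imp_deriv, rule has_field_derivative_transform_within_open[of "\<lambda>_. 0" _ _ "{-1<..<1}"])
         (use x 1 in auto)
  qed
  ultimately show ?thesis using pde(4)[OF t x] by simp
qed

end

section \<open>Existence\<close>

lemma continuous_on_suminf_majorant:
  fixes f :: "nat \<Rightarrow> 'a :: topological_space \<Rightarrow> real"
  assumes "\<And>n. continuous_on A (f n)" "\<And>n x. x \<in> A \<Longrightarrow> \<bar>f n x\<bar> \<le> M n" "summable M"
  shows "continuous_on A (\<lambda>x. \<Sum>n. f n x)"
proof (rule uniform_limit_theorem)
  show "uniform_limit A (\<lambda>n x. \<Sum>i<n. f i x) (\<lambda>x. \<Sum>i. f i x) sequentially"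
    using assms(2,3) by (intro Weierstrass_m_test[of _ _ M]) auto
qed (use assms(1) in \<open>auto intro!: always_eventually continuous_intros\<close>)

lemma has_real_derivative_suminf_majorant:
  fixes f :: "nat \<Rightarrow> real \<Rightarrow> real"
  assumes "open S" "convex S" "x \<in> S"
    and "\<And>n x. x \<in> S \<Longrightarrow> (f n has_real_derivative f' n x) (at x)"
    and "\<And>n x. x \<in> S \<Longrightarrow> \<bar>f' n x\<bar> \<le> M n" "summable M" "summable (\<lambda>n. f n x)"
  shows "((\<lambda>x. \<Sum>n. f n x) has_real_derivative (\<Sum>n. f' n x)) (at x)"
proof (rule has_field_derivative_series'(2)[of S f f' x])
  show "uniformly_convergent_on S (\<lambda>n x. \<Sum>i<n. f' i x)"
    using assms(5,6) by (intro Weierstrass_m_test'[of _ _ M]) auto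
qed (use assms in \<open>auto intro: has_field_derivative_at_within simp: interior_open\<close>)

text \<open>Nonnegativity of k and of the g n makes the L1 norm of the n-th integrand |d n| conv k
  (g n) t, which is at most |d n| B; the norms are therefore summable and the series may be
  integrated termwise.\<close>

lemma conv_suminf:
  assumes k: "\<And>s. 0 < s \<Longrightarrow> s < t \<Longrightarrow> 0 \<le> k s"
    and g: "\<And>n s. 0 < s \<Longrightarrow> s < t \<Longrightarrow> 0 \<le> g n s" "\<And>n. conv_integrable k (g n) t"
    and B: "\<And>n. conv k (g n) t \<le> B" and d: "summable (\<lambda>n. \<bar>d n\<bar>)"
    and s: "\<And>s. 0 < s \<Longrightarrow> s < t \<Longrightarrow> summable (\<lambda>n. \<bar>d n\<bar> * g n s)"
  shows "conv_integrable k (\<lambda>s. \<Sum>n. d n * g n s) t"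
    "conv k (\<lambda>s. \<Sum>n. d n * g n s) t = (\<Sum>n. d n * conv k (g n) t)"
proof -
  define F where "F n s = d n * (indicator {0<..<t} s * (k (t - s) * g n s))" for n s
  have int: "integrable lborel (F n)" for n
    using g(2)[of n] unfolding F_def conv_integrable_def by (rule integrable_mult_right)
  have I: "integral\<^sup>L lborel (F n) = d n * conv k (g n) t" for n
    by (simp add: F_def[abs_def] conv_def)
  have nF: "norm (F n s) = \<bar>d n\<bar> * (indicator {0<..<t} s * (k (t - s) * g n s))" for n s
    using k[of "t - s"] g(1)[of s n] by (cases "s \<in> {0<..<t}") (auto simp: F_def abs_mult)
  have "AE s in lborel. summable (\<lambda>n. norm (F n s))"
  proof (rule AE_I2)
    fix r
    show "summable (\<lambda>n. norm (F n r))"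
    proof (cases "r \<in> {0<..<t}")
      case True
      have "summable (\<lambda>n. k (t - r) * (\<bar>d n\<bar> * g n r))" using s True by (intro summable_mult) auto
      with True show ?thesis unfolding nF by (simp add: mult_ac)
    next
      case False
      then have "indicator {0<..<t} r = (0 :: real)" by (simp add: indicator_def)
      then show ?thesis unfolding nF by simp
    qed
  qed
  moreover have "summable (\<lambda>n. \<integral>s. norm (F n s) \<partial>lborel)"
  proof (rule summable_comparison_test)
    show "summable (\<lambda>n. \<bar>d n\<bar> * B)" by (intro summable_mult2 d)
    have "(\<integral>s. norm (F n s) \<partial>lborel) = \<bar>d n\<bar> * conv k (g n) t" for n unfolding nF by (simp add: conv_def)
    moreover have "0 \<le> conv k (g n) t" for n using k g by (intro conv_nonneg) auto
    ultimately show "\<exists>N. \<forall>n\<ge>N. norm (\<integral>s. norm (F n s) \<partial>lborel) \<le> \<bar>d n\<bar> * B"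
      using B by (auto intro!: mult_left_mono simp: abs_mult)
  qed
  moreover have eq: "(\<Sum>n. F n r) = indicator {0<..<t} r * (k (t - r) * (\<Sum>n. d n * g n r))" for r
  proof (cases "r \<in> {0<..<t}")
    case True
    have "summable (\<lambda>n. d n * g n r)"
    proof (rule summable_rabs_cancel)
      show "summable (\<lambda>n. \<bar>d n * g n r\<bar>)" using s[of r] g(1)[of r] True by (simp add: abs_mult)
    qed
    then have "(\<Sum>n. k (t - r) * (d n * g n r)) = k (t - r) * (\<Sum>n. d n * g n r)" by (rule suminf_mult)
    with True show ?thesis by (simp add: F_def mult_ac)
  qed (simp add: F_def)
  ultimately have "integrable lborel (\<lambda>s. \<Sum>n. F n s)" "(\<integral>s. (\<Sum>n. F n s) \<partial>lborel) = (\<Sum>n.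
      integral\<^sup>L lborel (F n))"
    using int by (blast intro: integrable_suminf integral_suminf)+
  then show "conv_integrable k (\<lambda>s. \<Sum>n. d n * g n s) t"
    "conv k (\<lambda>s. \<Sum>n. d n * g n s) t = (\<Sum>n. d n * conv k (g n) t)"
    by (simp_all add: conv_integrable_def conv_def[of k "\<lambda>s. \<Sum>n. d n * g n s"] eq I)
qed

text \<open>Absolute summability makes the series converge uniformly to a continuous function with
  the same Legendre coefficients as f. By completeness it is f.\<close>

lemma legendre_expansion:
  assumes f: "continuous_on {-1..1} f" and s: "summable (\<lambda>n. \<bar>legendre_coeff f n\<bar>)" and x: "x \<in> {-1..1}"
  shows "(\<lambda>n. legendre_coeff f n * legendre_P n x) sums f x"
proof -
  let ?c = "legendre_coeff f"
  have le: "\<bar>?c n * legendre_P n x\<bar> \<le> \<bar>?c n\<bar>" if "x \<in> {-1..1}" for n x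
    using abs_legendre_P_le[OF that, of n] by (simp add: abs_mult mult_left_le)
  define S where "S x = (\<Sum>n. ?c n * legendre_P n x)" for x
  have cS: "continuous_on {-1..1} S"
    unfolding S_def using le s by (intro continuous_on_suminf_majorant[of _ _ "\<lambda>n. \<bar>?c n\<bar>"] continuous_intros) auto
  have sums: "(\<lambda>n. ?c n * legendre_P n x) sums S x" if "x \<in> {-1..1}" for x
    unfolding S_def using le[OF that] by (intro summable_sums summable_comparison_test[OF _ s]) auto
  have "integral {-1..1} (\<lambda>x. (f x - S x) * legendre_P m x) = 0" for m
  proof -
    have ul: "uniform_limit {-1..1} (\<lambda>N x. \<Sum>n<N. ?c n * legendre_P n x * legendre_P m x) (\<lambda>x. \<Sum>n. ?c n
        * legendre_P n x * legendre_P m x) sequentially"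
    proof (rule Weierstrass_m_test[OF _ s])
      fix n x assume x: "x \<in> {-1..1::real}"
      have "\<bar>?c n * legendre_P n x\<bar> * \<bar>legendre_P m x\<bar> \<le> \<bar>?c n\<bar> * 1"
        by (intro mult_mono le abs_legendre_P_le x) auto
      then show "norm (?c n * legendre_P n x * legendre_P m x) \<le> \<bar>?c n\<bar>" by (simp add: abs_mult)
    qed
    obtain I J where IJ: "\<And>N. ((\<lambda>x. \<Sum>n<N. ?c n * legendre_P n x * legendre_P m x) has_integral I N) {-1..1}"
      "((\<lambda>x. \<Sum>n. ?c n * legendre_P n x * legendre_P m x) has_integral J) {-1..1}" "I \<longlonglongrightarrow> J"
    proof -
      have "continuous_on {-1..1} (\<lambda>x. \<Sum>n<N. ?c n * legendre_P n x * legendre_P m x)" for N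
        by (intro continuous_intros)
      from uniform_limit_integral[OF ul this sequentially_bot] show ?thesis using that by blast
    qed
    have "I N = (\<Sum>n<N. ?c n * integral {-1..1} (\<lambda>x. legendre_P n x * legendre_P m x))" for N
      using IJ(1)[of N, THEN integral_unique]
      by (subst (asm) integral_sum) (auto intro!: integrable_continuous_real continuous_intros simp: mult.assoc)
    also have "(\<Sum>n<N. ?c n * integral {-1..1} (\<lambda>x. legendre_P n x * legendre_P m x)) =
        (\<Sum>n<N. if n = m then ?c m * (2 / (2 * real m + 1)) else 0)" for N
      using integral_legendre_P_square[of m]
      by (intro sum.cong) (auto simp: legendre_P_orthogonal power2_eq_square)
    finally have IN: "I N = (\<Sum>n<N. if n = m then ?c m * (2 / (2 * real m + 1)) else 0)" for N .
    have "\<forall>\<^sub>F N in sequentially. I N = ?c m * (2 / (2 * real m + 1))"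
      using eventually_gt_at_top[of m] by (rule eventually_mono) (simp add: IN)
    then have "I \<longlonglongrightarrow> ?c m * (2 / (2 * real m + 1))" by (rule tendsto_eventually)
    with IJ(3) have "J = ?c m * (2 / (2 * real m + 1))" by (rule LIMSEQ_unique)
    moreover have "integral {-1..1} (\<lambda>x. S x * legendre_P m x) = J"
    proof -
      have "(\<Sum>n. ?c n * legendre_P n x * legendre_P m x) = S x * legendre_P m x" if "x \<in> {-1..1}" for x
        using sums_mult2[OF sums[OF that], of "legendre_P m x"] by (simp add: sums_iff)
      with IJ(2) show ?thesis by (metis (no_types, lifting) Henstock_Kurzweil_Integration.integral_cong integral_unique)
    qed
    moreover have "integral {-1..1} (\<lambda>x. f x * legendre_P m x) = ?c m * (2 / (2 * real m + 1))"
      by (simp add: legendre_coeff_eq[OF f])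
    moreover have "integral {-1..1} (\<lambda>x. (f x - S x) * legendre_P m x) =
       integral {-1..1} (\<lambda>x. f x * legendre_P m x) - integral {-1..1} (\<lambda>x. S x * legendre_P m x)"
      unfolding left_diff_distrib by (intro integral_diff integrable_continuous_real continuous_intros f cS)
    ultimately show ?thesis by simp
  qed
  then have "f x - S x = 0"
    by (intro legendre_P_complete[OF _ _ x, of "\<lambda>x. f x - S x"] continuous_intros f cS)
  with sums[OF x] show ?thesis by simp
qed

section \<open>The series solution\<close>

locale inverse_source_data =
  fixes a T :: real and v v1 v2 v3 gv w w1 w2 w3 gw :: "real \<Rightarrow> real"
  assumes a: "0 < a" "a < 1" and T: "0 < T"
    and Hv: "H4_derivs v v1 v2 v3 gv" and Hw: "H4_derivs w w1 w2 w3 gw"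
begin

abbreviation "ev \<equiv> legendre_eigenvalue"

definition fn :: "nat \<Rightarrow> real" where "fn n = legendre_coeff w n - legendre_coeff v n"

definition E :: "nat \<Rightarrow> real \<Rightarrow> real" where "E n t = mittag_leffler a (- ev n * t powr a)"

lemma cv: "continuous_on {-1..1} v" and cw: "continuous_on {-1..1} w"
  using Hv Hw by (auto simp: H4_derivs_def)

lemma fn_eq: "fn n = legendre_coeff (\<lambda>x. w x - v x) n"
  unfolding fn_def by (rule legendre_coeff_diff[symmetric, OF cw cv])

lemma summable_K: "summable (\<lambda>n. ev (Suc n) * \<bar>fn (Suc n)\<bar>)"
  using summable_eigenvalue_legendre_coeff[OF H4_derivs_diff[OF Hw Hv]]
  by (subst summable_Suc_iff) (simp add: fn_eq)

lemma ev_Suc: "2 \<le> ev (Suc n)"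
proof -
  have "1 * 2 \<le> real (Suc n) * (real (Suc n) + 1)" by (intro mult_mono) auto
  then show ?thesis by (simp add: legendre_eigenvalue_def)
qed

lemma ev_nonneg: "0 \<le> ev n"
  by (simp add: legendre_eigenvalue_def)

lemma summable_fn: "summable (\<lambda>n. \<bar>fn n\<bar>)"
proof -
  have "summable (\<lambda>n. \<bar>fn (Suc n)\<bar>)"
  proof (rule summable_comparison_test[OF _ summable_K])
    have "1 * \<bar>fn (Suc n)\<bar> \<le> ev (Suc n) * \<bar>fn (Suc n)\<bar>" for n
      using ev_Suc[of n] by (intro mult_right_mono) auto
    then show "\<exists>N. \<forall>n\<ge>N. norm \<bar>fn (Suc n)\<bar> \<le> ev (Suc n) * \<bar>fn (Suc n)\<bar>" by auto
  qed
  then show ?thesis by (subst (asm) summable_Suc_iff)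
qed

text \<open>The denominator for n = 1. Monotonicity of E_a makes it a positive lower bound for all
  the others, see \<open>q_le\<close>.\<close>

definition q :: real where "q = 1 - E 1 T"

lemma q_pos: "0 < q"
  using mlf_less_1[of a "ev 1 * T powr a"] a T
  by (simp add: q_def E_def mittag_leffler_eq legendre_eigenvalue_def)

lemma E_range: "0 \<le> E n t" "E n t \<le> 1"
  using mlf_nonneg[of a 1 "ev n * t powr a"] mlf_le[of a 1 "ev n * t powr a"] a
  by (auto simp: E_def mittag_leffler_eq legendre_eigenvalue_def)

lemma E_0: "E n 0 = 1"
  by (simp add: E_def mittag_leffler_eq mlf_0)

lemma q_le: "q \<le> 1 - E (Suc n) T"
proof -
  have "ev 1 * T powr a \<le> ev (Suc n) * T powr a"
  proof (rule mult_right_mono)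
    have "ev 1 = 2" by (simp add: legendre_eigenvalue_def)
    with ev_Suc[of n] show "ev 1 \<le> ev (Suc n)" by simp
  qed simp
  then show ?thesis
    using mlf_antimono[of a "ev 1 * T powr a" "ev (Suc n) * T powr a"] a
    by (simp add: q_def E_def mittag_leffler_eq ev_nonneg)
qed

definition r :: "nat \<Rightarrow> real" where "r n = fn (Suc n) / (1 - E (Suc n) T)"

text \<open>The common majorant for the M-tests. The eigenvalue in it pays for one Legendre operator
  or for one x-derivative of P_n. Indices are shifted by one because the mode n = 0 is split off as
  the t^a term.\<close>

abbreviation "K n \<equiv> ev (Suc n) * \<bar>r n\<bar>"

abbreviation "cf n t \<equiv> 1 - E (Suc n) t"

abbreviation "d x n \<equiv> ev (Suc n) * r n * legendre_P (Suc n) x"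

lemma r_le: "\<bar>r n\<bar> \<le> \<bar>fn (Suc n)\<bar> / q"
  using q_le[of n] q_pos by (auto simp: r_def abs_div intro!: divide_left_mono mult_pos_pos)

lemma ev_r_le: "K n \<le> ev (Suc n) * \<bar>fn (Suc n)\<bar> / q"
  using mult_left_mono[OF r_le, of "ev (Suc n)" n] ev_Suc[of n] by simp

lemma summable_ev_r: "summable (\<lambda>n. K n)"
proof (rule summable_comparison_test)
  show "summable (\<lambda>n. ev (Suc n) * \<bar>fn (Suc n)\<bar> / q)" by (intro summable_divide summable_K)
  show "\<exists>N. \<forall>n\<ge>N. norm (K n) \<le> ev (Suc n) * \<bar>fn (Suc n)\<bar> / q"
    using ev_r_le by (simp add: abs_mult ev_nonneg)
qed

lemma r_le_ev_r: "\<bar>r n\<bar> \<le> K n"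
  using mult_right_mono[of 1 "ev (Suc n)" "\<bar>r n\<bar>"] ev_Suc[of n] by simp

lemma summable_majorized:
  assumes "\<And>n. \<bar>b n\<bar> \<le> C * K n"
  shows "summable b"
  using assms by (intro summable_comparison_test[OF _ summable_mult[OF summable_ev_r, of C]]) auto

definition S :: "real \<Rightarrow> real \<Rightarrow> real" where
  "S t x = (\<Sum>n. cf n t * r n * legendre_P (Suc n) x)"

definition U :: "real \<Rightarrow> real \<Rightarrow> real" where
  "U t x = t powr a / T powr a * fn 0 + v x + S t x"

definition h :: "real \<Rightarrow> real" where
  "h x = Gamma (a + 1) / T powr a * fn 0 - legendre_op v x + (\<Sum>n. d x n)"

lemma term_le: "x \<in> {-1..1} \<Longrightarrow> \<bar>cf n t * r n * legendre_P (Suc n) x\<bar> \<le> 1 * K n"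
proof -
  assume x: "x \<in> {-1..1}"
  have "\<bar>cf n t\<bar> * \<bar>r n\<bar> * \<bar>legendre_P (Suc n) x\<bar> \<le> 1 * \<bar>r n\<bar> * 1"
    using E_range[of "Suc n" t] by (intro mult_mono abs_legendre_P_le x) auto
  then show ?thesis using r_le_ev_r[of n] by (simp add: abs_mult)
qed

lemma evterm_le:
  assumes "x \<in> {-1..1}" "\<bar>c\<bar> \<le> 1"
  shows "\<bar>c * d x n\<bar> \<le> 1 * K n"
proof -
  have "\<bar>c\<bar> * (\<bar>ev (Suc n)\<bar> * \<bar>r n\<bar> * \<bar>legendre_P (Suc n) x\<bar>) \<le> 1 * (K n * 1)"
    using ev_Suc[of n] assms by (intro mult_mono abs_legendre_P_le) auto
  then show ?thesis by (simp add: abs_mult)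
qed

lemma continuous_on_E [continuous_intros]:
  "continuous_on A f \<Longrightarrow> (\<And>x. x \<in> A \<Longrightarrow> 0 \<le> f x) \<Longrightarrow> continuous_on A (\<lambda>x. E n (f x))"
  unfolding E_def mittag_leffler_eq using a
  by (intro continuous_on_mlf continuous_on_mult continuous_on_const continuous_on_powr') auto

lemma continuous_on_P_snd: "continuous_on A (\<lambda>p. legendre_P n (snd p))"
  by (rule continuous_on_compose2[OF continuous_on_legendre_P[of UNIV]]) (auto intro!: continuous_intros)

lemma continuous_U: "continuous_on ({0..T} \<times> {-1..1}) (\<lambda>(t, x). U t x)"
proof -
  have "continuous_on ({0..T} \<times> {-1..1}) (\<lambda>p. (\<Sum>n. cf n (fst p) * r n * legendre_P (Suc n) (snd p)))"
    using term_le summable_ev_r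
    by (intro continuous_on_suminf_majorant[of _ _ "\<lambda>n. 1 * K n"] continuous_on_mult continuous_on_diff continuous_on_const continuous_on_E
        continuous_on_P_snd continuous_on_fst continuous_on_id) auto
  moreover have "continuous_on ({0..T} \<times> {-1..1}) (\<lambda>p. v (snd p))"
    by (rule continuous_on_compose2[OF cv]) (auto intro!: continuous_intros)
  moreover have "continuous_on ({0..T} \<times> {-1..1}) (\<lambda>p. fst p powr a / T powr a * fn 0)"
    using a T by (intro continuous_on_mult continuous_on_divide continuous_on_const continuous_on_powr' continuous_on_fst continuous_on_id) auto
  ultimately show ?thesis
    unfolding U_def S_def case_prod_unfold by (intro continuous_on_add)
qed

lemma U_0: "U 0 x = v x"
  by (simp add: U_def S_def E_0)

text \<open>At t = T the quotients cancel, so \<open>S T\<close> is the Legendre series of w - v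
  without its constant mode; the t^a term restores that mode.\<close>

lemma U_T:
  assumes x: "x \<in> {-1..1}"
  shows "U T x = w x"
proof -
  have "(\<lambda>n. fn n * legendre_P n x) sums (w x - v x)"
    unfolding fn_eq by (intro legendre_expansion continuous_intros cw cv x) (use summable_fn in \<open>simp add: fn_eq\<close>)
  then have "(\<lambda>n. fn (Suc n) * legendre_P (Suc n) x) sums (w x - v x - fn 0 * legendre_P 0 x)"
    by (subst sums_Suc_iff) simp
  moreover have "(1 - E (Suc n) T) * r n = fn (Suc n)" for n
    using q_le[of n] q_pos by (simp add: r_def)
  ultimately have "S T x = w x - v x - fn 0 * legendre_P 0 x" by (simp add: S_def sums_iff)
  then show ?thesis using T by (simp add: U_def legendre_P_def)
qed

lemma v_derivs:
  assumes "x \<in> {-1<..<1}"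
  shows "(v has_real_derivative v1 x) (at x)" "deriv v x = v1 x"
    "((\<lambda>y. (1 - y\<^sup>2) * deriv v y) has_real_derivative legendre_op v x) (at x)"
    "legendre_op v x = (1 - x\<^sup>2) * v2 x - 2 * x * v1 x"
proof -
  have d: "(v has_real_derivative v1 x) (at x)" "(v1 has_real_derivative v2 x) (at x)" if "x \<in> {-1<..<1}" for x
    using Hv that by (auto simp: H4_derivs_def)
  show "(v has_real_derivative v1 x) (at x)" by (rule d(1)[OF assms])
  have dv: "deriv v x = v1 x" if "x \<in> {-1<..<1}" for x using d(1)[OF that] by (rule DERIV_imp_deriv)
  show "deriv v x = v1 x" by (rule dv[OF assms])
  have "((\<lambda>y. (1 - y\<^sup>2) * v1 y) has_real_derivative (1 - x\<^sup>2) * v2 x - 2 * x * v1 x) (at x)"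
    using d(2)[OF assms] by (auto intro!: derivative_eq_intros)
  then have D: "((\<lambda>y. (1 - y\<^sup>2) * deriv v y) has_real_derivative (1 - x\<^sup>2) * v2 x - 2 * x * v1 x) (at x)"
    by (rule has_field_derivative_transform_within_open[where S = "{-1<..<1}"]) (use dv assms in auto)
  show "legendre_op v x = (1 - x\<^sup>2) * v2 x - 2 * x * v1 x"
    unfolding legendre_op_def by (rule DERIV_imp_deriv[OF D])
  with D show "((\<lambda>y. (1 - y\<^sup>2) * deriv v y) has_real_derivative legendre_op v x) (at x)" by simp
qed

lemma continuous_legendre_op_v: "continuous_on {-1<..<1} (legendre_op v)"
proof -
  have "continuous_on {-1<..<1} v1" "continuous_on {-1<..<1} v2"
    using Hv by (auto simp: H4_derivs_def intro: continuous_on_subset)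
  then have "continuous_on {-1<..<1} (\<lambda>x. (1 - x\<^sup>2) * v2 x - 2 * x * v1 x)" by (intro continuous_intros)
  then show ?thesis by (rule continuous_on_cong[THEN iffD1, rotated -1]) (auto simp: v_derivs(4))
qed

lemma continuous_h: "continuous_on {-1<..<1} h"
proof -
  have "continuous_on {-1<..<1} (\<lambda>x. \<Sum>n. d x n)"
    using evterm_le[of _ 1] summable_ev_r
    by (intro continuous_on_suminf_majorant[of _ _ "\<lambda>n. 1 * K n"] continuous_intros) auto
  then show ?thesis unfolding h_def by (intro continuous_intros continuous_legendre_op_v)
qed

abbreviation "P' n \<equiv> poly (pderiv (legendre_poly n))"

lemma dterm_le:
  assumes x: "x \<in> {-1..1}"
  shows "\<bar>cf n t * r n * P' (Suc n) x\<bar> \<le> 1 * K n"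
proof -
  have "\<bar>cf n t\<bar> * \<bar>r n\<bar> * \<bar>P' (Suc n) x\<bar> \<le> 1 * \<bar>r n\<bar> * ev (Suc n)"
    using E_range[of "Suc n" t] abs_legendre_P'_le[OF x, of "Suc n"] ev_Suc[of n] by (intro mult_mono) auto
  then show ?thesis by (simp add: abs_mult mult.commute)
qed

lemma deriv_U:
  assumes x: "x \<in> {-1<..<1}"
  shows "(U t has_real_derivative v1 x + (\<Sum>n. cf n t * r n * P' (Suc n) x)) (at x)"
proof -
  have x': "x \<in> {-1..1}" using x by auto
  have "((\<lambda>x. \<Sum>n. cf n t * r n * legendre_P (Suc n) x) has_real_derivative (\<Sum>n. cf n t * r n * P' (Suc n) x)) (at x)"
  proof (rule has_real_derivative_suminf_majorant[where M = "\<lambda>n. 1 * K n", OF _ _ x])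
    show "summable (\<lambda>n. cf n t * r n * legendre_P (Suc n) x)" using term_le[OF x'] by (rule summable_majorized)
    show "((\<lambda>x. cf n t * r n * legendre_P (Suc n) x) has_real_derivative cf n t * r n * P' (Suc n) z) (at z)" for n z
      by (intro DERIV_cmult has_real_derivative_legendre_P)
  qed (use summable_ev_r dterm_le in auto)
  then have "((\<lambda>x. t powr a / T powr a * fn 0 + v x + S t x) has_real_derivative 0 + v1 x + (\<Sum>n. cf n t * r n * P' (Suc n) x)) (at x)"
    unfolding S_def by (intro DERIV_add DERIV_const v_derivs x)
  then show ?thesis by (simp add: U_def[abs_def])
qed

text \<open>The series is differentiated only after multiplication by 1 - x^2. By Legendre's
  equation each term then becomes - lambda_n P_n times its coefficient, still below the majorant,
  and no bound on P_n'' is needed.\<close>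

lemma legendre_op_U:
  assumes x: "x \<in> {-1<..<1}"
  shows "((\<lambda>y. (1 - y\<^sup>2) * deriv (U t) y) has_real_derivative legendre_op (U t) x) (at x)"
    "legendre_op (U t) x = legendre_op v x - (\<Sum>n. cf n t * d x n)"
proof -
  have sub: "{-1<..<1} \<subseteq> {-1..1::real}" by auto
  have s: "summable (\<lambda>n. cf n t * r n * P' (Suc n) y)" if "y \<in> {-1<..<1}" for y
    using dterm_le[of y] that sub by (intro summable_majorized[of _ 1]) auto
  have cle: "\<bar>cf n t\<bar> \<le> 1" for n using E_range[of "Suc n" t] by auto
  have "((\<lambda>y. \<Sum>n. cf n t * r n * ((1 - y\<^sup>2) * P' (Suc n) y)) has_real_derivative
     (\<Sum>n. - (cf n t * d x n))) (at x)"
  proof (rule has_real_derivative_suminf_majorant[where M = "\<lambda>n. 1 * K n", OF _ _ x])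
    show "summable (\<lambda>n. cf n t * r n * ((1 - x\<^sup>2) * P' (Suc n) x))"
      using summable_mult[OF s[OF x], of "1 - x\<^sup>2"] by (simp add: mult_ac)
    show "((\<lambda>y. cf n t * r n * ((1 - y\<^sup>2) * P' (Suc n) y)) has_real_derivative
        - (cf n t * d z n)) (at z)" for n z
    proof -
      have "((\<lambda>y. (1 - y\<^sup>2) * P' (Suc n) y) has_real_derivative (1 - z\<^sup>2) * poly (pderiv (pderiv
          (legendre_poly (Suc n)))) z - 2 * z * P' (Suc n) z) (at z)"
        by (auto intro!: derivative_eq_intros)
      from DERIV_cmult[OF this, of "cf n t * r n"] show ?thesis
        unfolding legendre_ode_at by (rule DERIV_cong) simp
    qed
    show "\<bar>- (cf n t * d z n)\<bar> \<le> 1 * K n" if "z \<in> {-1<..<1}" for n z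
      unfolding abs_minus_cancel using that sub cle by (intro evterm_le) auto
  qed (use summable_ev_r in auto)
  then have "((\<lambda>y. (1 - y\<^sup>2) * deriv v y + (\<Sum>n. cf n t * r n * ((1 - y\<^sup>2) * P' (Suc n) y))) has_real_derivative
     legendre_op v x + (\<Sum>n. - (cf n t * d x n))) (at x)"
    by (intro DERIV_add v_derivs x)
  moreover have "(\<Sum>n. - (cf n t * d x n)) = - (\<Sum>n. cf n t * d x n)"
    using x sub cle by (intro suminf_minus summable_majorized[of _ 1] evterm_le) auto
  ultimately have "((\<lambda>y. (1 - y\<^sup>2) * deriv v y + (\<Sum>n. cf n t * r n * ((1 - y\<^sup>2) * P' (Suc n) y))) has_real_derivative
     legendre_op v x - (\<Sum>n. cf n t * d x n)) (at x)" by simp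
  then have D: "((\<lambda>y. (1 - y\<^sup>2) * deriv (U t) y) has_real_derivative
     legendre_op v x - (\<Sum>n. cf n t * d x n)) (at x)"
  proof (rule has_field_derivative_transform_within_open[where S = "{-1<..<1}"])
    fix y :: real assume y: "y \<in> {-1<..<1}"
    have "(1 - y\<^sup>2) * (\<Sum>n. cf n t * r n * P' (Suc n) y) = (\<Sum>n. cf n t * r n * ((1 - y\<^sup>2) * P' (Suc n) y))"
      using suminf_mult[OF s[OF y], of "1 - y\<^sup>2"] by (simp add: mult_ac)
    then show "(1 - y\<^sup>2) * deriv v y + (\<Sum>n. cf n t * r n * ((1 - y\<^sup>2) * P' (Suc n) y)) = (1 - y\<^sup>2) * deriv (U t) y"
      unfolding DERIV_imp_deriv[OF deriv_U[OF y]] v_derivs(2)[OF y] by (simp only: distrib_left)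
  qed (use x in auto)
  show "legendre_op (U t) x = legendre_op v x - (\<Sum>n. cf n t * d x n)"
    unfolding legendre_op_def[of "U t"] by (rule DERIV_imp_deriv[OF D])
  with D show "((\<lambda>y. (1 - y\<^sup>2) * deriv (U t) y) has_real_derivative legendre_op (U t) x) (at x)" by simp
qed

lemma continuous_legendre_op_U: "continuous_on ({0<..<T} \<times> {-1<..<1}) (\<lambda>(t, x). legendre_op (U t) x)"
proof -
  have "continuous_on ({0<..<T} \<times> {-1<..<1}) (\<lambda>p. \<Sum>n. cf n (fst p) * d (snd p) n)"
  proof (rule continuous_on_suminf_majorant[of _ _ "\<lambda>n. 1 * K n"])
    show "\<bar>cf n (fst p) * d (snd p) n\<bar> \<le> 1 * K n"
      if "p \<in> {0<..<T} \<times> {-1<..<1}" for n p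
      using that E_range[of "Suc n" "fst p"] by (intro evterm_le) auto
    show "continuous_on ({0<..<T} \<times> {-1<..<1}) (\<lambda>p. cf n (fst p) * d (snd p) n)" for n
      by (intro continuous_on_mult continuous_on_diff continuous_on_const continuous_on_E continuous_on_P_snd continuous_on_fst continuous_on_id) auto
  qed (use summable_ev_r in auto)
  moreover have "continuous_on ({0<..<T} \<times> {-1<..<1}) (\<lambda>p. legendre_op v (snd p))"
    by (rule continuous_on_compose2[OF continuous_legendre_op_v]) (auto intro!: continuous_intros)
  ultimately have "continuous_on ({0<..<T} \<times> {-1<..<1}) (\<lambda>p. legendre_op v (snd p) - (\<Sum>n. cf n (fst p) * d (snd p) n))"
    by (intro continuous_on_diff)
  then show ?thesis
    by (rule continuous_on_cong[THEN iffD1, rotated -1]) (auto simp: legendre_op_U)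
qed

text \<open>The upper bound is the same for all n, so the singular time kernels cost nothing in the
  summation over n.\<close>

lemma mlk_ev_le: "0 < s \<Longrightarrow> 0 \<le> mlk a (ev n) a s" "0 < s \<Longrightarrow> mlk a (ev n) a s \<le> pker a s"
  using mlf_nonneg[of a a "ev n * s powr a"] mlf_le[of a a "ev n * s powr a"] a
    mult_left_mono[of "mlf a a (- ev n * s powr a)" "1 / Gamma a" "s powr (a - 1)"]
  by (auto simp: mlk_def pker_def legendre_eigenvalue_def)

lemma d_le: "x \<in> {-1..1} \<Longrightarrow> \<bar>d x n\<bar> \<le> K n"
  using evterm_le[of x 1 n] by simp

lemma summable_d: "x \<in> {-1..1} \<Longrightarrow> summable (\<lambda>n. \<bar>d x n\<bar>)"
  using d_le by (intro summable_majorized[of _ 1]) auto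

lemma time_deriv_U:
  assumes s: "0 < s" and x: "x \<in> {-1..1}"
  shows "((\<lambda>s. U s x) has_real_derivative
     Gamma (a + 1) / T powr a * fn 0 * pker a s + (\<Sum>n. d x n * mlk a (ev (Suc n)) a s)) (at s)"
proof -
  have "((\<lambda>s. \<Sum>n. cf n s * r n * legendre_P (Suc n) x) has_real_derivative (\<Sum>n. d x n * mlk a (ev (Suc n)) a s)) (at s)"
  \<comment> \<open>The differentiated terms blow up like s^(a-1) at 0. Cutting at s / 2 bounds them
    by the constant \<open>pker a (s / 2)\<close> times the majorant.\<close>
  proof (rule has_real_derivative_suminf_majorant[where M = "\<lambda>n. pker a (s / 2) * K n" and S = "{s / 2<..}"])
    show "((\<lambda>s. cf n s * r n * legendre_P (Suc n) x) has_real_derivative d x n * mlk a (ev (Suc n)) a z) (at z)"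
      if "z \<in> {s / 2<..}" for n z
    proof -
      have z: "0 < z" using that s by simp
      have "((\<lambda>s. (1 - mlk a (ev (Suc n)) 1 s) * r n * legendre_P (Suc n) x) has_real_derivative
         (0 - (- ev (Suc n) * mlk a (ev (Suc n)) a z)) * r n * legendre_P (Suc n) x) (at z)"
        by (intro DERIV_cmult_right DERIV_diff DERIV_const mlk_1_deriv a z)
      then have "((\<lambda>s. (1 - mlk a (ev (Suc n)) 1 s) * r n * legendre_P (Suc n) x) has_real_derivative d x n * mlk a (ev (Suc n)) a z) (at z)"
        by (rule DERIV_cong) simp
      then show ?thesis
        by (rule has_field_derivative_transform_within_open[where S = "{0<..}"]) (use z in \<open>auto simp: E_def mlk_def mittag_leffler_eq\<close>)
    qed
    show "\<bar>d x n * mlk a (ev (Suc n)) a z\<bar> \<le> pker a (s / 2) * K n" if z: "z \<in> {s / 2<..}" for n z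
    proof -
      have "mlk a (ev (Suc n)) a z \<le> pker a z" using z s by (intro mlk_ev_le) auto
      also have "\<dots> \<le> pker a (s / 2)"
        using z s a by (auto simp: pker_def Gamma_real_pos less_imp_le intro!: divide_right_mono powr_mono2')
      finally have "\<bar>d x n\<bar> * mlk a (ev (Suc n)) a z \<le> (K n) * pker a (s / 2)"
        using d_le[OF x, of n] mlk_ev_le(1)[of z "Suc n"] z s by (intro mult_mono) auto
      then show ?thesis using mlk_ev_le(1)[of z "Suc n"] z s by (simp add: abs_mult mult.commute)
    qed
    show "summable (\<lambda>n. cf n s * r n * legendre_P (Suc n) x)" using term_le[OF x] by (rule summable_majorized)
  qed (use s summable_ev_r in \<open>auto intro: summable_mult\<close>)
  moreover have "((\<lambda>s. s powr a / T powr a * fn 0 + v x) has_real_derivative Gamma (a + 1) / T powr a * fn 0 * pker a s) (at s)"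
  proof -
    have "((\<lambda>s. s powr a / T powr a * fn 0 + v x) has_real_derivative (a * s powr (a - 1)) / T powr a * fn 0) (at s)"
      using s T by (auto intro!: derivative_eq_intros)
    moreover have "Gamma (a + 1) = a * Gamma a" using a by (intro Gamma_plus1) (auto elim!: nonpos_Ints_cases)
    moreover have "Gamma a > 0" using a by (simp add: Gamma_real_pos)
    ultimately show ?thesis by (elim DERIV_cong) (simp add: pker_def)
  qed
  ultimately show ?thesis unfolding U_def S_def by (rule DERIV_add[rotated])
qed

text \<open>J^{1-a} sends \<open>pker a\<close> to 1 and \<open>mlk a (ev n) a\<close> to
  \<open>E n\<close>. The Caputo derivative is thus a constant plus the sum of d E_n, and writing
  E_n = 1 - (1 - E_n) splits that sum into the series in \<open>h\<close> and the one in
  \<open>legendre_op (U t)\<close>.\<close>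

lemma caputo_U:
  assumes t: "0 < t" and x: "x \<in> {-1<..<1}"
  shows "caputo_exists a (\<lambda>s. U s x) t" "caputo a (\<lambda>s. U s x) t = legendre_op (U t) x + h x"
proof -
  let ?k = "pker (1 - a)" and ?c = "Gamma (a + 1) / T powr a * fn 0"
  have x': "x \<in> {-1..1}" using x by auto
  have dU: "deriv (\<lambda>s. U s x) s = ?c * pker a s + 1 * (\<Sum>n. d x n * mlk a (ev (Suc n)) a s)" if "0 < s" for s
    using DERIV_imp_deriv[OF time_deriv_U[OF that x']] by simp
  have k: "conv_integrable ?k (pker a) t" "conv ?k (pker a) t = 1"
    using conv_pker[of "1 - a" a t] a t by (auto simp: pker_1)
  have kE: "conv_integrable ?k (mlk a (ev n) a) t" "conv ?k (mlk a (ev n) a) t = E n t" for n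
    using conv_mlk[of a a "1 - a" t "ev n"] a t by (auto simp: E_def mlk_def mittag_leffler_eq)
  have sm: "summable (\<lambda>n. \<bar>d x n\<bar> * mlk a (ev (Suc n)) a s)" if s: "0 < s" for s
  proof (rule summable_comparison_test[OF _ summable_mult[OF summable_d[OF x'], of "pker a s"]])
    have "\<bar>d x n\<bar> * mlk a (ev (Suc n)) a s \<le> pker a s * \<bar>d x n\<bar>" for n
      using mult_right_mono[OF mlk_ev_le(2)[OF s, of "Suc n"], of "\<bar>d x n\<bar>"] by (simp add: mult.commute)
    then show "\<exists>N. \<forall>n\<ge>N. norm (\<bar>d x n\<bar> * mlk a (ev (Suc n)) a s) \<le> pker a s * \<bar>d x n\<bar>"
      using mlk_ev_le(1)[OF s] by (simp add: abs_mult)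
  qed
  have D: "conv_integrable ?k (\<lambda>s. \<Sum>n. d x n * mlk a (ev (Suc n)) a s) t"
    "conv ?k (\<lambda>s. \<Sum>n. d x n * mlk a (ev (Suc n)) a s) t = (\<Sum>n. d x n * conv ?k (mlk a (ev (Suc n)) a) t)"
    by (rule conv_suminf[where B = 1]; use a mlk_ev_le kE E_range summable_d[OF x'] sm in \<open>auto intro!: pker_nonneg\<close>)+
  have "conv ?k (deriv (\<lambda>s. U s x)) t = conv ?k (\<lambda>s. ?c * pker a s + 1 * (\<Sum>n. d x n * mlk a (ev (Suc n)) a s)) t"
    by (rule conv_cong(1)) (use dU in auto)
  also have "\<dots> = ?c + (\<Sum>n. d x n * E (Suc n) t)"
    by (subst conv_add[OF k(1) D(1)]) (simp add: k D kE)
  also have "(\<Sum>n. d x n * E (Suc n) t) = (\<Sum>n. d x n - cf n t * d x n)" by (simp add: algebra_simps)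
  also have "\<dots> = (\<Sum>n. d x n) - (\<Sum>n. cf n t * d x n)"
  proof (rule suminf_diff[symmetric])
    show "summable (\<lambda>n. d x n)" using summable_d[OF x'] by (rule summable_rabs_cancel)
    show "summable (\<lambda>n. cf n t * d x n)"
      using E_range[of "Suc _" t] by (intro summable_majorized[of _ 1] evterm_le x') auto
  qed
  finally show "caputo a (\<lambda>s. U s x) t = legendre_op (U t) x + h x"
    unfolding caputo_eq_conv[OF a] legendre_op_U(2)[OF x] h_def by simp
  have "conv_integrable ?k (\<lambda>s. ?c * pker a s + 1 * (\<Sum>n. d x n * mlk a (ev (Suc n)) a s)) t"
    using Bochner_Integration.integrable_add[OF integrable_mult_right[OF k(1)[unfolded conv_integrable_def], of ?c] D(1)[unfolded
        conv_integrable_def]]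
    unfolding conv_integrable_def by (simp add: algebra_simps)
  then have "conv_integrable ?k (deriv (\<lambda>s. U s x)) t"
    by (rule conv_cong(2)[THEN iffD2, rotated -1]) (use dU in auto)
  moreover have "(\<lambda>s. U s x) differentiable (at s)" if "0 < s" for s
    using time_deriv_U[OF that x'] by (auto simp: real_differentiable_def)
  ultimately show "caputo_exists a (\<lambda>s. U s x) t"
    unfolding caputo_exists_iff[OF a] by auto
qed

text \<open>The time factors lie in [0,1], so U_x is bounded by a bound for v' plus the sum of the
  majorant, on the whole rectangle and not only near x = -1, 1.\<close>

lemma U_bounded: "\<exists>M. \<forall>t\<in>{0<..<T}. \<forall>x\<in>{-1<..<1}. \<bar>U t x\<bar> \<le> M \<and> \<bar>deriv (U t) x\<bar> \<le> M"
proof -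
  have "bounded ((\<lambda>(t, x). U t x) ` ({0..T} \<times> {-1..1}))"
    by (intro compact_imp_bounded compact_continuous_image continuous_U compact_Times compact_Icc)
  then obtain M1 where M1: "\<And>z. z \<in> (\<lambda>(t, x). U t x) ` ({0..T} \<times> {-1..1}) \<Longrightarrow> norm z \<le> M1"
    unfolding bounded_iff by blast
  have "bounded (v1 ` {-1..1})"
    using Hv by (intro compact_imp_bounded compact_continuous_image compact_Icc) (auto simp: H4_derivs_def)
  then obtain M2 where M2: "\<And>z. z \<in> v1 ` {-1..1} \<Longrightarrow> norm z \<le> M2"
    unfolding bounded_iff by blast
  define M where "M = max M1 (M2 + (\<Sum>n. K n))"
  have "\<bar>U t x\<bar> \<le> M" if "t \<in> {0<..<T}" "x \<in> {-1<..<1}" for t x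
  proof -
    have "U t x \<in> (\<lambda>(t, x). U t x) ` ({0..T} \<times> {-1..1})" using that by force
    from M1[OF this] show ?thesis by (simp add: M_def)
  qed
  moreover have "\<bar>deriv (U t) x\<bar> \<le> M" if "x \<in> {-1<..<1}" for t x
  proof -
    have x': "x \<in> {-1..1}" using that by auto
    have le: "\<bar>cf n t * r n * P' (Suc n) x\<bar> \<le> K n" for n using dterm_le[OF x', of n t] by simp
    then have s: "summable (\<lambda>n. \<bar>cf n t * r n * P' (Suc n) x\<bar>)" by (intro summable_majorized[of _ 1]) simp
    have "\<bar>\<Sum>n. cf n t * r n * P' (Suc n) x\<bar> \<le> (\<Sum>n. \<bar>cf n t * r n * P' (Suc n) x\<bar>)"
      by (rule summable_rabs[OF s])
    also have "\<dots> \<le> (\<Sum>n. K n)" by (rule suminf_le[OF le s summable_ev_r])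
    finally have "\<bar>v1 x + (\<Sum>n. cf n t * r n * P' (Suc n) x)\<bar> \<le> M2 + (\<Sum>n. K n)"
      using M2[of "v1 x"] x' by simp
    then show ?thesis unfolding DERIV_imp_deriv[OF deriv_U[OF that]] by (simp add: M_def)
  qed
  ultimately show ?thesis by blast
qed

lemma solution: "inverse_source_solution a T v w U h"
proof -
  obtain M where "\<forall>t\<in>{0<..<T}. \<forall>x\<in>{-1<..<1}. \<bar>U t x\<bar> \<le> M \<and> \<bar>deriv (U t) x\<bar>
      \<le> M" using U_bounded by blast
  then have "\<exists>\<delta>>0. \<exists>M. \<forall>t\<in>{0<..<T}. \<forall>x\<in>{-1<..<1}. 1 - \<delta> < \<bar>x\<bar>
      \<longrightarrow> \<bar>U t x\<bar> \<le> M \<and> \<bar>deriv (U t) x\<bar> \<le> M"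
    by (intro exI[of _ 1]) auto
  moreover have "U t differentiable (at x)" "(\<lambda>y. (1 - y\<^sup>2) * deriv (U t) y) differentiable (at x)" if "x \<in> {-1<..<1}" for t x
    using deriv_U[OF that] legendre_op_U(1)[OF that] by (auto simp: real_differentiable_def)
  ultimately show ?thesis
    unfolding inverse_source_solution_def
    using continuous_U continuous_legendre_op_U continuous_h caputo_U U_0 U_T by auto
qed

end

section \<open>Linearity and conclusion\<close>

text \<open>The problem is linear, but \<open>deriv\<close> and the integral are total functions
  that are additive only where derivatives and integrals exist. Each difference therefore draws on
  the existence clauses in the notion of solution.\<close>

lemma inverse_source_solution_diff:
  assumes a: "0 < a" "a < 1"
    and 1: "inverse_source_solution a T v w U h" and 2: "inverse_source_solution a T v w U' h'"
  shows "inverse_source_solution a T (\<lambda>_. 0) (\<lambda>_. 0) (\<lambda>t x. U' t x - U t x) (\<lambda>x. h' x - h x)"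
proof -
  note S1 = 1[unfolded inverse_source_solution_def] and S2 = 2[unfolded inverse_source_solution_def]
  have dx: "deriv (\<lambda>x. U' t x - U t x) x = deriv (U' t) x - deriv (U t) x" "(\<lambda>x. U' t x - U t x) differentiable (at x)"
    if "t \<in> {0<..<T}" "x \<in> {-1<..<1}" for t x
    using S1 S2 that by (auto intro!: DERIV_imp_deriv DERIV_diff simp: DERIV_deriv_iff_real_differentiable)
  have L: "((\<lambda>y. (1 - y\<^sup>2) * deriv (\<lambda>x. U' t x - U t x) y) has_real_derivative legendre_op (U' t) x -
      legendre_op (U t) x) (at x)"
    if t: "t \<in> {0<..<T}" and x: "x \<in> {-1<..<1}" for t x
  proof -
    have "((\<lambda>y. (1 - y\<^sup>2) * deriv (U' t) y - (1 - y\<^sup>2) * deriv (U t) y) has_real_derivative legendre_op (U'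
        t) x - legendre_op (U t) x) (at x)"
      using S1 S2 t x unfolding legendre_op_def by (intro DERIV_diff) (auto simp: DERIV_deriv_iff_real_differentiable)
    then show ?thesis
      by (rule has_field_derivative_transform_within_open[where S = "{-1<..<1}"]) (use x dx(1)[OF t] in \<open>auto simp: right_diff_distrib\<close>)
  qed
  then have L': "legendre_op (\<lambda>x. U' t x - U t x) x = legendre_op (U' t) x - legendre_op (U t) x" if "t \<in> {0<..<T}"
      "x \<in> {-1<..<1}" for t x
    unfolding legendre_op_def[of "\<lambda>x. U' t x - U t x"] using that by (intro DERIV_imp_deriv) auto
  have C: "caputo_exists a (\<lambda>s. U' s x - U s x) t" "caputo a (\<lambda>s. U' s x - U s x) t = caputo a (\<lambda>s. U' s
      x) t - caputo a (\<lambda>s. U s x) t"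
    if t: "t \<in> {0<..<T}" and x: "x \<in> {-1<..<1}" for t x
  proof -
    let ?k = "pker (1 - a)"
    have E: "caputo_exists a (\<lambda>s. U s x) t" "caputo_exists a (\<lambda>s. U' s x) t" using S1 S2 t x by blast+
    have ds: "deriv (\<lambda>s. U' s x - U s x) s = 1 * deriv (\<lambda>s. U' s x) s + (- 1) * deriv (\<lambda>s. U s x) s"
      "(\<lambda>s. U' s x - U s x) differentiable (at s)" if "0 < s" "s < t" for s
      using E that unfolding caputo_exists_iff[OF a]
      by (auto intro!: DERIV_imp_deriv DERIV_diff simp: DERIV_deriv_iff_real_differentiable)
    have i: "conv_integrable ?k (deriv (\<lambda>s. U' s x)) t" "conv_integrable ?k (deriv (\<lambda>s. U s x)) t"
      using E unfolding caputo_exists_iff[OF a] by auto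
    have "conv_integrable ?k (\<lambda>s. 1 * deriv (\<lambda>s. U' s x) s + (- 1) * deriv (\<lambda>s. U s x) s) t"
      using Bochner_Integration.integrable_diff[OF i[unfolded conv_integrable_def]]
      unfolding conv_integrable_def by (simp add: algebra_simps)
    then have "conv_integrable ?k (deriv (\<lambda>s. U' s x - U s x)) t"
      by (rule conv_cong(2)[THEN iffD2, rotated -1]) (use ds in auto)
    then show "caputo_exists a (\<lambda>s. U' s x - U s x) t" unfolding caputo_exists_iff[OF a] using ds by auto
    have "conv ?k (deriv (\<lambda>s. U' s x - U s x)) t = conv ?k (\<lambda>s. 1 * deriv (\<lambda>s. U' s x) s + (- 1) * deriv
        (\<lambda>s. U s x) s) t"
      by (rule conv_cong(1)) (use ds in auto)
    then show "caputo a (\<lambda>s. U' s x - U s x) t = caputo a (\<lambda>s. U' s x) t - caputo a (\<lambda>s. U s x) t"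
      unfolding caputo_eq_conv[OF a] conv_add[OF i] by simp
  qed
  from S1 obtain \<delta> M where B1: "\<delta> > 0"
    "\<And>t x. t \<in> {0<..<T} \<Longrightarrow> x \<in> {-1<..<1} \<Longrightarrow> 1 - \<delta> < \<bar>x\<bar>
        \<Longrightarrow> \<bar>U t x\<bar> \<le> M \<and> \<bar>deriv (U t) x\<bar> \<le> M"
    by blast
  from S2 obtain \<delta>' M' where B2: "\<delta>' > 0"
    "\<And>t x. t \<in> {0<..<T} \<Longrightarrow> x \<in> {-1<..<1} \<Longrightarrow> 1 - \<delta>' < \<bar>x\<bar>
        \<Longrightarrow> \<bar>U' t x\<bar> \<le> M' \<and> \<bar>deriv (U' t) x\<bar> \<le> M'"
    by blast
  have "\<bar>U' t x - U t x\<bar> \<le> M' + M \<and> \<bar>deriv (\<lambda>x. U' t x - U t x) x\<bar> \<le> M' + M"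
    if tx: "t \<in> {0<..<T}" "x \<in> {-1<..<1}" "1 - min \<delta> \<delta>' < \<bar>x\<bar>" for t x
  proof -
    have "\<bar>U t x\<bar> \<le> M" "\<bar>deriv (U t) x\<bar> \<le> M" "\<bar>U' t x\<bar> \<le> M'" "\<bar>deriv (U' t) x\<bar> \<le> M'"
      using B1(2)[OF tx(1,2)] B2(2)[OF tx(1,2)] tx(3) by auto
    then show ?thesis unfolding dx(1)[OF tx(1,2)] by linarith
  qed
  moreover have "0 < min \<delta> \<delta>'" using B1(1) B2(1) by simp
  ultimately have B': "\<exists>\<delta>>0. \<exists>M. \<forall>t\<in>{0<..<T}. \<forall>x\<in>{-1<..<1}. 1 - \<delta> <
      \<bar>x\<bar> \<longrightarrow>
        \<bar>U' t x - U t x\<bar> \<le> M \<and> \<bar>deriv (\<lambda>x. U' t x - U t x) x\<bar> \<le> M"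
    by blast
  have c1: "continuous_on ({0..T} \<times> {-1..1}) (\<lambda>(t, x). U' t x - U t x)"
  proof -
    have "continuous_on ({0..T} \<times> {-1..1}) (\<lambda>p. (\<lambda>(t, x). U' t x) p - (\<lambda>(t, x). U t x) p)"
      using S1 S2 by (intro continuous_on_diff) auto
    then show ?thesis by (simp add: case_prod_unfold)
  qed
  have c2: "continuous_on ({0<..<T} \<times> {-1<..<1}) (\<lambda>(t, x). legendre_op (\<lambda>x. U' t x - U t x) x)"
  proof -
    have "continuous_on ({0<..<T} \<times> {-1<..<1}) (\<lambda>p. (\<lambda>(t, x). legendre_op (U' t) x) p - (\<lambda>(t, x).
        legendre_op (U t) x) p)"
      using S1 S2 by (intro continuous_on_diff) auto
    then show ?thesis by (rule continuous_on_cong[THEN iffD1, rotated -1]) (auto simp: L')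
  qed
  have c3: "continuous_on {-1<..<1} (\<lambda>x. h' x - h x)" using S1 S2 by (intro continuous_on_diff) auto
  have "caputo_exists a (\<lambda>s. U' s x - U s x) t \<and> (\<lambda>x. U' t x - U t x) differentiable (at x) \<and>
      (\<lambda>y. (1 - y\<^sup>2) * deriv (\<lambda>x. U' t x - U t x) y) differentiable (at x) \<and>
      caputo a (\<lambda>s. U' s x - U s x) t = legendre_op (\<lambda>x. U' t x - U t x) x + (h' x - h x)"
    if "t \<in> {0<..<T}" "x \<in> {-1<..<1}" for t x
  proof (intro conjI)
    show "(\<lambda>y. (1 - y\<^sup>2) * deriv (\<lambda>x. U' t x - U t x) y) differentiable (at x)"
      using L[OF that] by (auto simp: real_differentiable_def)
    have "caputo a (\<lambda>s. U s x) t = legendre_op (U t) x + h x" "caputo a (\<lambda>s. U' s x) t = legendre_op (U' t) x + h' x"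
      using S1 S2 that by blast+
    then show "caputo a (\<lambda>s. U' s x - U s x) t = legendre_op (\<lambda>x. U' t x - U t x) x + (h' x - h x)"
      using that by (simp add: C L')
  qed (use C dx that in auto)
  moreover have "\<forall>x\<in>{-1..1}. U' 0 x - U 0 x = 0" "\<forall>x\<in>{-1..1}. U' T x - U T x = 0" using S1 S2 by auto
  ultimately show ?thesis
    unfolding inverse_source_solution_def using c1 c2 c3 B' by blast
qed

theorem theorem8:
  fixes \<alpha> T :: real and v w :: "real \<Rightarrow> real"
  assumes "0 < \<alpha>" and "\<alpha> < 1" and "0 < T"
    and "continuous_on {-1..1} v" and "continuous_on {-1..1} w"
    and "C_k_on 3 {-1<..<1} v" and "C_k_on 3 {-1<..<1} w"
    and "deriv_in_L2 (-1) 1 ((deriv ^^ 3) v)" and "deriv_in_L2 (-1) 1 ((deriv ^^ 3) w)"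
  defines "vn \<equiv> legendre_coeff v" and "wn \<equiv> legendre_coeff w" and "ev \<equiv> legendre_eigenvalue"
  shows "\<exists>U h.
    inverse_source_solution \<alpha> T v w U h \<and>
    (\<forall>U' h'. inverse_source_solution \<alpha> T v w U' h' \<longrightarrow>
       (\<forall>t\<in>{0..T}. \<forall>x\<in>{-1..1}. U' t x = U t x) \<and> (\<forall>x\<in>{-1<..<1}. h' x = h x)) \<and>
    (\<forall>t\<in>{0..T}. \<forall>x\<in>{-1..1}.
       summable (\<lambda>n. (1 - mittag_leffler \<alpha> (- ev (Suc n) * t powr \<alpha>))
          / (1 - mittag_leffler \<alpha> (- ev (Suc n) * T powr \<alpha>))
          * (wn (Suc n) - vn (Suc n)) * legendre_P (Suc n) x) \<and>
       U t x = t powr \<alpha> / T powr \<alpha> * (wn 0 - vn 0) + v x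
         + (\<Sum>n. (1 - mittag_leffler \<alpha> (- ev (Suc n) * t powr \<alpha>))
              / (1 - mittag_leffler \<alpha> (- ev (Suc n) * T powr \<alpha>))
              * (wn (Suc n) - vn (Suc n)) * legendre_P (Suc n) x)) \<and>
    (\<forall>x\<in>{-1<..<1}.
       summable (\<lambda>n. ev (Suc n) * ((wn (Suc n) - vn (Suc n))
          / (1 - mittag_leffler \<alpha> (- ev (Suc n) * T powr \<alpha>))) * legendre_P (Suc n) x) \<and>
       h x = Gamma (\<alpha> + 1) / T powr \<alpha> * (wn 0 - vn 0)
         - deriv (\<lambda>y. (1 - y\<^sup>2) * deriv v y) x
         + (\<Sum>n. ev (Suc n) * ((wn (Suc n) - vn (Suc n))
              / (1 - mittag_leffler \<alpha> (- ev (Suc n) * T powr \<alpha>))) * legendre_P (Suc n) x))"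
proof -
  obtain v1 v2 v3 gv where Hv: "H4_derivs v v1 v2 v3 gv" using H4_derivs_exist[OF assms(4,6,8)] by blast
  obtain w1 w2 w3 gw where Hw: "H4_derivs w w1 w2 w3 gw" using H4_derivs_exist[OF assms(5,7,9)] by blast
  interpret D: inverse_source_data \<alpha> T v v1 v2 v3 gv w w1 w2 w3 gw
    by unfold_locales (use assms(1-3) Hv Hw in auto)
  have uniq: "(\<forall>t\<in>{0..T}. \<forall>x\<in>{-1..1}. U' t x = D.U t x) \<and> (\<forall>x\<in>{-1<..<1}. h' x = D.h x)"
    if "inverse_source_solution \<alpha> T v w U' h'" for U' h'
  proof -
    interpret homogeneous_problem \<alpha> T "\<lambda>t x. U' t x - D.U t x" "\<lambda>x. h' x - D.h x"
      using inverse_source_solution_diff[OF assms(1,2) D.solution that] assms(1-3) by unfold_locales auto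
    show ?thesis using u_eq_0 h_eq_0 by simp
  qed
  have c: "(1 - mittag_leffler \<alpha> (- ev (Suc n) * t powr \<alpha>)) / (1 - mittag_leffler \<alpha> (- ev (Suc n) * T powr \<alpha>))
      * (wn (Suc n) - vn (Suc n)) * legendre_P (Suc n) x = D.cf n t * D.r n * legendre_P (Suc n) x" for n t x
    by (simp add: D.E_def D.r_def D.fn_def vn_def wn_def ev_def)
  have e: "ev (Suc n) * ((wn (Suc n) - vn (Suc n)) / (1 - mittag_leffler \<alpha> (- ev (Suc n) * T powr \<alpha>))) * legendre_P (Suc n) x
      = D.d x n" for n x
    by (simp add: D.E_def D.r_def D.fn_def vn_def wn_def ev_def)
  have f0: "wn 0 - vn 0 = D.fn 0" by (simp add: D.fn_def vn_def wn_def)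
  show ?thesis
    unfolding c e f0
  proof (intro exI[of _ D.U] exI[of _ D.h] conjI ballI allI impI)
    show "inverse_source_solution \<alpha> T v w D.U D.h" by (rule D.solution)
    show "summable (\<lambda>n. D.cf n t * D.r n * legendre_P (Suc n) x)" if "x \<in> {-1..1}" for t x
      using D.term_le[OF that] by (rule D.summable_majorized)
    show "D.U t x = t powr \<alpha> / T powr \<alpha> * D.fn 0 + v x + (\<Sum>n. D.cf n t * D.r n * legendre_P (Suc n) x)" for t x
      unfolding D.U_def D.S_def ..
    show "summable (D.d x)" if "x \<in> {-1<..<1}" for x
      using D.summable_d[of x] that by (intro summable_rabs_cancel[of "D.d x"]) auto
    show "D.h x = Gamma (\<alpha> + 1) / T powr \<alpha> * D.fn 0 - deriv (\<lambda>y. (1 - y\<^sup>2) * deriv v y) x + (\<Sum>n. D.d x n)" for x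
      unfolding D.h_def legendre_op_def ..
  qed (use uniq in blast)+
qed

end
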